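(* Let $P$ be a set of $n$ points in $\mathbb{R}^d$ ($d$ not assumed constant). There is a family of sets $\mathcal{P}=\{P_i\mid i\in I\}$ and a data structure with the following properties: (i) $P_i\subseteq P$ for each $i\in I$; (ii) $\sum_{i\in I}|P_i|=O(nd\cdot B(n,d))$; (iii) for each axis-parallel box $R\subseteq\mathbb{R}^d$, the data structure finds in $O(2^d B(n,d))$ time a set of indices $I_R\subseteq I$ with $|I_R|=O(2^dB(n,d))$ such that $P\cap R$ is the disjoint union of the sets $P_i$, $i\in I_R$; (iv) the family $\mathcal{P}$ and the data structure can be computed in $O(nd\cdot B(n,d))$ time.
   Context: $B(n,d)=\binom{d+\lceil\log n\rceil}{d}$. A box in $\mathbb{R}^d$ is a product of $d$ intervals, each possibly infinite, open or closed. The model of computation is the Word RAM. *)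

theory Defs
  imports "HOL-Analysis.Analysis"
begin

unbundle bit_operations_syntax

definition B :: "nat \<Rightarrow> nat \<Rightarrow> nat" where
  "B n d = (d + nat \<lceil>log 2 (real n)\<rceil>) choose d"

text \<open>Since the dimension is a quantified number, a point of \<open>d\<close>-space is a real list of length \<open>d\<close>.\<close>

definition points :: "nat \<Rightarrow> real list set" where
  "points d = {x. length x = d}"

definition axis_parallel_box :: "nat \<Rightarrow> real list set \<Rightarrow> bool" where
  "axis_parallel_box d R \<longleftrightarrow>
     (\<exists>J. (\<forall>j<d. is_interval (J j)) \<and> R = {x \<in> points d. \<forall>j<d. x ! j \<in> J j})"


text \<open>
  A Word RAM with \<open>w\<close>-bit words. A configuration consists of word registers, a word memory addressed
  by words, and a coordinate memory, also addressed by words, whose cells hold real coordinates.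
  Coordinates are atomic: they can only be copied and compared, and in particular no real number can
  be converted to a word, so no information can be packed into reals. Control flow is structured
  instead of by jumps; every instruction and every evaluation of a test costs one step.
  A program is a finite object that depends neither on the word size nor on the input.
\<close>

record config =
  reg :: "nat \<Rightarrow> nat"
  mem :: "nat \<Rightarrow> nat"
  crd :: "nat \<Rightarrow> real"

datatype binop = Add | Sub | Mul | Div | Mod | BAnd | BOr | BXor | Shl | Shr

fun apply_binop :: "nat \<Rightarrow> binop \<Rightarrow> nat \<Rightarrow> nat \<Rightarrow> nat" where
  "apply_binop w Add a b = (a + b) mod 2 ^ w"
| "apply_binop w Sub a b = nat ((int a - int b) mod 2 ^ w)"
| "apply_binop w Mul a b = (a * b) mod 2 ^ w"
| "apply_binop w Div a b = a div b"
| "apply_binop w Mod a b = a mod b"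
| "apply_binop w BAnd a b = a AND b"
| "apply_binop w BOr a b = a OR b"
| "apply_binop w BXor a b = a XOR b"
| "apply_binop w Shl a b = push_bit b a mod 2 ^ w"
| "apply_binop w Shr a b = drop_bit b a"

datatype instr =
    Const nat nat             \<comment> \<open>\<open>Const r k\<close>: register \<open>r\<close> gets the constant \<open>k\<close>\<close>
  | Binop nat binop nat nat   \<comment> \<open>\<open>Binop r f r1 r2\<close>: register \<open>r\<close> gets \<open>f\<close> of registers \<open>r1\<close>, \<open>r2\<close>\<close>
  | Load nat nat              \<comment> \<open>\<open>Load r a\<close>: register \<open>r\<close> gets the word at the address in register \<open>a\<close>\<close>
  | Store nat nat             \<comment> \<open>\<open>Store a r\<close>: register \<open>r\<close> is written to the address in register \<open>a\<close>\<close>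
  | Copy nat nat              \<comment> \<open>\<open>Copy a b\<close>: coordinate at the address in \<open>b\<close> copied to that in \<open>a\<close>\<close>

fun exec_instr :: "nat \<Rightarrow> instr \<Rightarrow> config \<Rightarrow> config" where
  "exec_instr w (Const r k) s = s\<lparr>reg := (reg s)(r := k mod 2 ^ w)\<rparr>"
| "exec_instr w (Binop r f r1 r2) s =
     s\<lparr>reg := (reg s)(r := apply_binop w f (reg s r1) (reg s r2))\<rparr>"
| "exec_instr w (Load r a) s = s\<lparr>reg := (reg s)(r := mem s (reg s a))\<rparr>"
| "exec_instr w (Store a r) s = s\<lparr>mem := (mem s)(reg s a := reg s r)\<rparr>"
| "exec_instr w (Copy a b) s = s\<lparr>crd := (crd s)(reg s a := crd s (reg s b))\<rparr>"

datatype cond =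
    RLess nat nat
  | REq nat nat
  | CLess nat nat             \<comment> \<open>compares the coordinates at the addresses in two registers\<close>

fun holds :: "cond \<Rightarrow> config \<Rightarrow> bool" where
  "holds (RLess r1 r2) s \<longleftrightarrow> reg s r1 < reg s r2"
| "holds (REq r1 r2) s \<longleftrightarrow> reg s r1 = reg s r2"
| "holds (CLess a b) s \<longleftrightarrow> crd s (reg s a) < crd s (reg s b)"

datatype prog = Instr instr | Seq prog prog | If cond prog prog | While cond prog

text \<open>\<open>exec w p s t s'\<close>: with word size \<open>w\<close>, program \<open>p\<close> started in \<open>s\<close> halts in \<open>s'\<close> after
  exactly \<open>t\<close> steps.\<close>

inductive exec :: "nat \<Rightarrow> prog \<Rightarrow> config \<Rightarrow> nat \<Rightarrow> config \<Rightarrow> bool" for w where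
  Instr: "exec w (Instr i) s 1 (exec_instr w i s)"
| Seq: "exec w p s t s' \<Longrightarrow> exec w q s' t' s'' \<Longrightarrow> exec w (Seq p q) s (t + t') s''"
| IfTrue: "holds b s \<Longrightarrow> exec w p s t s' \<Longrightarrow> exec w (If b p q) s (1 + t) s'"
| IfFalse: "\<not> holds b s \<Longrightarrow> exec w q s t s' \<Longrightarrow> exec w (If b p q) s (1 + t) s'"
| WhileFalse: "\<not> holds b s \<Longrightarrow> exec w (While b p) s 1 s"
| WhileTrue: "holds b s \<Longrightarrow> exec w p s t s' \<Longrightarrow> exec w (While b p) s' t' s'' \<Longrightarrow>
     exec w (While b p) s (1 + t + t') s''"

lemma exec_deterministic:
  "exec w p s t s' \<Longrightarrow> exec w p s u s'' \<Longrightarrow> u = t \<and> s'' = s'"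
proof (induction arbitrary: u s'' rule: exec.induct)
  case (Instr i s)
  then show ?case by (auto elim: exec.cases)
next
  case (Seq p s t s' q t' s1)
  from Seq.prems show ?case by (cases rule: exec.cases) (use Seq.IH in blast)+
next
  case (IfTrue b s p t s' q)
  from IfTrue.prems show ?case by (cases rule: exec.cases) (use IfTrue in blast)+
next
  case (IfFalse b s q t s' p)
  from IfFalse.prems show ?case by (cases rule: exec.cases) (use IfFalse in blast)+
next
  case (WhileFalse b s p)
  from WhileFalse.prems show ?case by (cases rule: exec.cases) (use WhileFalse in blast)+
next
  case (WhileTrue b s p t s' t' s1)
  from WhileTrue.prems show ?case by (cases rule: exec.cases) (use WhileTrue in blast)+
qed


text \<open>
  The construction starts with \<open>n\<close> and \<open>d\<close> in registers 0 and 1, with the coordinates of the points,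
  in an arbitrary enumeration \<open>ps\<close>, in the first \<open>n * d\<close> cells of the coordinate memory, and with
  everything else cleared.
\<close>

definition build_input :: "nat \<Rightarrow> nat \<Rightarrow> real list list \<Rightarrow> config" where
  "build_input n d ps =
     \<lparr>reg = (\<lambda>_. 0)(0 := n, 1 := d),
      mem = (\<lambda>_. 0),
      crd = (\<lambda>k. if k < n * d then ps ! (k div d) ! (k mod d) else 0)\<rparr>"

text \<open>
  A box is passed to a query as a list of \<open>d\<close> pairs consisting of a lower and an upper endpoint, each
  of which may be missing, excluded or included; the lower one may exceed the upper one, which
  gives the empty interval.
\<close>

datatype endpoint = Unbounded | Open real | Closed real

fun above :: "endpoint \<Rightarrow> real \<Rightarrow> bool" where
  "above Unbounded x \<longleftrightarrow> True"
| "above (Open a) x \<longleftrightarrow> a < x"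
| "above (Closed a) x \<longleftrightarrow> a \<le> x"

fun below :: "endpoint \<Rightarrow> real \<Rightarrow> bool" where
  "below Unbounded x \<longleftrightarrow> True"
| "below (Open b) x \<longleftrightarrow> x < b"
| "below (Closed b) x \<longleftrightarrow> x \<le> b"

type_synonym box_code = "(endpoint \<times> endpoint) list"

definition encodes_box :: "nat \<Rightarrow> box_code \<Rightarrow> real list set \<Rightarrow> bool" where
  "encodes_box d q R \<longleftrightarrow>
     length q = d \<and> R = {x \<in> points d. \<forall>j<d. above (fst (q ! j)) (x ! j) \<and> below (snd (q ! j)) (x ! j)}"

lemma interval_endpoints:
  assumes "is_interval (J :: real set)"
  shows "\<exists>l u. J = {x. above l x \<and> below u x}"
proof -
  from is_real_interval[OF assms] consider "J = {}" | "J = UNIV" | b where "J = {..<b}" | b where "J = {..b}"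
    | a where "J = {a<..}" | a where "J = {a..}" | a b where "J = {a<..<b}"
    | a b where "J = {a<..b}" | a b where "J = {a..<b}" | a b where "J = {a..b}"
    by blast
  then show ?thesis
  proof cases
    case 1 then show ?thesis by (intro exI[of _ "Closed 1"] exI[of _ "Closed 0"]) auto
  next
    case 2 then show ?thesis by (intro exI[of _ Unbounded]) auto
  next
    case (3 b) then show ?thesis by (intro exI[of _ Unbounded] exI[of _ "Open b"]) auto
  next
    case (4 b) then show ?thesis by (intro exI[of _ Unbounded] exI[of _ "Closed b"]) auto
  next
    case (5 a) then show ?thesis by (intro exI[of _ "Open a"] exI[of _ Unbounded]) auto
  next
    case (6 a) then show ?thesis by (intro exI[of _ "Closed a"] exI[of _ Unbounded]) auto
  next
    case (7 a b) then show ?thesis by (intro exI[of _ "Open a"] exI[of _ "Open b"]) auto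
  next
    case (8 a b) then show ?thesis by (intro exI[of _ "Open a"] exI[of _ "Closed b"]) auto
  next
    case (9 a b) then show ?thesis by (intro exI[of _ "Closed a"] exI[of _ "Open b"]) auto
  next
    case (10 a b) then show ?thesis by (intro exI[of _ "Closed a"] exI[of _ "Closed b"]) auto
  qed
qed

lemma axis_parallel_box_encodable:
  assumes "axis_parallel_box d R"
  shows "\<exists>q. encodes_box d q R"
proof -
  from assms obtain J where J: "\<forall>j<d. is_interval (J j)"
    and R: "R = {x \<in> points d. \<forall>j<d. x ! j \<in> J j}"
    unfolding axis_parallel_box_def by blast
  from J have "\<forall>j. \<exists>l u. j < d \<longrightarrow> J j = {x. above l x \<and> below u x}"
    using interval_endpoints by blast
  then obtain l u where "\<And>j. j < d \<Longrightarrow> J j = {x. above (l j) x \<and> below (u j) x}"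
    by metis
  then have "encodes_box d (map (\<lambda>j. (l j, u j)) [0..<d]) R"
    by (auto simp: encodes_box_def R)
  then show ?thesis by blast
qed

fun kind :: "endpoint \<Rightarrow> nat" where
  "kind Unbounded = 0" | "kind (Open _) = 1" | "kind (Closed _) = 2"

fun coordinate :: "endpoint \<Rightarrow> real" where
  "coordinate Unbounded = 0" | "coordinate (Open a) = a" | "coordinate (Closed a) = a"

text \<open>
  The lower and upper endpoint in dimension \<open>j\<close> have numbers \<open>2 * j\<close> and \<open>2 * j + 1\<close>. Their kinds
  are placed in the first \<open>2 * d\<close> cells of the word memory, their values in the \<open>2 * d\<close> cells of the
  coordinate memory that follow the input points. The rest of the configuration is left as it is.
\<close>

definition query_endpoint :: "box_code \<Rightarrow> nat \<Rightarrow> endpoint" where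
  "query_endpoint q k = (if even k then fst (q ! (k div 2)) else snd (q ! (k div 2)))"

definition load_query :: "nat \<Rightarrow> nat \<Rightarrow> box_code \<Rightarrow> config \<Rightarrow> config" where
  "load_query n d q s =
     s\<lparr>mem := (\<lambda>k. if k < 2 * d then kind (query_endpoint q k) else mem s k),
       crd := (\<lambda>k. if n * d \<le> k \<and> k < n * d + 2 * d
                   then coordinate (query_endpoint q (k - n * d)) else crd s k)\<rparr>"

text \<open>
  The configurations that arise from \<open>s0\<close> by answering any number of queries one after the other:
  the data structure must still work in all of them.
\<close>

inductive after_queries :: "nat \<Rightarrow> prog \<Rightarrow> nat \<Rightarrow> nat \<Rightarrow> config \<Rightarrow> config \<Rightarrow> bool"
  for w query n d s0 where
  start: "after_queries w query n d s0 s0"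
| step: "after_queries w query n d s0 s \<Longrightarrow> length q = d \<Longrightarrow>
     exec w query (load_query n d q s) t s' \<Longrightarrow> after_queries w query n d s0 s'"

text \<open>A list is stored at address \<open>a\<close> as its length followed by its elements.\<close>

definition stored_list :: "(nat \<Rightarrow> nat) \<Rightarrow> nat \<Rightarrow> nat list" where
  "stored_list M a = map (\<lambda>k. M (a + 1 + k)) [0..<M a]"

definition list_fits :: "nat \<Rightarrow> (nat \<Rightarrow> nat) \<Rightarrow> nat \<Rightarrow> bool" where
  "list_fits w M a \<longleftrightarrow> a + M a < 2 ^ w"

text \<open>
  Register 2 points to the list of addresses of the sets of the family; the indices are the positions
  in this list. Each set is stored as a repetition-free list of positions in the enumeration \<open>ps\<close>.
\<close>

definition stores_family ::
  "nat \<Rightarrow> real list list \<Rightarrow> config \<Rightarrow> nat set \<Rightarrow> (nat \<Rightarrow> real list set) \<Rightarrow> bool" where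
  "stores_family w ps s I F \<longleftrightarrow>
     list_fits w (mem s) (reg s 2) \<and>
     (let dir = stored_list (mem s) (reg s 2) in
        I = {..<length dir} \<and>
        (\<forall>i\<in>I. list_fits w (mem s) (dir ! i) \<and>
           (let xs = stored_list (mem s) (dir ! i) in
              distinct xs \<and> set xs \<subseteq> {..<length ps} \<and> F i = (!) ps ` set xs)))"

text \<open>A query returns in register 3 the address of a repetition-free list of indices.\<close>

definition returns_indices :: "nat \<Rightarrow> config \<Rightarrow> nat set \<Rightarrow> bool" where
  "returns_indices w s IR \<longleftrightarrow>
     list_fits w (mem s) (reg s 3) \<and> distinct (stored_list (mem s) (reg s 3)) \<and>
     IR = set (stored_list (mem s) (reg s 3))"

end

theory Submission
  imports Defs "HOL-Library.Multiset"
begin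

text \<open>
  The data structure is a range tree. Each node of a tree for dimension \<open>k\<close> stores its points sorted by
  dimension \<open>k + 1\<close> and owns a tree for dimension \<open>k + 1\<close> over them. The nodes of a tree are the runs of a
  bottom-up merge sort: the leaves are the points in the order of dimension \<open>k\<close>, and merging
  neighbouring runs by dimension \<open>k + 1\<close> yields their parent, so that sorting costs no more than
  writing down the nodes. All nodes lie consecutively in memory and serve as the queue of the trees that
  remain to be built. A node of height \<open>l\<close> with \<open>j\<close> dimensions to go accounts, per point, for at most
  \<open>(j + 1) (l + j choose j)\<close> entries, since \<open>(i + j choose j)\<close> summed over \<open>i \<le> l\<close> is \<open>(l + j + 1 choose j + 1)\<close>.

  A query keeps a stack of nodes. It drops a node that misses the box in the current dimension, passes
  to the tree of the next dimension (or reports the node) if the node lies within the box, and otherwise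
  replaces the node by its children. Only two nodes per level are cut by the ends of the interval, and the
  same summation, now with a factor 2 per dimension, bounds the number of visits. The nodes on the stack
  and in the output are always disjoint and nonempty; hence there are at most \<open>n\<close> of them, which matters
  because a word may be too short to address \<open>2 ^ d B(n,d)\<close> cells.
\<close>

section \<open>Execution times of programs\<close>

text \<open>No program stores or tests a level: \<open>lev\<close> exists only in the invariants. So
  that all nodes of a level have equal height, an odd run is not carried over but copied into a node
  with a single child; a list of at most \<open>2 ^ H\<close> points then gives a root of level at
  most \<open>H\<close>, whatever its length. All sizes rest on one identity, kept for an arbitrary
  function \<open>f\<close> of the level: the entries written so far, weighted by \<open>f\<close>,
  and those that the remaining levels will still write add up to the number of points times the sum
  of \<open>f\<close>. The constant 1 gives the space of one tree; \<open>weight\<close> for one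
  dimension less gives the size of all that is built from its nodes. As future entries are included,
  the identity shows in advance that the next addresses fit into a word, without which the
  arithmetic would wrap around. A record adds eight words to a nonempty list, so counting entries
  suffices up to a factor 9. Queries come in any number and must leave the structure intact; hence
  they write only to word cells reserved below it, and the bound \<open>n\<close> on stack and
  output fixes how many cells that takes.\<close>

definition wp :: "nat \<Rightarrow> prog \<Rightarrow> (nat \<Rightarrow> config \<Rightarrow> bool) \<Rightarrow> config \<Rightarrow> bool" where
  "wp w p Q s \<longleftrightarrow> (\<exists>t s'. exec w p s t s' \<and> Q t s')"

lemma wp_Instr: "wp w (Instr i) Q s \<longleftrightarrow> Q 1 (exec_instr w i s)"
proof
  assume "wp w (Instr i) Q s"
  then obtain t s' where "exec w (Instr i) s t s'" "Q t s'" unfolding wp_def by blast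
  then show "Q 1 (exec_instr w i s)" by (cases rule: exec.cases) auto
next
  assume "Q 1 (exec_instr w i s)"
  then show "wp w (Instr i) Q s" unfolding wp_def by (intro exI conjI) (rule exec.Instr)
qed

lemma wp_Seq: "wp w (Seq p q) Q s \<longleftrightarrow> wp w p (\<lambda>t s'. wp w q (\<lambda>t'. Q (t + t')) s') s"
proof
  assume "wp w (Seq p q) Q s"
  then obtain t s' where "exec w (Seq p q) s t s'" "Q t s'" unfolding wp_def by blast
  then show "wp w p (\<lambda>t s'. wp w q (\<lambda>t'. Q (t + t')) s') s"
    by (cases rule: exec.cases) (auto simp: wp_def)
next
  assume "wp w p (\<lambda>t s'. wp w q (\<lambda>t'. Q (t + t')) s') s"
  then obtain t s' t' s'' where "exec w p s t s'" "exec w q s' t' s''" "Q (t + t') s''"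
    unfolding wp_def by blast
  then show "wp w (Seq p q) Q s" unfolding wp_def using exec.Seq by blast
qed

lemma wp_If: "wp w (If b p q) Q s \<longleftrightarrow>
    (if holds b s then wp w p (\<lambda>t. Q (1 + t)) s else wp w q (\<lambda>t. Q (1 + t)) s)"
proof
  assume "wp w (prog.If b p q) Q s"
  then obtain t s' where "exec w (prog.If b p q) s t s'" "Q t s'" unfolding wp_def by blast
  then show "if holds b s then wp w p (\<lambda>t. Q (1 + t)) s else wp w q (\<lambda>t. Q (1 + t)) s"
    by (cases rule: exec.cases) (auto simp: wp_def)
next
  assume a: "if holds b s then wp w p (\<lambda>t. Q (1 + t)) s else wp w q (\<lambda>t. Q (1 + t)) s"
  show "wp w (prog.If b p q) Q s"
  proof (cases "holds b s")
    case True
    then obtain t s' where "exec w p s t s'" "Q (1 + t) s'" using a unfolding wp_def by auto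
    then show ?thesis using exec.IfTrue[OF True] unfolding wp_def by (intro exI conjI)
  next
    case False
    then obtain t s' where "exec w q s t s'" "Q (1 + t) s'" using a unfolding wp_def by auto
    then show ?thesis using exec.IfFalse[OF False] unfolding wp_def by (intro exI conjI)
  qed
qed

lemma wp_mono: "wp w p Q s \<Longrightarrow> (\<And>t s'. Q t s' \<Longrightarrow> Q' t s') \<Longrightarrow> wp w p Q' s"
  unfolding wp_def by blast

text \<open>The natural number carried by the invariant is a time credit.\<close>

lemma wp_While:
  assumes "I v s"
    and body: "\<And>v s. I v s \<Longrightarrow> holds b s \<Longrightarrow> wp w p (\<lambda>t s'. \<exists>v'. I v' s' \<and> v' + t + 1 \<le> v) s"
    and Q: "\<And>t v' s'. I v' s' \<Longrightarrow> \<not> holds b s' \<Longrightarrow> t + v' \<le> v + 1 \<Longrightarrow> Q t s'"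
  shows "wp w (While b p) Q s"
proof -
  have "\<exists>t s' v'. exec w (While b p) s t s' \<and> I v' s' \<and> \<not> holds b s' \<and> t + v' \<le> v + 1"
    using assms(1)
  \<comment> \<open>The credit also proves termination: every round pays at least for its test, so
    \<open>v\<close> strictly decreases. The surplus 1 in the claim is the final, failing
    test.\<close>
  proof (induction v arbitrary: s rule: less_induct)
    case (less v)
    show ?case
    proof (cases "holds b s")
      case True
      from body[OF less.prems True] obtain t s' v' where 1: "exec w p s t s'" "I v' s'" "v' + t + 1 \<le> v"
        unfolding wp_def by blast
      from less.IH[OF _ 1(2)] 1(3) obtain t' s'' v'' where
        2: "exec w (While b p) s' t' s''" "I v'' s''" "\<not> holds b s''" "t' + v'' \<le> v' + 1"
        by fastforce
      show ?thesis
        using exec.WhileTrue[OF True 1(1) 2(1)] 1 2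
        by (intro exI[of _ "1 + t + t'"] exI[of _ s''] exI[of _ v'']) simp
    next
      case False
      show ?thesis
        using exec.WhileFalse[OF False] less.prems False
        by (intro exI[of _ 1] exI[of _ s] exI[of _ v]) auto
    qed
  qed
  then obtain t s' v' where "exec w (While b p) s t s'" "I v' s'" "\<not> holds b s'" "t + v' \<le> v + 1"
    by blast
  with Q[OF this(2-4)] show ?thesis unfolding wp_def by blast
qed

text \<open>A separate name keeps the word bound an atom in linear arithmetic.\<close>

definition words :: "nat \<Rightarrow> nat" where "words w = 2 ^ w"

lemma exec_Const: "k < words w \<Longrightarrow> exec_instr w (Const r k) s = s\<lparr>reg := (reg s)(r := k)\<rparr>"
  by (simp add: words_def)

lemma exec_Add: "reg s a + reg s b < words w \<Longrightarrow>
    exec_instr w (Binop r Add a b) s = s\<lparr>reg := (reg s)(r := reg s a + reg s b)\<rparr>"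
  by (simp add: words_def)

lemma exec_Mul: "reg s a * reg s b < words w \<Longrightarrow>
    exec_instr w (Binop r Mul a b) s = s\<lparr>reg := (reg s)(r := reg s a * reg s b)\<rparr>"
  by (simp add: words_def)

lemma exec_Sub: "reg s b \<le> reg s a \<Longrightarrow> reg s a < words w \<Longrightarrow>
    exec_instr w (Binop r Sub a b) s = s\<lparr>reg := (reg s)(r := reg s a - reg s b)\<rparr>"
proof -
  assume a: "reg s b \<le> reg s a" "reg s a < words w"
  have "apply_binop w Sub (reg s a) (reg s b) = nat (int (reg s a - reg s b) mod int (2 ^ w))"
    using a(1) by (simp add: of_nat_diff)
  also have "\<dots> = (reg s a - reg s b) mod 2 ^ w"
    unfolding of_nat_mod[symmetric] nat_int ..
  also have "\<dots> = reg s a - reg s b"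
    using a by (intro mod_less) (simp add: words_def)
  finally show ?thesis by simp
qed

lemmas exec_Load = exec_instr.simps(3)
lemmas exec_Store = exec_instr.simps(4)

declare exec_instr.simps [simp del]

lemmas wps = wp_Instr wp_Seq wp_If exec_Const exec_Add exec_Mul exec_Sub exec_Load exec_Store

section \<open>The programs\<close>

abbreviation seq_prog (infixr ";;" 60) where "p ;; q \<equiv> Seq p q"
abbreviation ADD where "ADD r a b \<equiv> Instr (Binop r Add a b)"
abbreviation SUB where "SUB r a b \<equiv> Instr (Binop r Sub a b)"
abbreviation MUL where "MUL r a b \<equiv> Instr (Binop r Mul a b)"
abbreviation SET where "SET r k \<equiv> Instr (Const r k)"
abbreviation LOAD where "LOAD r a \<equiv> Instr (Load r a)"
abbreviation STORE where "STORE a r \<equiv> Instr (Store a r)"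
abbreviation SKIP where "SKIP \<equiv> SET 4 0"

text \<open>
  Registers 4, 6, 30 to 33 hold the constants 0, 1, 2, 5, 7, 8, and register 7 the next free address.
  During the construction, 8 is the record being processed, 9 the key and 12 the index of the next new
  record, 10 the first record that remains to be paired, 11 the end of its level, and 26 its successor.
  During a query, 9 is the end of the stack, whose bottom is in 8; 12 and 13 address the coordinates
  of the extreme points of the current node, 22 and 23 those of the endpoints, whose kinds are in 19 and 20.
\<close>

definition consts_prog :: prog where
  "consts_prog = SET 4 0;; SET 6 1;; SET 30 2;; SET 31 5;; SET 32 7;; SET 33 8"

section \<open>Programs of the construction\<close>

definition emit :: "nat \<Rightarrow> prog" where "emit r = STORE 7 r;; ADD 7 7 6"

text \<open>The word at offset 5, the tree of the next dimension, is only a placeholder 0 here; the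
  main loop overwrites it when that tree has been built.\<close>

definition header :: prog where
  "header = emit 9;; emit 13;; emit 14;; emit 15;; emit 16;; emit 4;; emit 12;; ADD 12 12 6"

definition leaves :: prog where
  "leaves = ADD 17 8 32;; LOAD 21 17;; ADD 17 17 6;; ADD 18 17 21;; ADD 10 7 4;; ADD 11 7 4;;
     While (RLess 17 18)
       (LOAD 13 17;; LOAD 14 17;; header;; emit 6;; emit 13;; ADD 17 17 6)"

definition succ_prog :: prog where
  "succ_prog = ADD 21 10 32;; LOAD 21 21;; ADD 26 10 33;; ADD 26 26 21"

definition take_from :: "nat \<Rightarrow> prog" where
  "take_from r = LOAD 21 r;; emit 21;; ADD r r 6"

definition merge_prog :: prog where
  "merge_prog = While (RLess 7 25)
     (If (RLess 17 18)
       (If (RLess 19 20)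
         (LOAD 21 17;; LOAD 22 19;; MUL 23 21 1;; ADD 23 23 9;; MUL 24 22 1;; ADD 24 24 9;;
          If (CLess 24 23) (take_from 19) (take_from 17))
         (take_from 17))
       (take_from 19))"

text \<open>If no run of the current level is left, the runs produced since then form the next
  level, which ends at the free address. If the first run is the last of its level, it becomes both
  children, and registers 19 and 20 coincide, so that it is merged with an empty list.\<close>

definition pair_setup :: prog where
  "pair_setup = 
     If (REq 10 11) (ADD 11 7 4) SKIP;;
     ADD 17 10 33;; ADD 18 26 4;; ADD 21 10 6;; LOAD 13 21;; ADD 21 21 6;; LOAD 14 21;;
     ADD 15 10 4;; ADD 16 10 4;; ADD 19 26 4;; ADD 20 26 4;; ADD 21 10 32;; LOAD 27 21;; ADD 10 26 4;;
     If (REq 26 11) SKIP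
       (ADD 16 26 4;; ADD 21 26 30;; LOAD 14 21;; ADD 19 26 33;; ADD 21 26 32;; LOAD 21 21;;
        ADD 27 27 21;; ADD 20 19 21;; ADD 10 20 4)"

definition pair_body :: prog where
  "pair_body = pair_setup;; header;; emit 27;; ADD 25 7 27;; merge_prog;; succ_prog"

text \<open>Register 26 is the end of the first unpaired record. It reaches the free address exactly
  when this record is the only one left; it is then the root, with its address in register
  10.\<close>

definition tree_prog :: prog where
  "tree_prog = leaves;; succ_prog;; While (RLess 26 7) pair_body"

abbreviation main_body :: prog where
  "main_body \<equiv> LOAD 9 8;; ADD 21 8 32;; LOAD 21 21;; ADD 28 8 33;; ADD 28 28 21;;
     If (RLess 9 1) (ADD 9 9 6;; tree_prog;; ADD 21 8 31;; STORE 21 10) SKIP;;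
     ADD 8 28 4"

definition main_prog :: prog where
  "main_prog = While (RLess 8 7)
     main_body"

text \<open>The cells below \<open>2 * n + 2 * d + 2\<close> are reserved for queries:
  \<open>2 * d\<close> endpoint kinds, the output list, and a stack of up to \<open>n\<close> nodes.
  Behind them comes a pseudo-record of which only the list \<open>[0..<n]\<close> matters; it feeds
  the first tree. The genuine records start at \<open>3 * n + 2 * d + 10\<close>, kept in register
  34.\<close>

definition init_prog :: prog where
  "init_prog = consts_prog;; ADD 8 0 0;; ADD 21 1 1;; ADD 8 8 21;; ADD 8 8 30;; ADD 7 8 32;;
     emit 0;; ADD 21 4 4;; While (RLess 21 0) (emit 21;; ADD 21 21 6);; ADD 34 7 4"

text \<open>Register 29 holds the record of all points in the order of the first dimension; the root
  of its tree goes to register 5. Directory entries are offset by 7 because there the length of a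
  record is followed by its points, in the format of a stored list.\<close>

definition dir_prog :: prog where
  "dir_prog = ADD 21 29 31;; LOAD 5 21;; ADD 8 34 4;; ADD 28 7 4;; ADD 2 7 4;; emit 12;;
     While (RLess 8 28) (ADD 21 8 32;; emit 21;; LOAD 21 21;; ADD 8 8 33;; ADD 8 8 21)"

definition build_prog :: prog where
  "build_prog = init_prog;; tree_prog;; ADD 8 10 4;; ADD 29 10 4;; main_prog;; dir_prog"

section \<open>Programs of a query\<close>

definition test_lower :: "nat \<Rightarrow> prog \<Rightarrow> prog \<Rightarrow> prog" where
  "test_lower x p q =
     If (REq 19 4) p (If (REq 19 6) (If (CLess 22 x) p q) (If (CLess x 22) q p))"

definition test_upper :: "nat \<Rightarrow> prog \<Rightarrow> prog \<Rightarrow> prog" where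
  "test_upper x p q =
     If (REq 20 4) p (If (REq 20 6) (If (CLess x 23) p q) (If (CLess 23 x) q p))"

definition fetch_prog :: prog where
  "fetch_prog = SUB 9 9 6;; LOAD 10 9;; LOAD 11 10;;
     ADD 21 10 6;; LOAD 12 21;; ADD 21 21 6;; LOAD 13 21;; ADD 21 21 6;; LOAD 14 21;;
     ADD 21 21 6;; LOAD 15 21;; ADD 21 21 6;; LOAD 16 21;; ADD 21 21 6;; LOAD 17 21;;
     SUB 18 11 6;; MUL 12 12 1;; ADD 12 12 18;; MUL 13 13 1;; ADD 13 13 18;;
     ADD 19 18 18;; ADD 20 19 6;; ADD 22 34 19;; ADD 23 34 20;; LOAD 19 19;; LOAD 20 20"

definition push :: "nat \<Rightarrow> prog" where "push r = STORE 9 r;; ADD 9 9 6"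

definition inside_prog :: prog where
  "inside_prog = If (RLess 11 1) (push 16)
     (STORE 7 17;; ADD 7 7 6;; LOAD 21 3;; ADD 21 21 6;; STORE 3 21)"

text \<open>An only child occupies both child fields; pushing it twice would destroy the
  disjointness of the stack.\<close>

definition split_prog :: prog where
  "split_prog = push 14;; If (REq 14 15) SKIP (push 15)"

definition query_body :: prog where
  "query_body = fetch_prog;;
     test_lower 13 (test_upper 12 (test_lower 12 (test_upper 13 inside_prog split_prog) split_prog) SKIP) SKIP"

definition query_prog :: prog where
  "query_prog = consts_prog;; ADD 3 1 1;; STORE 3 4;; ADD 7 3 6;; ADD 8 3 0;; ADD 8 8 30;;
     ADD 9 8 4;; push 5;; MUL 34 0 1;; While (RLess 8 9) query_body"

section \<open>Range trees\<close>

text \<open>Bounds all visits caused by a node of level \<open>l\<close>, itself included, when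
  \<open>j\<close> dimensions remain, the current one among them. For \<open>j = 0\<close> the value
  is 0, since nothing is visited after the last dimension. \<open>side_bound\<close> is the part
  caused below a node by one end of the interval.\<close>

definition node_bound :: "nat \<Rightarrow> nat \<Rightarrow> nat" where
  "node_bound l j = 2 ^ Suc j * ((l + j) choose j) - 2"

definition side_bound :: "nat \<Rightarrow> nat \<Rightarrow> nat" where
  "side_bound l j = 2 ^ j * ((l + j - 1) choose j)"

text \<open>Pascal's rule. The summands are the tight case of a node cut at one end: one child is
  cut again and the other lies inside, which makes two visits and a search in the next dimension.
  The 2 cancels the one subtracted in \<open>node_bound\<close>, where the truncated subtraction
  needs a lower bound.\<close>

lemma side_bound_Suc:
  "side_bound (Suc l) (Suc j) = side_bound l (Suc j) + 2 + node_bound l j"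
proof -
  have "2 * 1 \<le> 2 ^ Suc j * ((l + j) choose j)"
    by (intro mult_mono) (auto simp: Suc_le_eq)
  then show ?thesis
    by (simp add: side_bound_def node_bound_def algebra_simps)
qed

lemma side_bound_less: "Suc (2 * side_bound l (Suc j)) \<le> node_bound l (Suc j)"
proof -
  define c where "c = (2 ^ Suc j :: nat) * ((l + j) choose j)"
  have "(2 ^ 1 :: nat) * 1 \<le> c"
    unfolding c_def by (intro mult_mono power_increasing) (auto simp: Suc_le_eq)
  moreover have "node_bound l (Suc j) = 2 * c + 2 * side_bound l (Suc j) - 2"
    by (simp add: c_def side_bound_def node_bound_def algebra_simps)
  ultimately show ?thesis by simp
qed

lemma node_bound_mono: "l \<le> l' \<Longrightarrow> node_bound l j \<le> node_bound l' j"
  unfolding node_bound_def by (intro diff_le_mono mult_le_mono binomial_right_mono) auto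

lemma node_bound_Suc: "Suc (node_bound l j) \<le> node_bound l (Suc j)"
proof (cases j)
  case 0
  then show ?thesis by (simp add: node_bound_def)
next
  case (Suc i)
  have "2 ^ Suc (Suc j) * ((l + Suc j) choose Suc j) \<ge> 2 * (2 ^ Suc j * ((l + j) choose j))"
    by simp
  moreover have "2 ^ Suc j * ((l + j) choose j) \<ge> 2 * 1"
    by (intro mult_mono) (auto simp: Suc_le_eq)
  ultimately show ?thesis unfolding node_bound_def by linarith
qed

text \<open>
  Bounds the number of visits below a node of level \<open>l\<close> whose points have coordinates from \<open>x\<close> to
  \<open>y\<close> in the current dimension, when \<open>j\<close> dimensions remain. Only one side of the interval can be
  crossed in the third case, and then at most one of two siblings is crossed again.
\<close>

definition visits :: "endpoint \<Rightarrow> endpoint \<Rightarrow> nat \<Rightarrow> nat \<Rightarrow> real \<Rightarrow> real \<Rightarrow> nat" where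
  "visits a b l j x y =
     (if \<not> above a y \<or> \<not> below b x then 1
      else if above a x \<and> below b y then Suc (node_bound l (j - 1))
      else if above a x \<or> below b y then Suc (side_bound l j)
      else Suc (2 * side_bound l j))"

lemma above_mono: "above a x \<Longrightarrow> x \<le> y \<Longrightarrow> above a y"
  by (cases a) auto

lemma below_mono: "below b y \<Longrightarrow> x \<le> y \<Longrightarrow> below b x"
  by (cases b) auto

lemma visits_pos: "1 \<le> visits a b l j x y"
  by (simp add: visits_def)

lemma visits_le: "1 \<le> j \<Longrightarrow> visits a b l j x y \<le> node_bound l j"
  using side_bound_less[of l "j - 1"] node_bound_Suc[of l "j - 1"]
  by (auto simp: visits_def)

lemma visits_single:
  assumes "1 \<le> j" "above a y" "below b x" "\<not> (above a x \<and> below b y)"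
  shows "Suc (visits a b l j x y) \<le> visits a b (Suc l) j x y"
  using assms side_bound_Suc[of l "j - 1"] by (auto simp: visits_def)

lemma visits_split:
  assumes "1 \<le> j" "above a y" "below b x" "\<not> (above a x \<and> below b y)"
    and le: "x \<le> x'" "x' \<le> y'" "y' \<le> y"
  shows "Suc (visits a b l j x x' + visits a b l j y' y) \<le> visits a b (Suc l) j x y"
proof -
  have s: "side_bound (Suc l) j = side_bound l j + 2 + node_bound l (j - 1)"
    using assms(1) side_bound_Suc[of l "j - 1"] by simp
  \<comment> \<open>No end of the interval cuts both children: if the left child reaches beyond the
    lower end, the right one lies wholly beyond it, and symmetrically. The last two facts say that a
    child is not cut at a new end.\<close>
  have "above a x' \<Longrightarrow> above a y'" "below b y' \<Longrightarrow> below b x'" "above a x \<Longrightarrow> above a x'"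
    "below b y \<Longrightarrow> below b y'"
    using le by (auto intro: above_mono below_mono)
  then show ?thesis
    using assms(2-4) s unfolding visits_def by auto
qed

section \<open>Records and nodes in memory\<close>

definition elems :: "(nat \<Rightarrow> nat) \<Rightarrow> nat \<Rightarrow> nat list" where
  "elems M v = map M [v + 8..<v + 8 + M (v + 7)]"

abbreviation total :: "(nat \<Rightarrow> nat) \<Rightarrow> nat list \<Rightarrow> nat" where
  "total M us \<equiv> \<Sum>u\<leftarrow>us. length (elems M u)"

definition low :: "(nat \<Rightarrow> nat) \<Rightarrow> nat \<Rightarrow> nat" where "low M v = M (v + 1)"
definition high :: "(nat \<Rightarrow> nat) \<Rightarrow> nat \<Rightarrow> nat" where "high M v = M (v + 2)"
definition left :: "(nat \<Rightarrow> nat) \<Rightarrow> nat \<Rightarrow> nat" where "left M v = M (v + 3)"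
definition right :: "(nat \<Rightarrow> nat) \<Rightarrow> nat \<Rightarrow> nat" where "right M v = M (v + 4)"
definition next_tree :: "(nat \<Rightarrow> nat) \<Rightarrow> nat \<Rightarrow> nat" where "next_tree M v = M (v + 5)"
definition number :: "(nat \<Rightarrow> nat) \<Rightarrow> nat \<Rightarrow> nat" where "number M v = M (v + 6)"

text \<open>Keys are dimensions shifted by one. Key 0 stands for no order at all, so that the same
  program builds the initial tree over the unsorted points, whose merging sorts them by dimension
  0.\<close>

definition coord_le :: "(nat \<Rightarrow> nat \<Rightarrow> real) \<Rightarrow> nat \<Rightarrow> nat \<Rightarrow> nat \<Rightarrow> bool" where
  "coord_le X k p r \<longleftrightarrow> k = 0 \<or> X p (k - 1) \<le> X r (k - 1)"

text \<open>
  The record of a node occupies consecutive words: key, lowest point, highest point, two children,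
  tree of the next dimension, index, and its points as a list. A node with key \<open>k\<close> splits by
  dimension \<open>k - 1\<close>, while its points are listed in the order of dimension \<open>k\<close>, which is the order
  needed to build the tree of the next dimension. If the two children coincide there is only one.
\<close>

definition node_ok :: "(nat \<Rightarrow> nat \<Rightarrow> real) \<Rightarrow> (nat \<Rightarrow> nat) \<Rightarrow> (nat \<Rightarrow> nat) \<Rightarrow> nat set \<Rightarrow> nat \<Rightarrow> bool" where
  "node_ok X M lev U v \<longleftrightarrow>
     distinct (elems M v) \<and> elems M v \<noteq> [] \<and> length (elems M v) \<le> 2 ^ lev v \<and>
     sorted_wrt (coord_le X (Suc (M v))) (elems M v) \<and>
     low M v \<in> set (elems M v) \<and> high M v \<in> set (elems M v) \<and>
     (\<forall>p\<in>set (elems M v). coord_le X (M v) (low M v) p \<and> coord_le X (M v) p (high M v)) \<and>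
     (if lev v = 0 then low M v = high M v
      else (\<forall>u\<in>{left M v, right M v}. u \<in> U \<and> Suc (lev u) = lev v \<and> M u = M v) \<and>
        set (elems M v) = set (elems M (left M v)) \<union> set (elems M (right M v)) \<and>
        (left M v \<noteq> right M v \<longrightarrow>
           set (elems M (left M v)) \<inter> set (elems M (right M v)) = {} \<and>
           (\<forall>p\<in>set (elems M (left M v)). \<forall>r\<in>set (elems M (right M v)). coord_le X (M v) p r)))"

text \<open>Kept apart from \<open>node_ok\<close> because a record satisfies it only after it has
  been processed. The condition on the levels lets the bound of a node pay for the search in its
  next tree.\<close>

definition next_ok :: "nat \<Rightarrow> (nat \<Rightarrow> nat) \<Rightarrow> (nat \<Rightarrow> nat) \<Rightarrow> nat set \<Rightarrow> nat \<Rightarrow> bool" where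
  "next_ok d M lev U v \<longleftrightarrow> (M v < d \<longrightarrow>
     next_tree M v \<in> U \<and> M (next_tree M v) = Suc (M v) \<and> lev (next_tree M v) \<le> lev v \<and>
     set (elems M (next_tree M v)) = set (elems M v))"

definition node_visits ::
  "nat \<Rightarrow> box_code \<Rightarrow> (nat \<Rightarrow> nat \<Rightarrow> real) \<Rightarrow> (nat \<Rightarrow> nat) \<Rightarrow> (nat \<Rightarrow> nat) \<Rightarrow> nat \<Rightarrow> nat" where
  "node_visits d q X M lev v =
     (let k = M v - 1 in
      visits (fst (q ! k)) (snd (q ! k)) (lev v) (d - k) (X (low M v) k) (X (high M v) k))"

definition in_dim :: "box_code \<Rightarrow> (nat \<Rightarrow> nat \<Rightarrow> real) \<Rightarrow> nat \<Rightarrow> nat \<Rightarrow> bool" where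
  "in_dim q X k p \<longleftrightarrow> above (fst (q ! k)) (X p k) \<and> below (snd (q ! k)) (X p k)"

lemma node_visits_le: "M v \<ge> 1 \<Longrightarrow> M v \<le> d \<Longrightarrow> node_visits d q X M lev v \<le> node_bound (lev v) (d + 1 - M v)"
  unfolding node_visits_def Let_def by (rule order.trans[OF visits_le]) auto

text \<open>
  The state of a query, with the stack \<open>stk\<close> of nodes still to be visited (its top comes last) and
  the output \<open>out\<close>. Distinctness of the concatenation says that all these nodes have disjoint sets of
  points, so that they are at most \<open>n\<close> in number.
\<close>

definition query_inv ::
  "nat \<Rightarrow> nat \<Rightarrow> box_code \<Rightarrow> (nat \<Rightarrow> nat \<Rightarrow> real) \<Rightarrow> (nat \<Rightarrow> nat) \<Rightarrow> nat set \<Rightarrow> nat list \<Rightarrow> nat list \<Rightarrow> bool" where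
  "query_inv n d q X M U stk out \<longleftrightarrow>
     set stk \<union> set out \<subseteq> U \<and>
     distinct (concat (map (elems M) (stk @ out))) \<and>
     {p. p < n \<and> (\<forall>k<d. in_dim q X k p)} \<subseteq> (\<Union>v\<in>set (stk @ out). set (elems M v)) \<and>
     (\<forall>v\<in>set stk. \<forall>p\<in>set (elems M v). \<forall>k<M v - 1. in_dim q X k p) \<and>
     (\<forall>v\<in>set out. \<forall>p\<in>set (elems M v). \<forall>k<d. in_dim q X k p)"

locale range_tree =
  fixes n d :: nat and X :: "nat \<Rightarrow> nat \<Rightarrow> real" and M lev :: "nat \<Rightarrow> nat" and U :: "nat set"
  assumes node: "v \<in> U \<Longrightarrow> node_ok X M lev U v"
    and nxt: "v \<in> U \<Longrightarrow> next_ok d M lev U v"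
    and key: "v \<in> U \<Longrightarrow> 1 \<le> M v \<and> M v \<le> d"
    and elems_less: "v \<in> U \<Longrightarrow> set (elems M v) \<subseteq> {..<n}"
begin

section \<open>Steps of a query on an abstract range tree\<close>

lemma length_stack:
  assumes "query_inv n d q X M U stk out"
  shows "length stk + length out \<le> n"
proof -
  let ?L = "concat (map (elems M) (stk @ out))"
  have sub: "set ?L \<subseteq> {..<n}" using assms elems_less by (auto simp: query_inv_def)
  have "length xs \<le> length (concat (map (elems M) xs))" if "set xs \<subseteq> U" for xs
    using that
  proof (induction xs)
    case (Cons v xs)
    have "elems M v \<noteq> []" using node[of v] Cons.prems
      by (auto simp: node_ok_def)
    then show ?case using Cons by (cases "elems M v") auto
  qed simp
  from this[of "stk @ out"] assms have "length (stk @ out) \<le> length ?L"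
    by (auto simp: query_inv_def)
  also have "\<dots> = card (set ?L)" using assms by (metis distinct_card query_inv_def)
  also have "\<dots> \<le> n" using card_mono[OF _ sub] by simp
  finally show ?thesis by simp
qed

lemma range:
  assumes "v \<in> U" "p \<in> set (elems M v)"
  shows "X (low M v) (M v - 1) \<le> X p (M v - 1)" "X p (M v - 1) \<le> X (high M v) (M v - 1)"
  using node[OF assms(1)] key[OF assms(1)] assms(2) by (auto simp: node_ok_def coord_le_def)

lemma inv_outside:
  assumes inv: "query_inv n d q X M U (stk @ [v]) out"
    and "k = M v - 1"
    and "\<not> above (fst (q ! k)) (X (high M v) k) \<or> \<not> below (snd (q ! k)) (X (low M v) k)"
  shows "query_inv n d q X M U stk out"
proof -
  have v: "v \<in> U" using inv by (auto simp: query_inv_def)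
  have "\<not> in_dim q X k p" if "p \<in> set (elems M v)" for p
    using range[OF v that] assms(2,3) unfolding in_dim_def by (metis above_mono below_mono)
  moreover have "k < d" using key[OF v] assms(2) by linarith
  ultimately have nv: "p \<notin> set (elems M v)" if "\<forall>k<d. in_dim q X k p" for p
    using that by blast
  have "{p. p < n \<and> (\<forall>k<d. in_dim q X k p)} \<subseteq> (\<Union>u\<in>set ((stk @ [v]) @ out). set (elems M u))"
    using inv unfolding query_inv_def by (elim conjE)
  also have "\<dots> = (\<Union>u\<in>set (stk @ out). set (elems M u)) \<union> set (elems M v)" by auto
  finally have cov: "{p. p < n \<and> (\<forall>k<d. in_dim q X k p)} \<subseteq> (\<Union>u\<in>set (stk @ out). set (elems M u))"
    using nv by blast
  show ?thesis
    unfolding query_inv_def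
    by (intro conjI cov) (use inv in \<open>auto simp: query_inv_def\<close>)
qed

text \<open>Every point lies between the extremes in the current dimension, so these two decide for
  all. The next tree holds the same points, hence may replace the node on the stack without
  affecting disjointness or coverage.\<close>

lemma
  assumes inv: "query_inv n d q X M U (stk @ [v]) out"
    and k: "k = M v - 1"
    and in1: "above (fst (q ! k)) (X (low M v) k)" and in2: "below (snd (q ! k)) (X (high M v) k)"
  shows inv_next: "M v < d \<Longrightarrow> query_inv n d q X M U (stk @ [next_tree M v]) out"
    and inv_output: "\<not> M v < d \<Longrightarrow> query_inv n d q X M U stk (out @ [v])"
    and visits_next: "M v < d \<Longrightarrow>
       Suc (node_visits d q X M lev (next_tree M v)) \<le> node_visits d q X M lev v"
proof -
  have v: "v \<in> U" using inv by (auto simp: query_inv_def)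
  have i: "in_dim q X k p" if "p \<in> set (elems M v)" for p
    using range[OF v that] k in1 in2 unfolding in_dim_def by (metis above_mono below_mono)
  have kd: "M v = Suc k" "k < d" using key[OF v] k by auto
  have i': "in_dim q X k' p" if "p \<in> set (elems M v)" "k' \<le> k" for p k'
    using inv i[OF that(1)] that kd unfolding query_inv_def by (cases "k' = k") auto
  show "query_inv n d q X M U stk (out @ [v])" if "\<not> M v < d"
    using inv i' that kd unfolding query_inv_def by auto
  assume "M v < d"
  then have nx: "next_tree M v \<in> U" "M (next_tree M v) = Suc (M v)" "lev (next_tree M v) \<le> lev v"
    "set (elems M (next_tree M v)) = set (elems M v)"
    using nxt[OF v] by (auto simp: next_ok_def)
  have "distinct (elems M (next_tree M v))" using node[OF nx(1)] by (simp add: node_ok_def)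
  then show "query_inv n d q X M U (stk @ [next_tree M v]) out"
    using inv i' nx kd unfolding query_inv_def by auto
  have vv: "node_visits d q X M lev v = Suc (node_bound (lev v) (d - k - 1))"
  proof -
    have "X (low M v) k \<le> X (high M v) k"
      using range(1)[OF v, of "high M v"] node[OF v] k by (simp add: node_ok_def)
    from above_mono[OF in1 this] below_mono[OF in2 this] show ?thesis
      using in1 in2 unfolding node_visits_def visits_def Let_def k[symmetric] by simp
  qed
  have "node_visits d q X M lev (next_tree M v) \<le> node_bound (lev (next_tree M v)) (d - k - 1)"
    using node_visits_le[of M "next_tree M v" d q X lev] nx kd \<open>M v < d\<close> by simp
  also have "\<dots> \<le> node_bound (lev v) (d - k - 1)" by (intro node_bound_mono nx)
  finally show "Suc (node_visits d q X M lev (next_tree M v)) \<le> node_visits d q X M lev v"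
    using vv by simp
qed

lemma
  assumes inv: "query_inv n d q X M U (stk @ [v]) out"
    and k: "k = M v - 1"
    and ab: "above (fst (q ! k)) (X (high M v) k)" "below (snd (q ! k)) (X (low M v) k)"
      "\<not> (above (fst (q ! k)) (X (low M v) k) \<and> below (snd (q ! k)) (X (high M v) k))"
  defines "cs \<equiv> if left M v = right M v then [left M v] else [left M v, right M v]"
  shows inv_split: "query_inv n d q X M U (stk @ cs) out"
    and visits_children: "Suc (sum_list (map (node_visits d q X M lev) cs)) \<le> node_visits d q X M lev v"
proof -
  define l r where "l = left M v" and "r = right M v"
  have v: "v \<in> U" using inv by (auto simp: query_inv_def)
  have kd: "M v = Suc k" "k < d" using key[OF v] k by auto
  \<comment> \<open>Leaves carry no mark, and their child fields are meaningless. They are never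
    split, because their extreme points coincide and cannot lie on different sides of an
    end.\<close>
  have "lev v = 0 \<Longrightarrow> low M v = high M v" using node[OF v] by (simp add: node_ok_def)
  then have lv: "lev v \<noteq> 0" using ab by metis
  then have c: "l \<in> U" "r \<in> U" "Suc (lev l) = lev v" "Suc (lev r) = lev v" "M l = M v" "M r = M v"
    and S: "set (elems M v) = set (elems M l) \<union> set (elems M r)"
    and lr: "lev r = lev l"
    and ne: "l \<noteq> r \<Longrightarrow> set (elems M l) \<inter> set (elems M r) = {}"
      "l \<noteq> r \<Longrightarrow> p \<in> set (elems M l) \<Longrightarrow> p' \<in> set (elems M r) \<Longrightarrow> X p k \<le> X p' k" for p p'
    using node[OF v] kd by (auto simp: node_ok_def l_def r_def coord_le_def)
  have dist: "distinct (elems M l)" "distinct (elems M r)" using node c by (auto simp: node_ok_def)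
  show "query_inv n d q X M U (stk @ cs) out"
  proof (cases "l = r")
    case True
    then show ?thesis using inv c S dist unfolding query_inv_def cs_def l_def[symmetric] r_def[symmetric] by auto
  next
    case False
    then show ?thesis using inv c S dist ne(1) unfolding query_inv_def cs_def l_def[symmetric] r_def[symmetric]
      by (auto simp: Int_Un_distrib Int_Un_distrib2)
  qed
  have mem: "low M u \<in> set (elems M u)" "high M u \<in> set (elems M u)" if "u \<in> U" for u
    using node[OF that] by (auto simp: node_ok_def)
  note rl = range[OF c(1), unfolded c kd, simplified] and rr = range[OF c(2), unfolded c kd, simplified]
    and rv = range[OF v, unfolded kd, simplified]
  show "Suc (sum_list (map (node_visits d q X M lev) cs)) \<le> node_visits d q X M lev v"
  proof (cases "l = r")
    case True
    \<comment> \<open>An only child has the same points as its parent. Ties leave the choice of the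
      extreme points open, but their coordinates agree.\<close>
    have "X (low M l) k = X (low M v) k" "X (high M l) k = X (high M v) k"
      using rl rv mem[OF c(1)] mem[OF v] S True by (auto intro!: antisym)
    then show ?thesis
      using visits_single[of "d - k" "fst (q ! k)" "X (high M v) k" "snd (q ! k)" "X (low M v) k" "lev l"]
        True ab c kd unfolding cs_def l_def[symmetric] r_def[symmetric] node_visits_def by simp
  next
    case False
    have x: "X (low M l) k = X (low M v) k"
      using rv(1)[of "low M l"] mem[OF c(1)] mem[OF v] S rl(1) ne(2)[OF False] by (auto intro!: antisym)
    have y: "X (high M r) k = X (high M v) k"
      using rv(2)[of "high M r"] mem[OF c(2)] mem[OF v] S rr(2) ne(2)[OF False] by (auto intro!: antisym)
    have "X (low M l) k \<le> X (high M l) k" "X (high M l) k \<le> X (low M r) k"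
      "X (low M r) k \<le> X (high M r) k"
      using rl rr mem c ne(2)[OF False] by auto
    then show ?thesis
      using visits_split[of "d - k" "fst (q ! k)" "X (high M v) k" "snd (q ! k)" "X (low M v) k"
          "X (high M l) k" "X (low M r) k" "lev l"]
        False ab c(3) c(5,6) lr kd x y unfolding cs_def l_def[symmetric] r_def[symmetric] node_visits_def by simp
  qed
qed

end

section \<open>Building one tree\<close>

lemma coord_le_refl: "coord_le X k p p"
  by (simp add: coord_le_def)

section \<open>Merging two lists\<close>

fun merge_by :: "(nat \<Rightarrow> real) \<Rightarrow> nat list \<Rightarrow> nat list \<Rightarrow> nat list" where
  "merge_by f [] ys = ys"
| "merge_by f (x # xs) [] = x # xs"
| "merge_by f (x # xs) (y # ys) =
     (if f y < f x then y # merge_by f (x # xs) ys else x # merge_by f xs (y # ys))"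

lemma merge_by_Nil2 [simp]: "merge_by f xs [] = xs"
  by (cases xs) auto

lemma mset_merge_by: "mset (merge_by f xs ys) = mset xs + mset ys"
  by (induction f xs ys rule: merge_by.induct) auto

lemma set_merge_by: "set (merge_by f xs ys) = set xs \<union> set ys"
  using mset_merge_by[of f xs ys] by (metis set_mset_mset set_mset_union)

lemma length_merge_by: "length (merge_by f xs ys) = length xs + length ys"
  using mset_merge_by[of f xs ys] by (metis size_mset size_union)

lemma sorted_merge_by:
  "sorted_wrt (\<lambda>p r. f p \<le> f r) xs \<Longrightarrow> sorted_wrt (\<lambda>p r. f p \<le> f r) ys \<Longrightarrow>
   sorted_wrt (\<lambda>p r. f p \<le> f r) (merge_by f xs ys)"
  by (induction f xs ys rule: merge_by.induct) (auto simp: set_merge_by; fastforce)+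

text \<open>The tree of the next dimension is left out because it is filled in later.\<close>

definition same_rec :: "(nat \<Rightarrow> nat) \<Rightarrow> (nat \<Rightarrow> nat) \<Rightarrow> nat \<Rightarrow> bool" where
  "same_rec M M' v \<longleftrightarrow> M' v = M v \<and> low M' v = low M v \<and> high M' v = high M v \<and>
     left M' v = left M v \<and> right M' v = right M v \<and> number M' v = number M v \<and>
     elems M' v = elems M v"

lemma same_recI:
  assumes "\<And>a. v \<le> a \<Longrightarrow> a < v + 8 + length (elems M v) \<Longrightarrow> a \<noteq> v + 5 \<Longrightarrow> M' a = M a"
  shows "same_rec M M' v"
proof -
  have "M' (v + 7) = M (v + 7)" by (rule assms) auto
  then have "elems M' v = elems M v" using assms by (auto simp: elems_def)
  moreover have "M' v = M v" "M' (v + 1) = M (v + 1)" "M' (v + 2) = M (v + 2)" "M' (v + 3) = M (v + 3)"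
    "M' (v + 4) = M (v + 4)" "M' (v + 6) = M (v + 6)"
    by (rule assms; simp)+
  ultimately show ?thesis
    unfolding same_rec_def low_def high_def left_def right_def number_def by blast
qed

lemma node_ok_cong:
  assumes "\<And>u. u \<in> U \<Longrightarrow> same_rec M M' u" "\<And>u. u \<in> U \<Longrightarrow> lev' u = lev u" "v \<in> U" "node_ok X M lev U v"
  shows "node_ok X M' lev' U v"
proof -
  have "lev v \<noteq> 0 \<Longrightarrow> left M v \<in> U \<and> right M v \<in> U" using assms(4) by (simp add: node_ok_def)
  then show ?thesis
    using assms(4) assms(1)[OF assms(3)] assms(2)[OF assms(3)] assms(1)[of "left M v"] assms(1)[of "right M v"]
      assms(2)[of "left M v"] assms(2)[of "right M v"]
    unfolding node_ok_def same_rec_def by (cases "lev v = 0") force+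
qed

lemma node_ok_mono: "node_ok X M lev U v \<Longrightarrow> U \<subseteq> U' \<Longrightarrow> node_ok X M lev U' v"
  unfolding node_ok_def by (auto split: if_splits)

section \<open>Consecutive records in memory\<close>

fun recs :: "(nat \<Rightarrow> nat) \<Rightarrow> nat \<Rightarrow> nat list \<Rightarrow> nat \<Rightarrow> bool" where
  "recs M a [] b \<longleftrightarrow> a = b"
| "recs M a (v # vs) b \<longleftrightarrow> v = a \<and> recs M (a + 8 + length (elems M a)) vs b"

lemma recs_append: "recs M a (vs @ us) b \<longleftrightarrow> (\<exists>c. recs M a vs c \<and> recs M c us b)"
  by (induction vs arbitrary: a) auto

lemma recs_le: "recs M a vs b \<Longrightarrow> a \<le> b"
proof (induction vs arbitrary: a)
  case (Cons v vs)
  then have r: "recs M (a + 8 + length (elems M a)) vs b" "v = a" by auto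
  show ?case using Cons.IH[OF r(1)] r(2) by simp
qed simp

lemma recs_bounds:
  "recs M a vs b \<Longrightarrow> v \<in> set vs \<Longrightarrow> a \<le> v \<and> v + 8 + length (elems M v) \<le> b"
proof (induction vs arbitrary: a)
  case (Cons u vs)
  then have r: "recs M (a + 8 + length (elems M a)) vs b" and "u = a" by auto
  show ?case using Cons.IH[OF r] recs_le[OF r] Cons.prems(2) \<open>u = a\<close> by auto
qed simp

lemma recs_cong:
  "recs M a vs b \<Longrightarrow> \<forall>v\<in>set vs. length (elems M' v) = length (elems M v) \<Longrightarrow> recs M' a vs b"
  by (induction vs arbitrary: a) simp_all

lemma recs_same:
  assumes "recs M a vs b" "\<And>c. c < b \<Longrightarrow> M' c = M c" "v \<in> set vs"
  shows "same_rec M M' v"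
proof (rule same_recI)
  fix c assume "c < v + 8 + length (elems M v)"
  then show "M' c = M c" using recs_bounds[OF assms(1,3)] by (intro assms(2)) linarith
qed

lemma recs_below:
  assumes "recs M a vs b" "\<And>c. c < b \<Longrightarrow> M' c = M c"
  shows "recs M' a vs b"
  using assms(1) by (rule recs_cong) (use recs_same[OF assms] in \<open>simp add: same_rec_def\<close>)

lemma recs_disjoint:
  "recs M a vs b \<Longrightarrow> v \<in> set vs \<Longrightarrow> u \<in> set vs \<Longrightarrow> u \<noteq> v \<Longrightarrow>
   v + 8 + length (elems M v) \<le> u \<or> u + 8 + length (elems M u) \<le> v"
proof (induction vs arbitrary: a)
  case (Cons x vs)
  then have r: "recs M (a + 8 + length (elems M a)) vs b" and x: "x = a" by auto
  show ?case
    using Cons.IH[OF r] recs_bounds[OF r, of u] recs_bounds[OF r, of v] Cons.prems(2-4) x by auto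
qed simp

lemma recs_distinct: "recs M a vs b \<Longrightarrow> distinct vs"
proof (induction vs arbitrary: a)
  case (Cons x vs)
  then have r: "recs M (a + 8 + length (elems M a)) vs b" and x: "x = a" by auto
  show ?case using Cons.IH[OF r] recs_bounds[OF r, of x] x by auto
qed simp

lemma recs_end: "recs M a vs b \<Longrightarrow> b = a + (\<Sum>v\<leftarrow>vs. 8 + length (elems M v))"
proof (induction vs arbitrary: a)
  case (Cons v vs)
  then have r: "recs M (a + 8 + length (elems M a)) vs b" "v = a" by auto
  show ?case using Cons.IH[OF r(1)] r(2) by simp
qed simp

lemma sorted_wrt_hd_last:
  assumes "sorted_wrt R xs" "\<And>x. R x x" "p \<in> set xs"
  shows "R (hd xs) p" "R p (last xs)"
proof -
  show "R (hd xs) p" using assms by (cases xs) auto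
  show "R p (last xs)" using assms by (induction xs) auto
qed

text \<open>
  The state of the construction of the tree over the list \<open>L\<close>. The nodes \<open>Q1\<close> of level \<open>l - 1\<close> still
  have to be paired, the nodes \<open>Q2\<close> of level \<open>l\<close> are the result of the pairing so far, and \<open>sg\<close> maps
  a node to its segment of \<open>L\<close>.
\<close>

definition pair_inv where
  "pair_inv X K L H c0 b0 M i e b D Q1 Q2 lev sg l \<longleftrightarrow>
     recs M b0 D i \<and> recs M i Q1 e \<and> recs M e Q2 b \<and>
     (\<forall>u\<in>set (D @ Q1 @ Q2). node_ok X M lev (set (D @ Q1 @ Q2)) u \<and> M u = K \<and>
        set (elems M u) \<subseteq> set L) \<and>
     (\<forall>j<length (D @ Q1 @ Q2). number M ((D @ Q1 @ Q2) ! j) = c0 + j) \<and>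
     (\<forall>u\<in>set (Q1 @ Q2). sg u \<noteq> [] \<and> mset (elems M u) = mset (sg u) \<and>
        low M u = hd (sg u) \<and> high M u = last (sg u)) \<and>
     concat (map sg (Q2 @ Q1)) = L \<and>
     (\<forall>u\<in>set Q1. Suc (lev u) = l) \<and> (\<forall>u\<in>set Q2. lev u = l) \<and>
     l \<le> H \<and> length Q2 + (length Q1 + 1) div 2 \<le> 2 ^ (H - l) \<and>
     (\<forall>f :: nat \<Rightarrow> nat. (\<Sum>u\<leftarrow>D @ Q1 @ Q2. length (elems M u) * f (lev u)) +
        total M Q1 * sum f {l..H} +
        total M Q2 * sum f {Suc l..H} = length L * sum f {0..H})"

text \<open>The bound in \<open>pair_inv\<close> counts the runs that level \<open>l\<close> will
  have, rounding up for an odd one. At level \<open>H\<close> it is 1, so two runs force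
  \<open>l < H\<close>; below that, halving the number of runs matches the drop of the
  exponent.\<close>

lemma pair_inv_next_level:
  assumes "pair_inv X K L H c0 b0 M i i b D [] Q2 lev sg l" "2 \<le> length Q2"
  shows "pair_inv X K L H c0 b0 M i b b D Q2 [] lev sg (Suc l)"
proof -
  have "l < H"
  proof (rule ccontr)
    assume "\<not> l < H"
    then show False using assms by (simp add: pair_inv_def)
  qed
  then have H: "H - l = Suc (H - Suc l)" by simp
  have "length Q2 \<le> 2 ^ (H - l)" using assms(1) by (simp add: pair_inv_def)
  then have "(length Q2 + 1) div 2 \<le> 2 ^ (H - Suc l)" unfolding H by simp
  then show ?thesis using assms(1) \<open>l < H\<close> unfolding pair_inv_def by simp
qed

lemma pair_inv_size:
  assumes "pair_inv X K L H c0 b0 M i e b D Q1 Q2 lev sg l"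
  shows "total M Q1 + total M Q2 = length L"
proof -
  have "length (elems M u) = length (sg u)" if "u \<in> set (Q1 @ Q2)" for u
    using assms that unfolding pair_inv_def by (metis size_mset)
  then have "total M (Q2 @ Q1) = length (concat (map sg (Q2 @ Q1)))"
    unfolding length_concat map_map by (intro arg_cong[of _ _ sum_list] map_cong) auto
  also have "concat (map sg (Q2 @ Q1)) = L" using assms unfolding pair_inv_def by blast
  finally show ?thesis by simp
qed

text \<open>The new list is sorted by key \<open>K + 1\<close>, but it permutes a contiguous segment
  of \<open>L\<close>, which is sorted by key \<open>K\<close>. So the ends of the segment are the
  extremes for key \<open>K\<close>, and the segments of the two children are separated in that
  order; this is what \<open>sg\<close> is kept for.\<close>

lemma pair_inv_step:
  assumes inv: "pair_inv X K L H c0 b0 M i e b D (xs @ Q1) Q2 lev sg l"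
    and xs: "(xs = [x] \<and> y = x \<and> Q1 = []) \<or> xs = [x, y]"
    and L: "sorted_wrt (coord_le X K) L" "distinct L"
    and M': "\<And>a. a < b \<Longrightarrow> M' a = M a"
    and rec: "M' b = K" "low M' b = low M x" "high M' b = high M y" "left M' b = x" "right M' b = y"
      "number M' b = c0 + length (D @ xs @ Q1 @ Q2)" "elems M' b = zs"
    and zs: "mset zs = (\<Sum>u\<leftarrow>xs. mset (elems M u))" "sorted_wrt (coord_le X (Suc K)) zs"
    and i': "recs M i xs i'" and b': "b' = b + 8 + length zs"
  shows "pair_inv X K L H c0 b0 M' i' e b' (D @ xs) Q1 (Q2 @ [b]) (lev(b := l)) (sg(b := concat (map sg xs))) l"
proof -
  define V where "V = D @ xs @ Q1 @ Q2"
  define S where "S = concat (map sg xs)"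
  have I: "recs M b0 D i" "recs M i (xs @ Q1) e" "recs M e Q2 b"
    "\<And>u. u \<in> set V \<Longrightarrow> node_ok X M lev (set V) u" "\<And>u. u \<in> set V \<Longrightarrow> M u = K"
    "\<And>j. j < length V \<Longrightarrow> number M (V ! j) = c0 + j"
    "\<And>u. u \<in> set (xs @ Q1 @ Q2) \<Longrightarrow> sg u \<noteq> [] \<and> mset (elems M u) = mset (sg u) \<and>
        low M u = hd (sg u) \<and> high M u = last (sg u)"
    "concat (map sg Q2) @ S @ concat (map sg Q1) = L"
    "\<And>u. u \<in> set (xs @ Q1) \<Longrightarrow> Suc (lev u) = l" "\<And>u. u \<in> set Q2 \<Longrightarrow> lev u = l" "l \<le> H"
    "length Q2 + (length (xs @ Q1) + 1) div 2 \<le> 2 ^ (H - l)"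
    using inv unfolding pair_inv_def V_def S_def by auto
  have IL: "\<And>u. u \<in> set V \<Longrightarrow> set (elems M u) \<subseteq> set L"
    using inv unfolding pair_inv_def V_def by auto
  have W: "(\<Sum>u\<leftarrow>V. length (elems M u) * f (lev u)) +
        total M (xs @ Q1) * sum f {l..H} +
        total M Q2 * sum f {Suc l..H} = length L * sum f {0..H}" for f
    using inv unfolding pair_inv_def V_def by auto
  have rV: "recs M b0 V b"
    unfolding V_def using I(1-3) by (metis append.assoc recs_append)
  have same: "same_rec M M' u" if "u \<in> set V" for u
    using recs_same[OF rV M' that] .
  have bV: "b \<notin> set V" using recs_bounds[OF rV] by fastforce
  have el: "elems M' u = elems M u" if "u \<in> set V" for u using same[OF that] by (simp add: same_rec_def)
  have xV: "x \<in> set V" "y \<in> set V" "x \<in> set xs" "y \<in> set xs" using xs by (auto simp: V_def)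
  have "mset zs = mset S"
    unfolding zs(1) S_def mset_concat map_map using I(7) by (intro arg_cong[of _ _ sum_list] map_cong) auto
  have sS: "set zs = set S" "length zs = length S"
    using \<open>mset zs = mset S\<close> by (metis set_mset_mset, metis size_mset)
  have S: "sorted_wrt (coord_le X K) S" "distinct S"
    using L I(8) by (auto simp: sorted_wrt_append)
  have S': "S = sg x \<and> x = y \<or> S = sg x @ sg y \<and> x \<noteq> y"
    using xs recs_distinct[OF i'] by (auto simp: S_def)
  have sx: "sg x \<noteq> []" "sg y \<noteq> []" "set (elems M x) = set (sg x)" "set (elems M y) = set (sg y)"
    "low M x = hd (sg x)" "high M y = last (sg y)"
    using I(7) xV by (auto simp: dest: mset_eq_setD)
  have low: "low M' b = hd S" and high: "high M' b = last S" and Sne: "S \<noteq> []"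
    using S' sx rec by auto
  have len: "length (elems M u) \<le> 2 ^ (l - 1)" if "u \<in> {x, y}" for u
    using I(4)[of u] I(9)[of u] xV that by (auto simp: node_ok_def)
  have l0: "l \<noteq> 0" using I(9)[of x] xV by auto
  have szs: "length zs = total M xs"
    using xs zs(1) by (auto simp flip: size_mset)
  also have "\<dots> \<le> 2 * 2 ^ (l - 1)" using xs len[of x] len[of y] by auto
  also have "\<dots> = 2 ^ l" using l0 by (cases l) auto
  finally have "length zs \<le> 2 ^ l" .
  have "node_ok X M' (lev(b := l)) (set V \<union> {b}) b"
    unfolding node_ok_def rec fun_upd_same
  proof (intro conjI ballI)
    show "distinct zs" using \<open>mset zs = mset S\<close> S(2) by (metis mset_eq_imp_distinct_iff)
    show "zs \<noteq> []" using sS Sne by auto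
    show "length zs \<le> 2 ^ l" "sorted_wrt (coord_le X (Suc K)) zs" by fact+
    show "low M x \<in> set zs" "high M y \<in> set zs" using low high Sne sS rec by auto
    show "coord_le X K (low M x) p" "coord_le X K p (high M y)" if "p \<in> set zs" for p
      using sorted_wrt_hd_last[OF S(1) coord_le_refl, of p] that sS low high rec by auto
    have "coord_le X K p r" if "x \<noteq> y" "p \<in> set (sg x)" "r \<in> set (sg y)" for p r
      using S' S that by (auto simp: sorted_wrt_append)
    then show "if l = 0 then low M x = high M y else (\<forall>u\<in>{x, y}. u \<in> set V \<union> {b} \<and> Suc ((lev(b := l)) u) = l \<and> M' u = K) \<and>
       set zs = set (elems M' x) \<union> set (elems M' y) \<and>
       (x \<noteq> y \<longrightarrow> set (elems M' x) \<inter> set (elems M' y) = {} \<and>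
          (\<forall>p\<in>set (elems M' x). \<forall>r\<in>set (elems M' y). coord_le X K p r))"
      using l0 xV bV I(5,9) S' S sx same by (auto simp: el sS same_rec_def)
  qed
  moreover have "node_ok X M' (lev(b := l)) (set V \<union> {b}) u" if "u \<in> set V" for u
    by (rule node_ok_mono[OF node_ok_cong[OF same _ that I(4)[OF that]]]) (use bV in auto)
  ultimately have nok: "\<forall>u\<in>set (V @ [b]). node_ok X M' (lev(b := l)) (set (V @ [b])) u \<and> M' u = K \<and>
      set (elems M' u) \<subseteq> set L"
    using I(5,8) IL same rec sS by (auto simp: same_rec_def)
  have num: "\<forall>j<length (V @ [b]). number M' ((V @ [b]) ! j) = c0 + j"
  proof (intro allI impI)
    fix j assume "j < length (V @ [b])"
    then consider "j < length V" | "j = length V" by fastforce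
    then show "number M' ((V @ [b]) ! j) = c0 + j"
    proof cases
      case 1
      then show ?thesis using I(6)[OF 1] same[OF nth_mem[OF 1]] by (simp add: nth_append same_rec_def)
    next
      case 2
      then show ?thesis using rec(6) by (simp add: V_def)
    qed
  qed
  have r: "recs M' b0 (D @ xs) i'" "recs M' i' Q1 e" "recs M' e (Q2 @ [b]) b'"
  proof -
    have a: "recs M b0 (D @ xs) i'" "recs M i' Q1 e"
      using I(1,2) i' xs by (auto simp: recs_append)
    have "i' \<le> e" "e \<le> b" using recs_le a I(3) by auto
    then show "recs M' b0 (D @ xs) i'" "recs M' i' Q1 e"
      using a by (auto intro!: recs_below[OF a(1)] recs_below[OF a(2)] M')
    show "recs M' e (Q2 @ [b]) b'"
      using recs_below[OF I(3) M'] by (auto simp: recs_append rec(7) b')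
  qed
  have seg: "\<forall>u\<in>set (Q1 @ Q2 @ [b]). (sg(b := S)) u \<noteq> [] \<and> mset (elems M' u) = mset ((sg(b := S)) u) \<and>
        low M' u = hd ((sg(b := S)) u) \<and> high M' u = last ((sg(b := S)) u)"
    using I(7) same bV low high Sne rec(7) \<open>mset zs = mset S\<close> by (auto simp: same_rec_def V_def)
  have conc: "concat (map (sg(b := S)) ((Q2 @ [b]) @ Q1)) = L"
  proof -
    have "map (sg(b := S)) Q2 = map sg Q2" "map (sg(b := S)) Q1 = map sg Q1"
      using bV by (auto simp: V_def)
    then show ?thesis using I(8) unfolding map_append concat_append by (simp only: list.map fun_upd_same) simp
  qed
  have W': "(\<Sum>u\<leftarrow>V @ [b]. length (elems M' u) * f ((lev(b := l)) u)) +
        total M' Q1 * sum f {l..H} +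
        total M' (Q2 @ [b]) * sum f {Suc l..H} = length L * sum f {0..H}" for f :: "nat \<Rightarrow> nat"
  proof -
    have 1: "(\<Sum>u\<leftarrow>V. length (elems M' u) * f ((lev(b := l)) u)) = (\<Sum>u\<leftarrow>V. length (elems M u) * f (lev u))"
      using bV by (intro arg_cong[of _ _ sum_list] map_cong) (auto simp: el)
    have 2: "total M' Q1 = total M Q1"
      "total M' Q2 = total M Q2"
      by (intro arg_cong[of _ _ sum_list] map_cong; auto simp: el V_def)+
    \<comment> \<open>The entries of \<open>xs\<close> move from \<open>Q1\<close> to
      \<open>Q2\<close>; the term \<open>f l\<close> that they lose there reappears as the weight of
      the new record.\<close>
    have 3: "sum f {l..H} = f l + sum f {Suc l..H}" using I(11) by (rule sum.atLeast_Suc_atMost)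
    show ?thesis
      using W[of f] unfolding map_append sum_list_append 1 2 using 3
      by (simp add: rec(7) szs algebra_simps)
  qed
  \<comment> \<open>A run is taken alone only if it is the last one, exactly where the division
    rounds up.\<close>
  have cnt: "length (Q2 @ [b]) + (length Q1 + 1) div 2 \<le> 2 ^ (H - l)"
    using I(12) xs by auto
  have VV: "(D @ xs) @ Q1 @ Q2 @ [b] = V @ [b]" by (simp add: V_def)
  have pp: "\<forall>f. (\<Sum>u\<leftarrow>V @ [b]. length (elems M' u) * f ((lev(b := l)) u)) +
        total M' Q1 * sum f {l..H} +
        total M' (Q2 @ [b]) * sum f {Suc l..H} = length L * sum f {0..H}"
    using W' by blast
  have lv: "\<forall>u\<in>set Q1. Suc ((lev(b := l)) u) = l" "\<forall>u\<in>set (Q2 @ [b]). (lev(b := l)) u = l"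
    using I(9,10) bV by (auto simp: V_def)
  show ?thesis
    unfolding pair_inv_def VV S_def[symmetric]
    using r nok num seg conc lv I(11) cnt pp by (intro conjI) assumption+
qed

text \<open>As a congruence rule it leaves the postcondition alone while a program is executed
  symbolically.\<close>

lemma wp_cong: "p = p' \<Longrightarrow> s = s' \<Longrightarrow> wp w p Q s = wp w p' Q s'"
  by simp

lemma config_swap: "s\<lparr>mem := m, reg := r\<rparr> = s\<lparr>reg := r, mem := m\<rparr>"
  by simp

declare One_nat_def [simp del] add_2_eq_Suc [simp del] add_2_eq_Suc' [simp del]

lemmas wp_steps = wps config_swap

section \<open>Execution of the blocks of the tree program\<close>

definition frame :: "nat set \<Rightarrow> config \<Rightarrow> config \<Rightarrow> bool" where
  "frame A s s' \<longleftrightarrow> crd s' = crd s \<and> (\<forall>r. r \<notin> A \<longrightarrow> reg s' r = reg s r)"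

lemma frame_reg: "frame A s s' \<Longrightarrow> r \<notin> A \<Longrightarrow> reg s' r = reg s r"
  by (simp add: frame_def)

lemma frame_crd: "frame A s s' \<Longrightarrow> crd s' = crd s"
  by (simp add: frame_def)

lemma frame_refl: "frame A s s"
  by (simp add: frame_def)

definition consts_ok :: "config \<Rightarrow> bool" where
  "consts_ok s \<longleftrightarrow> reg s 4 = 0 \<and> reg s 6 = 1 \<and> reg s 30 = 2 \<and> reg s 31 = 5 \<and> reg s 32 = 7 \<and> reg s 33 = 8"

lemma consts_ok_frame: "consts_ok s \<Longrightarrow> frame A s s' \<Longrightarrow> A \<inter> {4, 6, 30, 31, 32, 33} = {} \<Longrightarrow> consts_ok s'"
  unfolding consts_ok_def frame_def by (metis disjoint_iff insertCI)

lemma wp_consts: "8 < words w \<Longrightarrow> Q 6 (s\<lparr>reg := (reg s)(4 := 0, 6 := 1, 30 := 2, 31 := 5, 32 := 7, 33 := 8)\<rparr>) \<Longrightarrow>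
    wp w consts_prog Q s"
  by (simp add: consts_prog_def wp_steps add.assoc cong: wp_cong)

lemma wp_emit: "reg s 6 = 1 \<Longrightarrow> reg s 7 + 1 < words w \<Longrightarrow> wp w (emit r) Q s \<longleftrightarrow>
    Q 2 (s\<lparr>reg := (reg s)(7 := reg s 7 + 1), mem := (mem s)(reg s 7 := reg s r)\<rparr>)"
  by (simp add: emit_def wp_steps add.assoc cong: wp_cong)

lemma wp_header:
  assumes "reg s 6 = 1" "reg s 7 = b" "b + 7 < words w" "reg s 12 + 1 < words w"
  shows "wp w header Q s \<longleftrightarrow>
    Q 15 (s\<lparr>reg := (reg s)(7 := b + 7, 12 := reg s 12 + 1),
      mem := (mem s)(b := reg s 9, b + 1 := reg s 13, b + 2 := reg s 14, b + 3 := reg s 15,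
        b + 4 := reg s 16, b + 5 := reg s 4, b + 6 := reg s 12)\<rparr>)"
  using assms by (simp add: header_def wp_steps add.assoc wp_emit cong: wp_cong)

lemma wp_take_from:
  assumes "reg s 6 = 1" "reg s 7 + 1 < words w" "reg s r + 1 < words w" "r \<in> {17, 19}"
  shows "wp w (take_from r) Q s \<longleftrightarrow>
    Q 4 (s\<lparr>reg := (reg s)(21 := mem s (reg s r), 7 := reg s 7 + 1, r := reg s r + 1),
      mem := (mem s)(reg s 7 := mem s (reg s r))\<rparr>)"
  using assms by (auto simp add: take_from_def wp_steps add.assoc wp_emit cong: wp_cong)

lemma wp_succ:
  assumes "consts_ok s" "reg s 10 = i" "i + 8 + mem s (i + 7) < words w"
  shows "wp w succ_prog Q s \<longleftrightarrow>
    Q 4 (s\<lparr>reg := (reg s)(21 := mem s (i + 7), 26 := i + 8 + mem s (i + 7))\<rparr>)"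
  using assms by (simp add: succ_prog_def wp_steps add.assoc consts_ok_def fun_upd_twist cong: wp_cong)

text \<open>Both inputs end at or below \<open>b\<close>, so the output does not overwrite them.
  Each output word costs at most 14 steps: four tests including that of the loop, six instructions
  to load two points and address their coordinates, and four to copy.\<close>

lemma wp_merge:
  assumes regs: "reg s 6 = 1" "reg s 7 = b" "reg s 17 = p" "reg s 18 = pe" "reg s 19 = q" "reg s 20 = qe"
      "reg s 25 = be"
    and le: "p \<le> pe" "pe \<le> b" "q \<le> qe" "qe \<le> b" "be = b + (pe - p) + (qe - q)" "be + 1 < words w"
    and fits: "\<And>a. a \<in> {p..<pe} \<union> {q..<qe} \<Longrightarrow> mem s a * reg s 1 + reg s 9 < words w"
  shows "wp w merge_prog (\<lambda>t s'. frame {7, 17, 19, 21, 22, 23, 24} s s' \<and> reg s' 7 = be \<and>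
      (\<forall>a<b. mem s' a = mem s a) \<and>
      map (mem s') [b..<be] = merge_by (\<lambda>x. crd s (x * reg s 1 + reg s 9))
        (map (mem s) [p..<pe]) (map (mem s) [q..<qe]) \<and>
      t \<le> 14 * (be - b) + 1) s"
proof -
  let ?f = "\<lambda>x. crd s (x * reg s 1 + reg s 9)"
  let ?A = "{7, 17, 19, 21, 22, 23, 24} :: nat set"
  let ?m = "merge_by ?f (map (mem s) [p..<pe]) (map (mem s) [q..<qe])"
  define I where "I v s' \<longleftrightarrow> frame ?A s s' \<and> b \<le> reg s' 7 \<and> p \<le> reg s' 17 \<and> reg s' 17 \<le> pe \<and>
    q \<le> reg s' 19 \<and> reg s' 19 \<le> qe \<and> be = reg s' 7 + (pe - reg s' 17) + (qe - reg s' 19) \<and>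
    (\<forall>a<b. mem s' a = mem s a) \<and>
    map (mem s') [b..<reg s' 7] @
      merge_by ?f (map (mem s) [reg s' 17..<pe]) (map (mem s) [reg s' 19..<qe]) = ?m \<and>
    v = 14 * (be - reg s' 7)" for v s'
  have step: "I (14 * (be - Suc b1)) s2"
    if I: "I v s1" and b1: "reg s1 7 = b1" and fr: "frame ?A s s2" and s2: "reg s2 7 = b1 + 1" "mem s2 = (mem s1)(b1 := x)"
      and c: "reg s1 17 < pe \<and> reg s2 17 = reg s1 17 + 1 \<and> reg s2 19 = reg s1 19 \<and> x = mem s (reg s1 17) \<and>
          (reg s1 19 < qe \<longrightarrow> \<not> ?f (mem s (reg s1 19)) < ?f (mem s (reg s1 17))) \<or>
        reg s1 19 < qe \<and> reg s2 17 = reg s1 17 \<and> reg s2 19 = reg s1 19 + 1 \<and> x = mem s (reg s1 19) \<and>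
          (reg s1 17 < pe \<longrightarrow> ?f (mem s (reg s1 19)) < ?f (mem s (reg s1 17)))" for v s1 s2 b1 x
  proof -
    define p1 q1 where "p1 = reg s1 17" and "q1 = reg s1 19"
    note I = I[unfolded I_def p1_def[symmetric] q1_def[symmetric] b1]
    have "map (mem s2) [b..<b1 + 1] = map (mem s1) [b..<b1] @ [x]"
      using s2(2) I by (simp add: One_nat_def)
    moreover have "merge_by ?f (map (mem s) [p1..<pe]) (map (mem s) [q1..<qe]) =
        x # merge_by ?f (map (mem s) [reg s2 17..<pe]) (map (mem s) [reg s2 19..<qe])"
    proof (cases "p1 < pe")
      case True
      then have p: "map (mem s) [p1..<pe] = mem s p1 # map (mem s) [Suc p1..<pe]" by (simp add: upt_conv_Cons)
      show ?thesis
      proof (cases "q1 < qe")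
        case True
        then have "map (mem s) [q1..<qe] = mem s q1 # map (mem s) [Suc q1..<qe]" by (simp add: upt_conv_Cons)
        with p c show ?thesis using True \<open>p1 < pe\<close> unfolding p1_def[symmetric] q1_def[symmetric] by (auto simp: One_nat_def)
      next
        case False
        then show ?thesis using c p unfolding p1_def[symmetric] q1_def[symmetric] by (auto simp: One_nat_def)
      qed
    next
      case False
      then have q1: "q1 < qe" "reg s2 19 = Suc q1" "reg s2 17 = p1" "x = mem s q1"
        using c unfolding p1_def[symmetric] q1_def[symmetric] by auto
      then have "map (mem s) [q1..<qe] = mem s q1 # map (mem s) [Suc q1..<qe]" by (simp add: upt_conv_Cons)
      then show ?thesis using False q1 by simp
    qed
    ultimately show ?thesis
      unfolding I_def using I fr s2 c unfolding p1_def[symmetric] q1_def[symmetric] by auto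
  qed
  show ?thesis
    unfolding merge_prog_def
  proof (rule wp_While[where I = I and v = "14 * (be - b)"])
    show "I (14 * (be - b)) s" using regs le by (simp add: I_def frame_refl)
  next
    fix v s1 assume I: "I v s1" and h: "holds (RLess 7 25) s1"
    define p1 q1 b1 where "p1 = reg s1 17" and "q1 = reg s1 19" and "b1 = reg s1 7"
    note I' = I[unfolded I_def p1_def[symmetric] q1_def[symmetric] b1_def[symmetric]]
    have fr: "frame ?A s s1" using I' by simp
    note r = frame_reg[OF fr] frame_crd[OF fr]
    have b1: "b1 < be" using h r(1)[of 25] regs by (simp add: b1_def)
    have v: "v = 14 * (be - Suc b1) + 14" using I' b1 by simp
    have m: "mem s1 p1 = mem s p1" if "p1 < pe" using I' le that by simp
    have m': "mem s1 q1 = mem s q1" if "q1 < qe" using I' le that by simp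
    have f: "mem s p1 * reg s 1 + reg s 9 < words w" if "p1 < pe" using fits[of p1] I' that by simp
    have f': "mem s q1 * reg s 1 + reg s 9 < words w" if "q1 < qe" using fits[of q1] I' that by simp
    have f2: "mem s p1 * reg s 1 < words w" if "p1 < pe" using f[OF that] by simp
    have f2': "mem s q1 * reg s 1 < words w" if "q1 < qe" using f'[OF that] by simp
    have bd: "p1 + 1 < words w" "q1 + 1 < words w" "b1 + 1 < words w" using I' le b1 by auto
    note [simp] = p1_def[symmetric] q1_def[symmetric] b1_def[symmetric]
    have r6: "reg s1 6 = 1" using r(1)[of 6] regs by simp
    show "wp w (If (RLess 17 18)
         (If (RLess 19 20)
           (LOAD 21 17;; LOAD 22 19;; MUL 23 21 1;; ADD 23 23 9;; MUL 24 22 1;; ADD 24 24 9;;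
            If (CLess 24 23) (take_from 19) (take_from 17))
           (take_from 17))
         (take_from 19)) (\<lambda>t s'. \<exists>v'. I v' s' \<and> v' + t + 1 \<le> v) s1"
    proof (cases "p1 < pe")
      case True
      show ?thesis
      proof (cases "q1 < qe")
        case q: True
        show ?thesis
        proof (cases "?f (mem s q1) < ?f (mem s p1)")
          case lt: True
          show ?thesis
            using True q lt regs r bd r6 m m' f f' f2 f2'
            apply (simp add: wp_steps wp_take_from cong: wp_cong)
            apply (rule exI[of _ "14 * (be - Suc b1)"], rule conjI)
             apply (rule step[OF I b1_def[symmetric]])
                apply (use fr v in \<open>auto simp: frame_def\<close>)
            done
        next
          case lt: False
          show ?thesis
            using True q lt regs r bd r6 m m' f f' f2 f2'
            apply (simp add: wp_steps wp_take_from cong: wp_cong)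
            apply (rule exI[of _ "14 * (be - Suc b1)"], rule conjI)
             apply (rule step[OF I b1_def[symmetric]])
                apply (use fr v in \<open>auto simp: frame_def\<close>)
            done
        qed
      next
        case q: False
        show ?thesis
          using True q regs r bd r6 m
          apply (simp add: wp_steps wp_take_from cong: wp_cong)
          apply (rule exI[of _ "14 * (be - Suc b1)"], rule conjI)
           apply (rule step[OF I b1_def[symmetric]])
              apply (use fr v in \<open>auto simp: frame_def\<close>)
          done
      qed
    next
      case False
      have q: "q1 < qe" using False I' b1 by linarith
      show ?thesis
        using False q regs r bd r6 m'
        apply (simp add: wp_steps wp_take_from cong: wp_cong)
        apply (rule exI[of _ "14 * (be - Suc b1)"], rule conjI)
         apply (rule step[OF I b1_def[symmetric]])
            apply (use fr v in \<open>auto simp: frame_def\<close>)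
        done
    qed
  next
    fix t v' s' assume I: "I v' s'" and h: "\<not> holds (RLess 7 25) s'" and t: "t + v' \<le> 14 * (be - b) + 1"
    have fr: "frame ?A s s'" using I by (simp add: I_def)
    have "reg s' 25 = be" using frame_reg[OF fr, of 25] regs by simp
    with h I have "reg s' 7 = be" "reg s' 17 = pe" "reg s' 19 = qe" by (auto simp: I_def)
    then show "frame ?A s s' \<and> reg s' 7 = be \<and> (\<forall>a<b. mem s' a = mem s a) \<and>
      map (mem s') [b..<be] = ?m \<and> t \<le> 14 * (be - b) + 1"
      using I t by (simp add: I_def)
  qed
qed

abbreviation leaves_post :: "nat list \<Rightarrow> nat \<Rightarrow> config \<Rightarrow> config \<Rightarrow> bool" where
  "leaves_post L b s s' \<equiv> frame {7, 10, 11, 12, 13, 14, 17, 18, 21} s s' \<and>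
      reg s' 7 = b + 9 * length L \<and> reg s' 10 = b \<and> reg s' 11 = b \<and> reg s' 12 = reg s 12 + length L \<and>
      (\<forall>a<b. mem s' a = mem s a) \<and>
      (\<forall>j<length L. mem s' (b + 9 * j) = reg s 9 \<and> low (mem s') (b + 9 * j) = L ! j \<and>
         high (mem s') (b + 9 * j) = L ! j \<and> number (mem s') (b + 9 * j) = reg s 12 + j \<and>
         elems (mem s') (b + 9 * j) = [L ! j])"

lemma wp_leaves:
  assumes c: "consts_ok s" and t: "reg s 8 = t" and b: "reg s 7 = b" and L: "elems (mem s) t = L"
    and le: "t + 8 + length L \<le> b" and w: "b + 9 * length L + 10 < words w" "reg s 12 + length L < words w"
  shows "wp w leaves (\<lambda>r s'. leaves_post L b s s' \<and>
      r \<le> 24 * length L + 7) s"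
proof -
  let ?A = "{7, 10, 11, 12, 13, 14, 17, 18, 21} :: nat set"
  let ?m = "length L"
  have m: "mem s (t + 7) = ?m" and Lj: "\<And>j. j < ?m \<Longrightarrow> mem s (t + 8 + j) = L ! j"
    using L by (auto simp: elems_def)
  define I where "I v s' \<longleftrightarrow> (\<exists>i\<le>?m. frame ?A s s' \<and> reg s' 17 = t + 8 + i \<and> reg s' 18 = t + 8 + ?m \<and>
      reg s' 7 = b + 9 * i \<and> reg s' 10 = b \<and> reg s' 11 = b \<and> reg s' 12 = reg s 12 + i \<and>
      (\<forall>a<b. mem s' a = mem s a) \<and>
      (\<forall>j<i. mem s' (b + 9 * j) = reg s 9 \<and> low (mem s') (b + 9 * j) = L ! j \<and>
         high (mem s') (b + 9 * j) = L ! j \<and> number (mem s') (b + 9 * j) = reg s 12 + j \<and>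
         elems (mem s') (b + 9 * j) = [L ! j]) \<and> v = 24 * (?m - i))" for v s'
  have loop: "wp w (While (RLess 17 18) (LOAD 13 17;; LOAD 14 17;; header;; emit 6;; emit 13;; ADD 17 17 6))
      (\<lambda>r s'. I 0 s' \<and> r \<le> 24 * ?m + 1) s1" if "I (24 * ?m) s1" for s1
  proof (rule wp_While[where I = I, OF that])
    fix v s1 assume I: "I v s1" and h: "holds (RLess 17 18) s1"
    obtain i where i: "i \<le> ?m" "frame ?A s s1" "reg s1 17 = t + 8 + i" "reg s1 18 = t + 8 + ?m"
      "reg s1 7 = b + 9 * i" "reg s1 10 = b" "reg s1 11 = b" "reg s1 12 = reg s 12 + i"
      "\<And>a. a < b \<Longrightarrow> mem s1 a = mem s a"
      "\<And>j. j<i \<Longrightarrow> mem s1 (b + 9 * j) = reg s 9 \<and> low (mem s1) (b + 9 * j) = L ! j \<and>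
         high (mem s1) (b + 9 * j) = L ! j \<and> number (mem s1) (b + 9 * j) = reg s 12 + j \<and>
         elems (mem s1) (b + 9 * j) = [L ! j]" "v = 24 * (?m - i)"
      using I unfolding I_def by blast
    have im: "i < ?m" using h i by simp
    note r = frame_reg[OF i(2)]
    have c1: "consts_ok s1" by (rule consts_ok_frame[OF c i(2)]) simp
    have x: "mem s1 (t + 8 + i) = L ! i" using i(9)[of "t + 8 + i"] Lj[OF im] im le by simp
    \<comment> \<open>The values \<open>l\<close> and \<open>l'\<close> are whatever registers 15
      and 16 contain: \<open>node_ok\<close> does not look at the children of a node of level
      0.\<close>
    have fin: "I (24 * (?m - Suc i)) s2"
      if s2: "frame ?A s s2" "reg s2 17 = t + 8 + i + 1" "reg s2 18 = t + 8 + ?m" "reg s2 7 = b + 9 * i + 9"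
        "reg s2 10 = b" "reg s2 11 = b" "reg s2 12 = reg s 12 + i + 1"
        and M: "mem s2 = (mem s1)(b + 9 * i := reg s 9, b + 9 * i + 1 := L ! i, b + 9 * i + 2 := L ! i,
          b + 9 * i + 3 := l, b + 9 * i + 4 := l', b + 9 * i + 5 := l'', b + 9 * i + 6 := reg s 12 + i,
          b + 9 * i + 7 := 1, b + 9 * i + 8 := L ! i)" for s2 l l' l''
    proof -
      have new: "mem s2 (b + 9 * i) = reg s 9" "low (mem s2) (b + 9 * i) = L ! i" "high (mem s2) (b + 9 * i) = L ! i"
        "number (mem s2) (b + 9 * i) = reg s 12 + i"
        by (simp_all add: M low_def high_def number_def)
      have el: "elems (mem s2) (b + 9 * i) = [L ! i]"
        by (simp add: M elems_def upt_rec)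
      have same: "same_rec (mem s1) (mem s2) (b + 9 * j)" if "j < i" for j
        by (rule same_recI) (use i(10)[OF that] that in \<open>auto simp: M\<close>)
      show "I (24 * (?m - Suc i)) s2"
        unfolding I_def
      proof (intro exI[of _ "Suc i"] conjI allI impI)
        fix j assume "j < Suc i"
        then consider "j < i" | "j = i" by linarith
        then show "mem s2 (b + 9 * j) = reg s 9" "low (mem s2) (b + 9 * j) = L ! j"
          "high (mem s2) (b + 9 * j) = L ! j" "number (mem s2) (b + 9 * j) = reg s 12 + j"
          "elems (mem s2) (b + 9 * j) = [L ! j]"
          by (cases; use new el i(10)[of j] same[of j] in \<open>auto simp: same_rec_def\<close>)+
      next
        fix a assume "a < b"
        then show "mem s2 a = mem s a" using i(9)[of a] by (simp add: M)
      qed (use s2 im in auto)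
    qed
    show "wp w (LOAD 13 17;; LOAD 14 17;; header;; emit 6;; emit 13;; ADD 17 17 6)
        (\<lambda>t s'. \<exists>v'. I v' s' \<and> v' + t + 1 \<le> v) s1"
      using c1 i(3-8) x im w le r[of 9]
      apply (simp add: consts_ok_def wp_steps wp_emit wp_header add.assoc cong: wp_cong)
      apply (rule exI[of _ "24 * (?m - Suc i)"], rule conjI)
       apply (rule fin[where l = "reg s1 15" and l' = "reg s1 16" and l'' = 0])
              apply (use i(2,11) in \<open>auto simp: frame_def add.assoc\<close>)
      done
  next
    fix r v' s' assume I: "I v' s'" and h: "\<not> holds (RLess 17 18) s'" and "r + v' \<le> 24 * ?m + 1"
    then show "I 0 s' \<and> r \<le> 24 * ?m + 1"
      by (auto simp: I_def)
  qed
  show ?thesis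
    unfolding leaves_def
    using c t b w le m
    apply (simp add: consts_ok_def wp_steps add.assoc cong: wp_cong)
    apply (rule wp_mono[OF loop])
     apply (simp add: I_def frame_def)
    apply (auto simp: I_def)
    done
qed

text \<open>The leaves enter as a finished level 0 with nothing left to pair; the first round of the
  loop then starts level 1 by the ordinary change of level.\<close>

lemma pair_inv_leaves:
  assumes m: "L \<noteq> []" "length L \<le> 2 ^ H"
    and leaf: "\<And>j. j < length L \<Longrightarrow> M (b + 9 * j) = K \<and> low M (b + 9 * j) = L ! j \<and>
         high M (b + 9 * j) = L ! j \<and> number M (b + 9 * j) = c0 + j \<and> elems M (b + 9 * j) = [L ! j]"
  shows "pair_inv X K L H c0 b M b b (b + 9 * length L) [] [] (map (\<lambda>j. b + 9 * j) [0..<length L])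
    (\<lambda>_. 0) (elems M) 0"
proof -
  let ?U = "map (\<lambda>j. b + 9 * j) [0..<length L]"
  have r: "recs M (b + 9 * i) (map (\<lambda>j. b + 9 * j) [i..<length L]) (b + 9 * length L)" if "i \<le> length L" for i
    using that
  proof (induction i rule: inc_induct)
    case (step i)
    then have "recs M (b + 9 * i + 9) (map (\<lambda>j. b + 9 * j) [Suc i..<length L]) (b + 9 * length L)"
      by (simp add: ac_simps)
    then show ?case using step.hyps leaf[of i] by (simp add: upt_conv_Cons ac_simps)
  qed simp
  have nok: "node_ok X M (\<lambda>_. 0) (set ?U) u \<and> M u = K \<and> set (elems M u) \<subseteq> set L" if "u \<in> set ?U" for u
    using that leaf by (auto simp: node_ok_def coord_le_refl)
  have conc: "concat (map (elems M) ?U) = L"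
  proof -
    have "map (elems M) ?U = map (\<lambda>j. [L ! j]) [0..<length L]" using leaf by auto
    then have "concat (map (elems M) ?U) = map ((!) L) [0..<length L]"
      by (metis concat_map_singleton)
    then show ?thesis by (simp add: map_nth)
  qed
  have "length (concat (map (elems M) ?U)) = (total M ?U)"
    by (simp only: length_concat map_map comp_def)
  then have sum: "(total M ?U) = length L"
    unfolding conc by (rule sym)
  have lenf: "(\<Sum>u\<leftarrow>?U. length (elems M u) * k) = length L * k" for k
    unfolding sum_list_mult_const sum ..
  have wt: "\<forall>f :: nat \<Rightarrow> nat. (\<Sum>u\<leftarrow>[] @ [] @ ?U. length (elems M u) * f 0) +
        (total M []) * sum f {0..H} +
        (total M ?U) * sum f {Suc 0..H} = length L * sum f {0..H}"
    unfolding append_Nil lenf sum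
    by (simp add: sum.atLeast_Suc_atMost[of 0] algebra_simps)
  show ?thesis
    unfolding pair_inv_def
    by (intro conjI wt) (use r[of 0] nok conc leaf m in auto)
qed

abbreviation pair_setup_post :: "(nat \<Rightarrow> nat) \<Rightarrow> nat \<Rightarrow> nat \<Rightarrow> nat \<Rightarrow> config \<Rightarrow> config \<Rightarrow> bool" where
  "pair_setup_post M i nx e' s s' \<equiv> frame {10, 11, 13, 14, 15, 16, 17, 18, 19, 20, 21, 27} s s' \<and> mem s' = M \<and>
     reg s' 11 = e' \<and> reg s' 13 = low M i \<and> reg s' 15 = i \<and> reg s' 17 = i + 8 \<and> reg s' 18 = nx \<and>
     (if nx = e' then reg s' 14 = high M i \<and> reg s' 16 = i \<and> reg s' 19 = nx \<and> reg s' 20 = nx \<and>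
        reg s' 27 = M (i + 7) \<and> reg s' 10 = nx
      else reg s' 14 = high M nx \<and> reg s' 16 = nx \<and> reg s' 19 = nx + 8 \<and> reg s' 20 = nx + 8 + M (nx + 7) \<and>
        reg s' 27 = M (i + 7) + M (nx + 7) \<and> reg s' 10 = nx + 8 + M (nx + 7))"

lemma wp_pair_setup:
  assumes c: "consts_ok s" and regs: "reg s 10 = i" "reg s 11 = e" "reg s 26 = nx" "reg s 7 = b" "mem s = M"
    and w: "b + 10 < words w" "nx \<le> b" "i + 8 \<le> nx"
    and e': "e' = (if i = e then b else e)"
    and w': "nx \<noteq> e' \<Longrightarrow> nx + 8 + M (nx + 7) \<le> b \<and> M (i + 7) + M (nx + 7) \<le> b"
  shows "wp w pair_setup (\<lambda>t s'. pair_setup_post M i nx e' s s' \<and> t \<le> 25) s"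
  using c regs w e' w' unfolding pair_setup_def
  by (cases "i = e"; cases "nx = e'")
    (simp_all add: consts_ok_def wp_steps frame_def low_def high_def add.assoc cong: wp_cong)

lemma wp_node_head:
  assumes "reg s 6 = 1" "reg s 7 = b" "b + 8 + reg s 27 < words w" "reg s 12 + 1 < words w"
  shows "wp w (header;; emit 27;; ADD 25 7 27;; p) Q s \<longleftrightarrow>
    wp w p (\<lambda>t. Q (18 + t)) (s\<lparr>reg := (reg s)(12 := reg s 12 + 1, 7 := b + 8, 25 := b + 8 + reg s 27),
      mem := (mem s)(b := reg s 9, b + 1 := reg s 13, b + 2 := reg s 14, b + 3 := reg s 15,
        b + 4 := reg s 16, b + 5 := reg s 4, b + 6 := reg s 12, b + 7 := reg s 27)\<rparr>)"
  using assms by (simp add: wp_steps wp_emit wp_header add.assoc cong: wp_cong)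

text \<open>Records have positive length, so comparing addresses, which is all that the loops do,
  decides whether records remain.\<close>

lemma recs_Nil_iff: "recs M a vs b \<Longrightarrow> vs = [] \<longleftrightarrow> a = b"
  using recs_bounds[of M a vs b "hd vs"] by (cases vs) auto

text \<open>The accounting identity for constant weight 1, at nine words per entry. The terms beside
  \<open>b\<close> reserve room for what this tree will still write, so the next record is known to
  fit.\<close>

lemma pair_inv_space:
  assumes "pair_inv X K L H c0 b0 M i e b D Q1 Q2 lev sg l"
  shows "b + 9 * (total M Q1 * (Suc H - l) + total M Q2 * (H - l))
      \<le> b0 + 9 * (length L * Suc H)" (is ?A)
    and "b0 + length (D @ Q1 @ Q2) \<le> b" (is ?B)
proof -
  define V where "V = D @ Q1 @ Q2"
  have r: "recs M b0 V b"
    using assms unfolding pair_inv_def V_def by (metis recs_append)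
  have "(\<Sum>u\<leftarrow>V. 8 + length (elems M u)) \<le> (\<Sum>u\<leftarrow>V. 9 * length (elems M u))"
  proof (rule sum_list_mono)
    fix u assume "u \<in> set V"
    then have "elems M u \<noteq> []" using assms unfolding pair_inv_def V_def node_ok_def by blast
    then show "8 + length (elems M u) \<le> 9 * length (elems M u)" by (cases "elems M u") auto
  qed
  then have b: "b \<le> b0 + 9 * total M V"
    using recs_end[OF r] by (simp add: sum_list_const_mult)
  have "(\<Sum>u\<leftarrow>V. length (elems M u) * f (lev u)) + total M Q1 * sum f {l..H} +
        total M Q2 * sum f {Suc l..H} = length L * sum f {0..H}" for f :: "nat \<Rightarrow> nat"
    using assms unfolding pair_inv_def V_def by blast
  from this[of "\<lambda>_. 1"] b show ?A by (simp add: algebra_simps)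
  have "(\<Sum>u\<leftarrow>V. 1) \<le> (\<Sum>u\<leftarrow>V. 8 + length (elems M u))" by (rule sum_list_mono) simp
  then show ?B using recs_end[OF r] by (simp add: V_def sum_list_triv)
qed

abbreviation "tree_regs \<equiv> {7, 10, 11, 12, 13, 14, 15, 16, 17, 18, 19, 20, 21, 22, 23, 24, 25, 26, 27} :: nat set"

text \<open>The credit is 70 steps for every entry still to be written. A round that creates a
  record of \<open>z\<close> entries takes at most \<open>14 * z + 49\<close> steps with its test,
  and \<open>z\<close> is positive.\<close>

definition tree_inv where
  "tree_inv X K L H c0 b0 s0 v s \<longleftrightarrow> frame tree_regs s0 s \<and> (\<forall>a<b0. mem s a = mem s0 a) \<and>
     (\<exists>i e b D Q1 Q2 lev sg l. pair_inv X K L H c0 b0 (mem s) i e b D Q1 Q2 lev sg l \<and>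
        reg s 10 = i \<and> reg s 11 = e \<and> reg s 7 = b \<and> reg s 12 = c0 + length (D @ Q1 @ Q2) \<and> Q1 @ Q2 \<noteq> [] \<and>
        reg s 26 = i + 8 + mem s (i + 7) \<and>
        v = 70 * (total (mem s) Q1 * (Suc H - l) +
              total (mem s) Q2 * (H - l)))"

lemma wp_pair_body:
  assumes inv: "tree_inv X K L H c0 b0 s0 v s" and more: "reg s 26 < reg s 7"
    and s0: "consts_ok s0" "reg s0 1 = d" "reg s0 9 = K" and X: "\<And>p. X p K = crd s0 (p * d + K)"
    and L: "sorted_wrt (coord_le X K) L" "distinct L"
    and fits: "\<And>x. x \<in> set L \<Longrightarrow> x * d + K < words w"
    and w: "c0 \<le> b0" "b0 + 9 * (length L * Suc H) + 20 < words w"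
  shows "wp w pair_body (\<lambda>t s'. \<exists>v'. tree_inv X K L H c0 b0 s0 v' s' \<and> v' + t + 1 \<le> v) s"
proof -
  let ?M = "mem s"
  let ?sz = "\<lambda>Q. \<Sum>u\<leftarrow>Q. length (elems ?M u)"
  have fr: "frame tree_regs s0 s" and low0: "\<And>a. a < b0 \<Longrightarrow> mem s a = mem s0 a"
    using inv unfolding tree_inv_def by simp_all
  obtain i e b D R1 R2 lev sg l0 where
    P0: "pair_inv X K L H c0 b0 ?M i e b D R1 R2 lev sg l0"
    and regs: "reg s 10 = i" "reg s 11 = e" "reg s 7 = b" "reg s 12 = c0 + length (D @ R1 @ R2)"
      "reg s 26 = i + 8 + ?M (i + 7)" and ne0: "R1 @ R2 \<noteq> []"
    and v0: "v = 70 * (?sz R1 * (Suc H - l0) + ?sz R2 * (H - l0))"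
    using inv unfolding tree_inv_def by (elim conjE exE) (rule that)
  note fr0 = frame_reg[OF fr]
  have c: "consts_ok s" by (rule consts_ok_frame[OF s0(1) fr]) simp
  define nx where "nx = i + 8 + length (elems ?M i)"
  have nx: "reg s 26 = nx" "nx < b" using regs more by (auto simp: nx_def elems_def)
  define e' where "e' = (if i = e then b else e)"
  \<comment> \<open>If the level is exhausted, its results become the runs to pair, as in the first
    test of \<open>pair_setup\<close>. There are at least two of them, since a single one would end
    at \<open>b\<close> and fail the loop test.\<close>
  obtain Q1 Q2 l where P: "pair_inv X K L H c0 b0 ?M i e' b D Q1 Q2 lev sg l" and Q1: "Q1 \<noteq> []"
    and V: "D @ R1 @ R2 = D @ Q1 @ Q2" and v: "v = 70 * (?sz Q1 * (Suc H - l) + ?sz Q2 * (H - l))"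
  proof (cases "R1 = []")
    case True
    have r: "i = e" "recs ?M e R2 b" using P0 True by (auto simp: pair_inv_def)
    have "2 \<le> length R2"
    proof (rule ccontr)
      assume "\<not> 2 \<le> length R2"
      then obtain u where "R2 = [u]" using True ne0 by (cases R2) (auto simp: not_le less_Suc_eq numeral_2_eq_2)
      then show False using r nx by (auto simp: nx_def)
    qed
    from pair_inv_next_level[OF _ this, of X K L H c0 b0 ?M i b D lev sg l0] P0 True r(1)
    show ?thesis using ne0 v0 True r(1) by (intro that[of R2 "[]" "Suc l0"]) (auto simp: e'_def)
  next
    case False
    have "recs ?M i R1 e" using P0 by (simp add: pair_inv_def)
    then have "i \<noteq> e" using recs_Nil_iff False by blast
    then show ?thesis using P0 False v0 by (intro that[of R1 R2 l0]) (auto simp: e'_def)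
  qed
  have rec: "recs ?M b0 D i" "recs ?M i Q1 e'" "recs ?M e' Q2 b" and
    nodes: "\<And>u. u \<in> set (D @ Q1 @ Q2) \<Longrightarrow> node_ok X ?M lev (set (D @ Q1 @ Q2)) u \<and> ?M u = K \<and> set (elems ?M u) \<subseteq> set L"
    and lH: "l \<le> H"
    using P unfolding pair_inv_def by blast+
  have e'b: "e' \<le> b" using recs_le[OF rec(3)] .
  define Q1' y xs where "Q1' = tl (if nx = e' then Q1 else tl Q1)" and "y = (if nx = e' then i else nx)"
    and "xs = (if nx = e' then [i] else [i, nx])"
  define i' where "i' = (if nx = e' then nx else nx + 8 + length (elems ?M nx))"
  obtain r where r: "Q1 = i # r" "recs ?M nx r e'" using rec(2) Q1 by (cases Q1) (auto simp: nx_def)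
  have r_Nil: "r = [] \<longleftrightarrow> nx = e'"
    using recs_Nil_iff[OF r(2)] .
  have split: "Q1 = xs @ Q1'" "xs = [i] \<and> y = i \<and> Q1' = [] \<or> xs = [i, y]" "recs ?M i xs i'" "i' \<le> b"
  proof -
    have "Q1 = xs @ Q1' \<and> (xs = [i] \<and> y = i \<and> Q1' = [] \<or> xs = [i, y]) \<and> recs ?M i xs i' \<and> i' \<le> e'"
    proof (cases r)
      case Nil
      then show ?thesis using r r_Nil by (auto simp: xs_def Q1'_def y_def i'_def nx_def)
    next
      case (Cons u r')
      then have "u = nx" "recs ?M (nx + 8 + length (elems ?M nx)) r' e'" "nx \<noteq> e'" using r r_Nil by auto
      moreover have "nx + 8 + length (elems ?M nx) \<le> e'" using recs_le[OF calculation(2)] .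
      ultimately show ?thesis using Cons r(1) by (simp add: xs_def Q1'_def y_def i'_def flip: nx_def)
    qed
    then show "Q1 = xs @ Q1'" "xs = [i] \<and> y = i \<and> Q1' = [] \<or> xs = [i, y]" "recs ?M i xs i'" "i' \<le> b"
      using e'b by auto
  qed
  define z where "z = ?sz xs"
  have z: "z = (if nx = e' then length (elems ?M i) else length (elems ?M i) + length (elems ?M nx))"
    by (simp add: z_def xs_def)
  have xsV: "u \<in> set (D @ Q1 @ Q2)" if "u \<in> set xs" for u using that split(1) by auto
  have z0: "0 < z"
    using nodes[OF xsV[of i]] by (auto simp: z xs_def node_ok_def)
  have zle: "z * (Suc H - l) \<le> ?sz Q1 * (Suc H - l)" by (simp add: split(1) z_def)
  \<comment> \<open>The list of the new record is among the entries still to be written, so the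
    space bound extends beyond it.\<close>
  have "z * 1 \<le> z * (Suc H - l)" using lH by (intro mult_le_mono2) simp
  then have zle': "z \<le> ?sz Q1 * (Suc H - l)" using zle by linarith
  have "b + 9 * z \<le> b + 9 * (?sz Q1 * (Suc H - l) + ?sz Q2 * (H - l))"
    using zle' by (intro add_left_mono mult_le_mono2 trans_le_add1)
  then have "b + 9 * z \<le> b0 + 9 * (length L * Suc H)"
    using pair_inv_space(1)[OF P] by (rule order.trans)
  then have bz: "b + 9 * z + 20 < words w" using w by linarith
  have cnt: "c0 + length (D @ Q1 @ Q2) + 1 < words w" using pair_inv_space(2)[OF P] w bz by linarith
  have M7: "?M (i + 7) = length (elems ?M i)" "?M (nx + 7) = length (elems ?M nx)" by (simp_all add: elems_def)
  have pre: "wp w pair_setup (\<lambda>t s'. pair_setup_post ?M i nx e' s s' \<and> t \<le> 25) s"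
  proof (rule wp_pair_setup[OF c regs(1,2) nx(1) regs(3) refl])
    show "b + 10 < words w" using bz by simp
    show "nx \<le> b" "i + 8 \<le> nx" using nx by (auto simp: nx_def)
    show "e' = (if i = e then b else e)" by (rule e'_def)
    assume "nx \<noteq> e'"
    then show "nx + 8 + ?M (nx + 7) \<le> b \<and> ?M (i + 7) + ?M (nx + 7) \<le> b"
    proof -
      have "length (elems ?M i) \<le> nx" by (simp add: nx_def)
      then show ?thesis using split(4) \<open>nx \<noteq> e'\<close> by (simp add: i'_def M7)
    qed
  qed
  show ?thesis
    unfolding pair_body_def wp_Seq[of w pair_setup]
  proof (rule wp_mono[OF pre], elim conjE)
    fix t1 :: nat and s1
    assume fr1: "frame {10, 11, 13, 14, 15, 16, 17, 18, 19, 20, 21, 27} s s1" and m1: "mem s1 = ?M"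
      and r1: "reg s1 11 = e'" "reg s1 13 = low ?M i" "reg s1 15 = i" "reg s1 17 = i + 8" "reg s1 18 = nx"
      and r1': "if nx = e' then reg s1 14 = high ?M i \<and> reg s1 16 = i \<and> reg s1 19 = nx \<and> reg s1 20 = nx \<and>
        reg s1 27 = ?M (i + 7) \<and> reg s1 10 = nx
      else reg s1 14 = high ?M nx \<and> reg s1 16 = nx \<and> reg s1 19 = nx + 8 \<and> reg s1 20 = nx + 8 + ?M (nx + 7) \<and>
        reg s1 27 = ?M (i + 7) + ?M (nx + 7) \<and> reg s1 10 = nx + 8 + ?M (nx + 7)" and t1: "t1 \<le> 25"
    note f1 = frame_reg[OF fr1]
    have g: "reg s1 14 = high ?M y" "reg s1 16 = y" "reg s1 27 = z" "reg s1 10 = i'"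
      using r1' by (auto simp: y_def z M7 i'_def split: if_splits)
    define q qe where "q = reg s1 19" and "qe = reg s1 20"
    have c1: "reg s1 6 = 1" "reg s1 4 = 0" "reg s1 7 = b" "reg s1 9 = K" "reg s1 1 = d"
      "reg s1 12 = c0 + length (D @ Q1 @ Q2)"
      using f1[of 6] f1[of 4] f1[of 7] f1[of 9] f1[of 1] f1[of 12] c regs V fr0[of 9] fr0[of 1] s0
      by (auto simp: consts_ok_def)
    define M2 where "M2 = ?M(b := K, b + 1 := low ?M i, b + 2 := high ?M y, b + 3 := i,
        b + 4 := y, b + 5 := 0, b + 6 := c0 + length (D @ Q1 @ Q2), b + 7 := z)"
    define s2 where "s2 = s1\<lparr>reg := (reg s1)(12 := c0 + length (D @ Q1 @ Q2) + 1, 7 := b + 8, 25 := b + 8 + z), mem := M2\<rparr>"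
    have M2b: "M2 a = ?M a" if "a < b" for a using that by (simp add: M2_def)
    have xs1: "map M2 [i + 8..<nx] = elems ?M i"
    proof -
      have "map M2 [i + 8..<nx] = map ?M [i + 8..<nx]" using nx by (auto simp: M2b)
      then show ?thesis by (simp add: elems_def nx_def)
    qed
    have qb: "q \<le> qe" "qe \<le> b" "z = (nx - (i + 8)) + (qe - q)" and
      xs2: "map M2 [q..<qe] = (if nx = e' then [] else elems ?M nx)"
    proof -
      show q: "q \<le> qe" "qe \<le> b" "z = (nx - (i + 8)) + (qe - q)"
      proof -
        have "nx - (i + 8) = length (elems ?M i)" by (simp add: nx_def)
        moreover have "if nx = e' then q = nx \<and> qe = nx else q = nx + 8 \<and> qe = nx + 8 + length (elems ?M nx)"
          using r1' by (simp add: q_def qe_def M7 split: if_splits)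
        ultimately show "q \<le> qe" "qe \<le> b" "z = (nx - (i + 8)) + (qe - q)"
          using split(4) nx(2) by (auto simp: z i'_def split: if_splits)
      qed
      have "map M2 [q..<qe] = map ?M [q..<qe]" using q by (auto simp: M2b)
      then show "map M2 [q..<qe] = (if nx = e' then [] else elems ?M nx)"
        using r1' by (auto simp: elems_def q_def qe_def)
    qed
    define zs where "zs = merge_by (\<lambda>x. crd s0 (x * d + K)) (elems ?M i) (if nx = e' then [] else elems ?M nx)"
    have crd: "crd s2 = crd s0" using frame_crd[OF fr] frame_crd[OF fr1] by (simp add: s2_def)
    have merge: "wp w merge_prog (\<lambda>t s'. frame {7, 17, 19, 21, 22, 23, 24} s2 s' \<and> reg s' 7 = b + 8 + z \<and>
      (\<forall>a<b + 8. mem s' a = mem s2 a) \<and>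
      map (mem s') [b + 8..<b + 8 + z] = merge_by (\<lambda>x. crd s2 (x * reg s2 1 + reg s2 9))
        (map (mem s2) [i + 8..<nx]) (map (mem s2) [q..<qe]) \<and>
      t \<le> 14 * (b + 8 + z - (b + 8)) + 1) s2"
    proof (rule wp_merge)
      show "reg s2 6 = 1" "reg s2 7 = b + 8" "reg s2 17 = i + 8" "reg s2 18 = nx" "reg s2 19 = q" "reg s2 20 = qe"
        "reg s2 25 = b + 8 + z" using c1 r1 by (auto simp: s2_def q_def qe_def)
      show "i + 8 \<le> nx" "nx \<le> b + 8" "q \<le> qe" "qe \<le> b + 8" "b + 8 + z = b + 8 + (nx - (i + 8)) + (qe - q)"
        "b + 8 + z + 1 < words w" using nx qb bz by (auto simp: nx_def)
      fix a assume "a \<in> {i + 8..<nx} \<union> {q..<qe}"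
      then have "M2 a \<in> set (map M2 [i + 8..<nx]) \<union> set (map M2 [q..<qe])" by auto
      then have "M2 a \<in> set L" unfolding xs1 xs2 using nodes[OF xsV] by (auto simp: xs_def split: if_splits)
      then show "mem s2 a * reg s2 1 + reg s2 9 < words w" using fits c1 by (simp add: s2_def)
    qed
    have "wp w (merge_prog;; succ_prog) (\<lambda>t s'. \<exists>v'. tree_inv X K L H c0 b0 s0 v' s' \<and> v' + (t1 + (18 + t)) + 1 \<le> v) s2"
      unfolding wp_Seq[of w merge_prog]
    proof (rule wp_mono[OF merge], elim conjE)
      fix t3 :: nat and s3
      assume fr3: "frame {7, 17, 19, 21, 22, 23, 24} s2 s3" and r3: "reg s3 7 = b + 8 + z"
        and m3: "\<forall>a<b + 8. mem s3 a = mem s2 a"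
        and mm: "map (mem s3) [b + 8..<b + 8 + z] = merge_by (\<lambda>x. crd s2 (x * reg s2 1 + reg s2 9))
          (map (mem s2) [i + 8..<nx]) (map (mem s2) [q..<qe])"
        and t3: "t3 \<le> 14 * (b + 8 + z - (b + 8)) + 1"
      note f3 = frame_reg[OF fr3]
      have mem2: "mem s2 = M2" by (simp add: s2_def)
      have M3: "mem s3 a = M2 a" if "a < b + 8" for a using m3 that mem2 by simp
      have "map (mem s3) [b + 8..<b + 8 + z] = zs"
        using mm c1 unfolding mem2 xs1 xs2 crd zs_def by (simp add: s2_def)
      then have el: "elems (mem s3) b = zs" by (simp add: elems_def M3) (simp add: M2_def)
      have lz: "length zs = z" by (simp add: zs_def z length_merge_by)
      have P': "pair_inv X K L H c0 b0 (mem s3) i' e' (b + 8 + z) (D @ xs) Q1' (Q2 @ [b]) (lev(b := l))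
         (sg(b := concat (map sg xs))) l"
      proof (rule pair_inv_step[OF P[unfolded split(1)] split(2) L])
        show "mem s3 a = ?M a" if "a < b" for a using that by (simp add: M3 M2b)
        show "mem s3 b = K" "low (mem s3) b = low ?M i" "high (mem s3) b = high ?M y" "left (mem s3) b = i"
          "right (mem s3) b = y" "number (mem s3) b = c0 + length (D @ xs @ Q1' @ Q2)"
          by (simp_all add: low_def high_def left_def right_def number_def M3)
            (simp_all add: M2_def low_def high_def split(1))
        show "elems (mem s3) b = zs" by (rule el)
        show "mset zs = (\<Sum>u\<leftarrow>xs. mset (elems ?M u))" by (simp add: zs_def xs_def mset_merge_by)
        have le: "coord_le X (Suc K) = (\<lambda>p r. crd s0 (p * d + K) \<le> crd s0 (r * d + K))"
          by (intro ext) (simp add: coord_le_def X)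
        have so: "sorted_wrt (\<lambda>p r. crd s0 (p * d + K) \<le> crd s0 (r * d + K)) (elems ?M u)" if "u \<in> set xs" for u
        proof -
          have "sorted_wrt (coord_le X (Suc (?M u))) (elems ?M u)" "?M u = K"
            using nodes[OF xsV[OF that]] unfolding node_ok_def by blast+
          then show ?thesis using le by simp
        qed
        have "sorted_wrt (\<lambda>p r. crd s0 (p * d + K) \<le> crd s0 (r * d + K)) zs"
          unfolding zs_def by (rule sorted_merge_by) (use so in \<open>auto simp: xs_def\<close>)
        then show "sorted_wrt (coord_le X (Suc K)) zs" using le by simp
        show "recs ?M i xs i'" by (rule split)
        show "b + 8 + z = b + 8 + length zs" by (simp add: lz)
      qed
      have c3: "consts_ok s3"
      proof (rule consts_ok_frame[OF _ fr3])
        show "consts_ok s2" using c f1 by (simp add: s2_def consts_ok_def)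
      qed simp
      have i3: "reg s3 10 = i'" using f3[of 10] g by (simp add: s2_def)
      have nb: "i' + 8 + mem s3 (i' + 7) \<le> b + 8 + z"
      proof -
        have "recs (mem s3) i' (Q1' @ Q2 @ [b]) (b + 8 + z)"
          using P' unfolding pair_inv_def by (metis recs_append)
        then have "i' + 8 + length (elems (mem s3) i') \<le> b + 8 + z"
          by (cases "Q1' @ Q2 @ [b]") (auto dest: recs_le)
        then show ?thesis by (simp add: elems_def)
      qed
      define s4 where "s4 = s3\<lparr>reg := (reg s3)(21 := mem s3 (i' + 7), 26 := i' + 8 + mem s3 (i' + 7))\<rparr>"
      define v' where "v' = 70 * (total (mem s4) Q1' * (Suc H - l) +
              total (mem s4) (Q2 @ [b]) * (H - l))"
      have T: "tree_inv X K L H c0 b0 s0 v' s4"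
        unfolding tree_inv_def
      proof (intro conjI exI)
        show "frame tree_regs s0 s4"
          using fr fr1 fr3 by (auto simp: frame_def s4_def s2_def)
        show "\<forall>a<b0. mem s4 a = mem s0 a"
        proof (intro allI impI)
          fix a assume "a < b0"
          moreover have "b0 \<le> b" using pair_inv_space(2)[OF P] by simp
          ultimately show "mem s4 a = mem s0 a" using low0 by (simp add: s4_def M3 M2b)
        qed
        show "pair_inv X K L H c0 b0 (mem s4) i' e' (b + 8 + z) (D @ xs) Q1' (Q2 @ [b]) (lev(b := l))
          (sg(b := concat (map sg xs))) l" using P' by (simp add: s4_def)
        show "reg s4 10 = i'" "reg s4 7 = b + 8 + z" using i3 r3 by (auto simp: s4_def)
        show "reg s4 11 = e'" using f3[of 11] r1 by (simp add: s4_def s2_def)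
        show "reg s4 12 = c0 + length ((D @ xs) @ Q1' @ Q2 @ [b])"
          using f3[of 12] split(1) by (simp add: s4_def s2_def)
        show "Q1' @ Q2 @ [b] \<noteq> []" by simp
        show "reg s4 26 = i' + 8 + mem s4 (i' + 7)" by (simp add: s4_def)
        show "v' = 70 * (total (mem s4) Q1' * (Suc H - l) +
              total (mem s4) (Q2 @ [b]) * (H - l))" by (rule v'_def)
      qed
      have old: "elems (mem s4) u = elems ?M u" if "u \<in> set (Q1' @ Q2)" for u
      proof -
        have rV: "recs ?M b0 (D @ Q1 @ Q2) b" using rec by (metis recs_append)
        have "same_rec ?M (mem s4) u"
          by (rule recs_same[OF rV]) (use that split(1) in \<open>auto simp: s4_def M3 M2b\<close>)
        then show ?thesis by (simp add: same_rec_def)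
      qed
      have "total (mem s4) Q1' = ?sz Q1'" "total (mem s4) Q2 = ?sz Q2"
        by (intro arg_cong[of _ _ sum_list] map_cong; use old in auto)+
      then have "v' = 70 * (?sz Q1' * (Suc H - l) + (?sz Q2 + z) * (H - l))"
        using el lz by (simp add: v'_def s4_def)
      moreover have "v = 70 * ((z + ?sz Q1') * (Suc H - l) + ?sz Q2 * (H - l))"
        by (simp add: v split(1) z_def)
      moreover have "Suc H - l = Suc (H - l)" using lH by simp
      ultimately have "v' + 70 * z = v" by (simp add: algebra_simps)
      then have time: "v' + (t1 + (18 + (t3 + 4))) + 1 \<le> v" using t1 t3 z0 by simp
      show "wp w succ_prog (\<lambda>t'. \<lambda>s'. \<exists>v'. tree_inv X K L H c0 b0 s0 v' s' \<and> v' + (t1 + (18 + (t3 + t'))) + 1 \<le> v) s3"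
        using wp_succ[OF c3 i3] nb bz T time unfolding s4_def by auto
    qed
    then show "wp w (header;; emit 27;; ADD 25 7 27;; merge_prog;; succ_prog)
       (\<lambda>t' s'. \<exists>v'. tree_inv X K L H c0 b0 s0 v' s' \<and> v' + (t1 + t') + 1 \<le> v) s1"
      using wp_node_head[of s1 b w] c1 g bz cnt m1 r1 unfolding s2_def M2_def by simp
  qed
qed

abbreviation tree_post ::
  "(nat \<Rightarrow> nat \<Rightarrow> real) \<Rightarrow> nat \<Rightarrow> nat list \<Rightarrow> nat \<Rightarrow> nat \<Rightarrow> nat \<Rightarrow> config \<Rightarrow> config \<Rightarrow> bool \<Rightarrow> bool" where
  "tree_post X K L H c0 b0 s s' time \<equiv> \<exists>U lev. frame tree_regs s s' \<and> (\<forall>a<b0. mem s' a = mem s a) \<and>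
      recs (mem s') b0 U (reg s' 7) \<and> U \<noteq> [] \<and> reg s' 10 = last U \<and> reg s' 12 = c0 + length U \<and>
      (\<forall>u\<in>set U. node_ok X (mem s') lev (set U) u \<and> mem s' u = K \<and> set (elems (mem s') u) \<subseteq> set L) \<and>
      (\<forall>j<length U. number (mem s') (U ! j) = c0 + j) \<and>
      lev (last U) \<le> H \<and> set (elems (mem s') (last U)) = set L \<and>
      (\<forall>f. (\<Sum>u\<leftarrow>U. length (elems (mem s') u) * f (lev u)) \<le> length L * sum f {0..H}) \<and>
      time"

text \<open>The factor 94 is made up of 24 steps for each leaf and 70 for each entry of the higher
  levels. The weighted sum stays available for every \<open>f\<close>, because the caller
  substitutes the weights of the following dimensions.\<close>

lemma wp_tree:
  assumes c: "consts_ok s" and regs: "reg s 1 = d" "reg s 9 = K" "reg s 8 = t" "reg s 7 = b0" "reg s 12 = c0"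
    and X: "\<And>p. X p K = crd s (p * d + K)"
    and L: "elems (mem s) t = L" "L \<noteq> []" "length L \<le> 2 ^ H" "sorted_wrt (coord_le X K) L" "distinct L"
    and fits: "\<And>x. x \<in> set L \<Longrightarrow> x * d + K < words w"
    and w: "c0 \<le> b0" "t + 8 + length L \<le> b0" "b0 + 9 * (length L * Suc H) + 20 < words w"
  shows "wp w tree_prog (\<lambda>r s'. tree_post X K L H c0 b0 s s' (r \<le> 94 * (length L * Suc H) + 12)) s"
proof -
  let ?m = "length L"
  have lb: "wp w leaves (\<lambda>r s'. leaves_post L b0 s s' \<and>
      r \<le> 24 * ?m + 7) s"
    by (rule wp_leaves[OF c regs(3,4) L(1) w(2)]) (use w regs in auto)
  show ?thesis
    unfolding tree_prog_def wp_Seq[of w leaves]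
  proof (rule wp_mono[OF lb], elim conjE)
    fix t1 :: nat and s1
    assume fr1: "frame {7, 10, 11, 12, 13, 14, 17, 18, 21} s s1"
      and r1: "reg s1 7 = b0 + 9 * ?m" "reg s1 10 = b0" "reg s1 11 = b0" "reg s1 12 = reg s 12 + ?m"
      and m1: "\<forall>a<b0. mem s1 a = mem s a"
      and leaf: "\<forall>j<?m. mem s1 (b0 + 9 * j) = reg s 9 \<and> low (mem s1) (b0 + 9 * j) = L ! j \<and>
         high (mem s1) (b0 + 9 * j) = L ! j \<and> number (mem s1) (b0 + 9 * j) = reg s 12 + j \<and>
         elems (mem s1) (b0 + 9 * j) = [L ! j]"
      and t1: "t1 \<le> 24 * ?m + 7"
    have c1: "consts_ok s1" by (rule consts_ok_frame[OF c fr1]) simp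
    let ?U = "map (\<lambda>j. b0 + 9 * j) [0..<?m]"
    have P: "pair_inv X K L H c0 b0 (mem s1) b0 b0 (b0 + 9 * ?m) [] [] ?U (\<lambda>_. 0) (elems (mem s1)) 0"
      by (rule pair_inv_leaves[OF L(2,3)]) (use leaf regs in auto)
    have "elems (mem s1) b0 = [L ! 0]" using leaf L(2) by (metis add_0_right length_greater_0_conv mult_0_right)
    then have one: "mem s1 (b0 + 7) = 1" using length_map[of "mem s1" "[b0 + 8..<b0 + 8 + mem s1 (b0 + 7)]"] by (simp add: elems_def)
    have m0: "0 < ?m" using L(2) by simp
    define s2 where "s2 = s1\<lparr>reg := (reg s1)(21 := mem s1 (b0 + 7), 26 := b0 + 8 + mem s1 (b0 + 7))\<rparr>"
    have "?m \<le> ?m * Suc H" by simp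
    then have succ: "wp w succ_prog Q s1 \<longleftrightarrow> Q 4 s2" for Q
      using wp_succ[OF c1 r1(2), of w Q] w m0 one by (simp add: s2_def)
    have size: "(total (mem s2) ?U) = ?m"
      using pair_inv_size[OF P] by (simp add: s2_def)
    have I: "tree_inv X K L H c0 b0 s (70 * (?m * H)) s2"
      unfolding tree_inv_def
    proof (intro conjI exI)
      show "frame tree_regs s s2" using fr1 by (auto simp: frame_def s2_def)
      show "\<forall>a<b0. mem s2 a = mem s a" using m1 by (simp add: s2_def)
      show "pair_inv X K L H c0 b0 (mem s2) b0 b0 (b0 + 9 * ?m) [] [] ?U (\<lambda>_. 0) (elems (mem s1)) 0"
        using P by (simp add: s2_def)
      show "70 * (?m * H) = 70 * ((total (mem s2) []) * (Suc H - 0) +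
         (total (mem s2) ?U) * (H - 0))" unfolding size by simp
    qed (use r1 regs m0 in \<open>simp_all add: s2_def\<close>)
    have "wp w (While (RLess 26 7) pair_body)
      (\<lambda>r s'. \<exists>v'. tree_inv X K L H c0 b0 s v' s' \<and> \<not> holds (RLess 26 7) s' \<and> r + v' \<le> 70 * (?m * H) + 1) s2"
    proof (rule wp_While[where I = "tree_inv X K L H c0 b0 s", OF I])
      fix v s' assume "tree_inv X K L H c0 b0 s v s'" "holds (RLess 26 7) s'"
      then show "wp w pair_body (\<lambda>t s'. \<exists>v'. tree_inv X K L H c0 b0 s v' s' \<and> v' + t + 1 \<le> v) s'"
        by (intro wp_pair_body[OF _ _ c regs(1,2) X L(4,5) fits w(1,3)]) simp_all
    qed blast
    then have "wp w (succ_prog;; While (RLess 26 7) pair_body)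
      (\<lambda>r s'. \<exists>v'. tree_inv X K L H c0 b0 s v' s' \<and> \<not> holds (RLess 26 7) s' \<and> r \<le> 70 * (?m * H) + 5) s1"
      unfolding wp_Seq[of w succ_prog] succ by (rule wp_mono) auto
    then show "wp w (succ_prog;; While (RLess 26 7) pair_body) (\<lambda>r s'. tree_post X K L H c0 b0 s s' (t1 + r \<le> 94 * (length L * Suc H) + 12)) s1"
    proof (rule wp_mono, elim exE conjE)
      fix r :: nat and s' v' assume I: "tree_inv X K L H c0 b0 s v' s'" and h: "\<not> holds (RLess 26 7) s'"
        and r: "r \<le> 70 * (?m * H) + 5"
      have fr: "frame tree_regs s s'" and low: "\<forall>a<b0. mem s' a = mem s a"
        using I unfolding tree_inv_def by blast+
      obtain i e b D Q1 Q2 lev sg l where P: "pair_inv X K L H c0 b0 (mem s') i e b D Q1 Q2 lev sg l"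
        and g: "reg s' 10 = i" "reg s' 7 = b" "reg s' 12 = c0 + length (D @ Q1 @ Q2)" "Q1 @ Q2 \<noteq> []"
          "reg s' 26 = i + 8 + mem s' (i + 7)"
        using I unfolding tree_inv_def by (elim conjE exE) (rule that)
      have "recs (mem s') i (Q1 @ Q2) b" and rV: "recs (mem s') b0 (D @ Q1 @ Q2) b"
        using P unfolding pair_inv_def by (metis recs_append)+
      then obtain u Q where Q: "Q1 @ Q2 = u # Q" "u = i" "recs (mem s') (i + 8 + mem s' (i + 7)) Q b"
        using g(4) by (cases "Q1 @ Q2") (auto simp: elems_def)
      \<comment> \<open>At exit the first unpaired record ends at the free address. It is therefore
        the only one left, and its segment is all of \<open>L\<close>.\<close>
      have "i + 8 + mem s' (i + 7) = b" using recs_le[OF Q(3)] h g by simp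
      then have "Q = []" using recs_Nil_iff[OF Q(3)] by simp
      then have QQ: "Q1 @ Q2 = [i]" using Q by simp
      have V: "D @ Q1 @ Q2 = D @ [i]" using QQ by simp
      have i: "lev i \<le> l" "sg i = L" "mset (elems (mem s') i) = mset (sg i)" "l \<le> H"
        using P QQ unfolding pair_inv_def by (auto simp: append_eq_Cons_conv)
      have nodes: "\<forall>u\<in>set (D @ [i]). node_ok X (mem s') lev (set (D @ [i])) u \<and> mem s' u = K \<and> set (elems (mem s') u) \<subseteq> set L"
        "\<forall>j<length (D @ [i]). number (mem s') ((D @ [i]) ! j) = c0 + j"
        using P unfolding pair_inv_def V by blast+
      have wt: "\<forall>f. (\<Sum>u\<leftarrow>D @ [i]. length (elems (mem s') u) * f (lev u)) \<le> length L * sum f {0..H}"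
      proof
        fix f :: "nat \<Rightarrow> nat"
        have "(\<Sum>u\<leftarrow>D @ [i]. length (elems (mem s') u) * f (lev u)) + total (mem s') Q1 * sum f {l..H} +
          total (mem s') Q2 * sum f {Suc l..H} = length L * sum f {0..H}"
          using P unfolding pair_inv_def V by blast
        then show "(\<Sum>u\<leftarrow>D @ [i]. length (elems (mem s') u) * f (lev u)) \<le> length L * sum f {0..H}"
          by linarith
      qed
      have "t1 + r \<le> 94 * (?m * Suc H) + 12" using t1 r by (simp add: algebra_simps)
      moreover have "set (elems (mem s') i) = set L" using i(2,3) by (auto dest: mset_eq_setD)
      ultimately show "tree_post X K L H c0 b0 s s' (t1 + r \<le> 94 * (length L * Suc H) + 12)"
        using fr low rV g nodes wt i(1,4) unfolding V
        by (intro exI[of _ "D @ [i]"] exI[of _ lev]) simp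
    qed
  qed
qed

section \<open>Building all trees\<close>

text \<open>
  Bounds, per point, the size of everything that is built from a node of level \<open>l\<close> when \<open>j\<close>
  dimensions remain. The factor \<open>j + 1\<close> accounts for the nodes of intermediate dimensions.
\<close>

definition weight :: "nat \<Rightarrow> nat \<Rightarrow> nat" where
  "weight l j = Suc j * ((l + j) choose j)"

abbreviation pending :: "nat \<Rightarrow> (nat \<Rightarrow> nat) \<Rightarrow> (nat \<Rightarrow> nat) \<Rightarrow> nat list \<Rightarrow> nat" where
  "pending d M lev us \<equiv> \<Sum>u\<leftarrow>us. length (elems M u) * weight (lev u) (d - M u)"

lemma weight_pos: "1 \<le> weight l j"
  by (simp add: weight_def Suc_le_eq One_nat_def del: mult_Suc)

lemma weight_mono: "l \<le> l' \<Longrightarrow> weight l j \<le> weight l' j"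
  unfolding weight_def by (intro mult_le_mono2 binomial_right_mono) auto

lemma sum_choose: "(\<Sum>i=0..l. (i + j) choose j) = (l + Suc j) choose Suc j"
  by (induction l) auto

lemma Suc_le_choose: "Suc l \<le> (l + Suc j) choose Suc j"
proof -
  have "(\<Sum>i=0..l. 1) \<le> (\<Sum>i=0..l. (i + j) choose j)"
    by (intro sum_mono) (simp add: Suc_le_eq One_nat_def)
  then show ?thesis unfolding sum_choose by simp
qed

text \<open>The sum yields \<open>j + 1\<close> copies of \<open>(l + Suc j) choose Suc j\<close>,
  while \<open>weight l (Suc j)\<close> has \<open>j + 2\<close>. The spare copy is at least
  \<open>l + 1\<close> and pays for the entries of the tree itself, one per point and level.\<close>

lemma weight_step: "(\<Sum>i=0..l. weight i j) + Suc l \<le> weight l (Suc j)"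
proof -
  have "(\<Sum>i=0..l. weight i j) = Suc j * ((l + Suc j) choose Suc j)"
    unfolding weight_def sum_distrib_left[symmetric] sum_choose ..
  then show ?thesis using Suc_le_choose[where l = l and j = j] by (simp add: weight_def)
qed

text \<open>The node \<open>v\<close> is treated apart from \<open>U\<close> because the record of
  all points refers to the range tree from outside.\<close>

lemma next_ok_cong:
  assumes "\<And>u. u \<in> U \<Longrightarrow> same_rec M M' u" "\<And>u. u \<in> U \<Longrightarrow> lev' u = lev u"
    and "same_rec M M' v" "lev' v = lev v" "next_tree M' v = next_tree M v" "next_ok d M lev U v" "U \<subseteq> U'"
  shows "next_ok d M' lev' U' v"
proof (cases "M v < d")
  case True
  then have n: "next_tree M v \<in> U" using assms(6) by (simp add: next_ok_def)
  have e: "M' v = M v" "elems M' v = elems M v" using assms(3) by (auto simp: same_rec_def)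
  have e': "M' (next_tree M v) = M (next_tree M v)" "elems M' (next_tree M v) = elems M (next_tree M v)"
    using assms(1)[OF n] by (auto simp: same_rec_def)
  show ?thesis
    using True n assms(2)[OF n] assms(4,6,7) unfolding next_ok_def e assms(5) e' by auto
next
  case False
  moreover have "M' v = M v" using assms(3) by (simp add: same_rec_def)
  ultimately show ?thesis by (simp add: next_ok_def)
qed

text \<open>
  The state of the main loop: the records \<open>D0 @ R1 @ R2\<close> have been created, of which \<open>D0\<close> belong to
  the initial sorting and are never processed, \<open>R1\<close> have been processed and \<open>R2\<close> are pending. The
  first record of \<open>R1 @ R2\<close> lists all points in the order of dimension \<open>0\<close>.
\<close>

definition main_inv where
  "main_inv n d h X b0 D0 N M t b R1 R2 lev \<longleftrightarrow>
     recs M b0 (D0 @ R1) t \<and> recs M t R2 b \<and> R1 @ R2 \<noteq> [] \<and>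
     M (hd (R1 @ R2)) = 0 \<and> set (elems M (hd (R1 @ R2))) = {..<n} \<and> lev (hd (R1 @ R2)) \<le> h \<and>
     (\<forall>u\<in>set (D0 @ R1 @ R2). node_ok X M lev (set (D0 @ R1 @ R2)) u \<and> set (elems M u) \<subseteq> {..<n}) \<and>
     (\<forall>u\<in>set (tl (R1 @ R2)). node_ok X M lev (set (tl (R1 @ R2))) u \<and> 1 \<le> M u) \<and>
     (\<forall>u\<in>set (R1 @ R2). M u \<le> d) \<and>
     (\<forall>u\<in>set R1. next_ok d M lev (set (tl (R1 @ R2))) u) \<and>
     (\<forall>j<length (D0 @ R1 @ R2). number M ((D0 @ R1 @ R2) ! j) = j) \<and>
     total M (D0 @ R1 @ R2) + pending d M lev R2 \<le> N"

lemma main_inv_space: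
  assumes "main_inv n d h X b0 D0 N M t b R1 R2 lev"
  shows "b + 9 * pending d M lev R2 \<le> b0 + 9 * N" (is ?A)
    and "b0 + 8 * length (D0 @ R1 @ R2) \<le> b" (is ?B)
    and "recs M b0 (D0 @ R1 @ R2) b" (is ?C)
proof -
  define V where "V = D0 @ R1 @ R2"
  have r: "recs M b0 V b"
    using assms unfolding main_inv_def V_def by (metis recs_append append.assoc)
  then show ?C by (simp add: V_def)
  have "(\<Sum>u\<leftarrow>V. 8 + length (elems M u)) \<le> (\<Sum>u\<leftarrow>V. 9 * length (elems M u))"
  proof (rule sum_list_mono)
    fix u assume "u \<in> set V"
    then have "elems M u \<noteq> []" using assms unfolding main_inv_def V_def node_ok_def by blast
    then show "8 + length (elems M u) \<le> 9 * length (elems M u)" by (cases "elems M u") auto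
  qed
  then have b: "b \<le> b0 + 9 * total M V"
    using recs_end[OF r] by (simp add: sum_list_const_mult)
  have "total M V + pending d M lev R2 \<le> N"
    using assms unfolding main_inv_def V_def by blast
  then show ?A using b by linarith
  have "(\<Sum>u\<leftarrow>V. 8) \<le> (\<Sum>u\<leftarrow>V. 8 + length (elems M u))" by (rule sum_list_mono) simp
  then show ?B using recs_end[OF r] by (simp add: V_def sum_list_triv)
qed

text \<open>At key \<open>d\<close> there is no next dimension, so \<open>next_ok\<close> holds
  vacuously and the record just leaves the queue.\<close>

lemma main_inv_skip:
  assumes inv: "main_inv n d h X b0 D0 N M t b R1 (t # R2) lev" and "\<not> M t < d"
  shows "main_inv n d h X b0 D0 N M (t + 8 + length (elems M t)) b (R1 @ [t]) R2 lev"
proof -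
  have "next_ok d M lev (set (tl (R1 @ t # R2))) t" using assms(2) by (simp add: next_ok_def)
  then have nx: "\<forall>u\<in>set (R1 @ [t]). next_ok d M lev (set (tl (R1 @ t # R2))) u"
    using inv unfolding main_inv_def by simp
  have r: "recs M b0 (D0 @ R1) t" "recs M (t + 8 + length (elems M t)) R2 b"
    using inv unfolding main_inv_def by simp_all
  then have r': "recs M b0 (D0 @ R1 @ [t]) (t + 8 + length (elems M t))"
    unfolding append_assoc[symmetric] recs_append[of M b0 "D0 @ R1"] by auto
  have e: "(R1 @ [t]) @ R2 = R1 @ t # R2" by simp
  have "total M (D0 @ R1 @ t # R2) +
      pending d M lev (t # R2) \<le> N"
    using inv unfolding main_inv_def by blast
  then have W: "total M (D0 @ R1 @ t # R2) +
      pending d M lev R2 \<le> N"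
    unfolding list.map sum_list.Cons by linarith
  show ?thesis
    using inv unfolding main_inv_def e by (intro conjI r' r nx W) (elim conjE, assumption)+
qed

text \<open>The only write to an old record hits offset 5 of \<open>t\<close>, which
  \<open>same_rec\<close> ignores and which lies in no other record. The weight of \<open>t\<close>
  pays for the new entries and for all that their records will cause. The second claim leaves
  \<open>length L * Suc H\<close> units over as credit for building the tree.\<close>

lemma main_inv_step:
  assumes inv: "main_inv n d h X b0 D0 N M t b R1 (t # R2) lev"
    and t: "M t < d" "lev t = H" "elems M t = L"
    and low: "\<And>a. a < b \<Longrightarrow> M1 a = M a" and U: "recs M1 b U b'" "U \<noteq> []"
    and nodes: "\<And>u. u \<in> set U \<Longrightarrow> node_ok X M1 levU (set U) u \<and> M1 u = Suc (M t) \<and> set (elems M1 u) \<subseteq> set L"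
    and num: "\<And>j. j < length U \<Longrightarrow> number M1 (U ! j) = length (D0 @ R1 @ t # R2) + j"
    and last: "levU (last U) \<le> H" "set (elems M1 (last U)) = set L"
    and wt: "\<And>f :: nat \<Rightarrow> nat. (\<Sum>u\<leftarrow>U. length (elems M1 u) * f (levU u)) \<le> length L * sum f {0..H}"
    and M': "M' = M1(t + 5 := last U)" and lev': "lev' = (\<lambda>u. if u \<in> set U then levU u else lev u)"
  shows "main_inv n d h X b0 D0 N M' (t + 8 + length L) b' (R1 @ [t]) (R2 @ U) lev'" (is ?A)
    and "pending d M' lev' (R2 @ U) + length L * Suc H
      \<le> pending d M lev (t # R2)" (is ?B)
proof -
  define R where "R = R1 @ t # R2"
  define V where "V = D0 @ R"
  have rV: "recs M b0 V b" using main_inv_space(3)[OF inv] by (simp add: V_def R_def)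
  have I: "recs M b0 (D0 @ R1) t" "recs M t (t # R2) b"
    "\<And>u. u \<in> set V \<Longrightarrow> node_ok X M lev (set V) u" "\<And>u. u \<in> set V \<Longrightarrow> set (elems M u) \<subseteq> {..<n}"
    "\<And>u. u \<in> set (tl R) \<Longrightarrow> node_ok X M lev (set (tl R)) u" "\<And>u. u \<in> set (tl R) \<Longrightarrow> 1 \<le> M u"
    "\<And>u. u \<in> set R \<Longrightarrow> M u \<le> d"
    "\<And>u. u \<in> set R1 \<Longrightarrow> next_ok d M lev (set (tl R)) u"
    "\<And>j. j < length V \<Longrightarrow> number M (V ! j) = j"
    and root: "M (hd R) = 0" "set (elems M (hd R)) = {..<n}" "lev (hd R) \<le> h"
    and W: "total M V + pending d M lev (t # R2) \<le> N"
    using inv unfolding main_inv_def V_def R_def by blast+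
  have tV: "t \<in> set V" by (simp add: V_def R_def)
  have tlR: "set (tl R) \<subseteq> set V" by (cases R) (auto simp: V_def)
  have tb: "t + 8 + length L \<le> b" using recs_bounds[OF rV tV] t(3) by simp
  have ub: "b \<le> u" if "u \<in> set U" for u using recs_bounds[OF U(1) that] by simp
  have disj: "u \<notin> set U" if "u \<in> set V" for u using recs_bounds[OF rV that] ub[of u] by fastforce
  have old: "same_rec M M' u" if "u \<in> set V" for u
  proof (rule same_recI)
    fix a assume a: "u \<le> a" "a < u + 8 + length (elems M u)" "a \<noteq> u + 5"
    have "a \<noteq> t + 5"
      using recs_disjoint[OF rV that tV] a t(3) tb by (cases "u = t") auto
    then show "M' a = M a" using a recs_bounds[OF rV that] by (simp add: M' low)
  qed
  have new: "same_rec M1 M' u" if "u \<in> set U" for u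
    by (rule same_recI) (use ub[OF that] tb in \<open>simp add: M'\<close>)
  have elold: "elems M' u = elems M u" "M' u = M u" if "u \<in> set V" for u using old[OF that] by (simp_all add: same_rec_def)
  have elnew: "elems M' u = elems M1 u" "M' u = M1 u" if "u \<in> set U" for u using new[OF that] by (simp_all add: same_rec_def)
  have levold: "lev' u = lev u" if "u \<in> set V" for u using disj[OF that] by (simp add: lev')
  have levnew: "lev' u = levU u" if "u \<in> set U" for u using that by (simp add: lev')
  have okold: "node_ok X M' lev' A u" if "u \<in> S" "node_ok X M lev S u" "S \<subseteq> set V" "S \<subseteq> A" for u S A
    by (rule node_ok_mono[OF node_ok_cong[OF _ _ that(1,2)] that(4)]) (use old levold that(3) in auto)
  have oknew: "node_ok X M' lev' A u" if "u \<in> set U" "set U \<subseteq> A" for u A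
    by (rule node_ok_mono[OF node_ok_cong[OF new levnew that(1)] that(2)]) (use nodes[OF that(1)] in auto)
  have tl: "tl ((R1 @ [t]) @ R2 @ U) = tl R @ U" by (simp add: R_def tl_append split: list.split)
  have Leq: "set L \<subseteq> {..<n}" using I(4)[OF tV] t(3) by simp
  have sumold: "pending d M' lev' xs = pending d M lev xs"
    "total M' xs = total M xs" if "set xs \<subseteq> set V" for xs
    by (intro arg_cong[of _ _ sum_list] map_cong refl; use that elold levold in \<open>simp add: subset_iff\<close>)+
  have sumnew: "pending d M' lev' U =
      (\<Sum>u\<leftarrow>U. length (elems M1 u) * weight (levU u) (d - Suc (M t)))"
    "total M' U = total M1 U"
    by (intro arg_cong[of _ _ sum_list] map_cong refl; use elnew levnew nodes in simp)+
  define j where "j = d - Suc (M t)"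
  have j: "d - M t = Suc j" using t(1) by (simp add: j_def)
  have ws: "length L * (\<Sum>i=0..H. weight i j) + length L * Suc H \<le> length L * weight H (Suc j)"
    using mult_le_mono2[OF weight_step[where l = H and j = j], of "length L"] by (simp add: algebra_simps)
  have R2V: "set R2 \<subseteq> set V" by (auto simp: V_def R_def)
  show ?B
  proof -
    have "(\<Sum>u\<leftarrow>U. length (elems M1 u) * weight (levU u) j) \<le> length L * (\<Sum>i=0..H. weight i j)"
      using wt[of "\<lambda>l. weight l j"] .
    then show ?thesis
      using ws unfolding map_append sum_list_append sumold[OF R2V] sumnew j_def[symmetric]
      by (simp add: t(2,3) j)
  qed
  have E: "(total M' (D0 @ (R1 @ [t]) @ R2 @ U)) +
      pending d M' lev' (R2 @ U) \<le> N"
  proof -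
    \<comment> \<open>The weight \<open>1 + weight l j\<close> counts the entries of the new records
      and their future cost at once.\<close>
    have "(\<Sum>u\<leftarrow>U. length (elems M1 u) * (1 + weight (levU u) j)) \<le> length L * (\<Sum>i=0..H. 1 + weight i j)"
      using wt[of "\<lambda>l. 1 + weight l j"] .
    also have "\<dots> = length L * (\<Sum>i=0..H. weight i j) + length L * Suc H"
      unfolding sum.distrib by (simp add: algebra_simps)
    finally have u: "total M1 U + (\<Sum>u\<leftarrow>U. length (elems M1 u) * weight (levU u) j)
        \<le> length L * weight H (Suc j)"
      using ws by (simp add: distrib_left sum_list_addf)
    have V2: "D0 @ (R1 @ [t]) @ R2 @ U = V @ U" by (simp add: V_def R_def)
    show ?thesis
      using W u unfolding V2 map_append sum_list_append sumold[OF subset_refl] sumold(1)[OF R2V] sumnew j_def[symmetric]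
      by (simp add: t(2,3) j)
  qed
  show ?A
    unfolding main_inv_def tl
  proof (intro conjI)
    show "recs M' b0 (D0 @ R1 @ [t]) (t + 8 + length L)"
    proof (rule recs_cong[where M = M])
      show "recs M b0 (D0 @ R1 @ [t]) (t + 8 + length L)"
        using I(1,2) unfolding append_assoc[symmetric] recs_append[of M b0 "D0 @ R1"] by (auto simp: t(3))
      show "\<forall>v\<in>set (D0 @ R1 @ [t]). length (elems M' v) = length (elems M v)"
        using elold by (auto simp: V_def R_def)
    qed
    have "recs M (t + 8 + length L) R2 b" using I(2) t(3) by simp
    then have "recs M' (t + 8 + length L) R2 b"
      by (rule recs_cong) (use elold R2V in auto)
    moreover have "recs M' b U b'" by (rule recs_cong[OF U(1)]) (use elnew in auto)
    ultimately show "recs M' (t + 8 + length L) (R2 @ U) b'" unfolding recs_append by blast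
    show "(R1 @ [t]) @ R2 @ U \<noteq> []" by simp
    have hR: "hd ((R1 @ [t]) @ R2 @ U) = hd R" by (cases R1) (simp_all add: R_def)
    have "hd R \<in> set V" by (cases R1) (simp_all add: V_def R_def)
    then show "M' (hd ((R1 @ [t]) @ R2 @ U)) = 0" "set (elems M' (hd ((R1 @ [t]) @ R2 @ U))) = {..<n}"
      "lev' (hd ((R1 @ [t]) @ R2 @ U)) \<le> h"
      unfolding hR using root elold levold by simp_all
    have V2: "D0 @ (R1 @ [t]) @ R2 @ U = V @ U" by (simp add: V_def R_def)
    show "\<forall>u\<in>set (D0 @ (R1 @ [t]) @ R2 @ U). node_ok X M' lev' (set (D0 @ (R1 @ [t]) @ R2 @ U)) u \<and> set (elems M' u) \<subseteq> {..<n}"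
      unfolding V2
    proof
      fix u assume "u \<in> set (V @ U)"
      then consider "u \<in> set V" | "u \<in> set U" by auto
      then show "node_ok X M' lev' (set (V @ U)) u \<and> set (elems M' u) \<subseteq> {..<n}"
      proof cases
        case 1
        show ?thesis using okold[OF 1 I(3)[OF 1] subset_refl] I(4)[OF 1] elold[OF 1] by simp
      next
        case 2
        show ?thesis using oknew[OF 2] nodes[OF 2] elnew[OF 2] Leq by auto
      qed
    qed
    show "\<forall>u\<in>set (tl R @ U). node_ok X M' lev' (set (tl R @ U)) u \<and> 1 \<le> M' u"
    proof
      fix u assume "u \<in> set (tl R @ U)"
      then consider "u \<in> set (tl R)" | "u \<in> set U" by auto
      then show "node_ok X M' lev' (set (tl R @ U)) u \<and> 1 \<le> M' u"
      proof cases
        case 1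
        have "u \<in> set V" using 1 tlR by blast
        show ?thesis using okold[OF 1 I(5)[OF 1] tlR] I(6)[OF 1] elold[OF \<open>u \<in> set V\<close>] by simp
      next
        case 2
        show ?thesis using oknew[OF 2] nodes[OF 2] elnew[OF 2] by simp
      qed
    qed
    show "\<forall>u\<in>set ((R1 @ [t]) @ R2 @ U). M' u \<le> d"
      using I(7) elold elnew nodes t(1) by (auto simp: R_def V_def)
    show "\<forall>u\<in>set (R1 @ [t]). next_ok d M' lev' (set (tl R @ U)) u"
    proof
      fix u assume "u \<in> set (R1 @ [t])"
      then consider "u \<in> set R1" "u \<noteq> t" | "u = t" by auto
      then show "next_ok d M' lev' (set (tl R @ U)) u"
      proof cases
        case 1
        have uV: "u \<in> set V" using 1 by (simp add: V_def R_def)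
        have "u + 5 < b" using recs_bounds[OF rV uV] by simp
        then have "next_tree M' u = next_tree M u" using 1(2) by (simp add: next_tree_def M' low)
        with old[OF uV] levold[OF uV] show ?thesis
        proof (rule next_ok_cong[where U = "set (tl R)", rotated 2])
          show "same_rec M M' u'" "lev' u' = lev u'" if "u' \<in> set (tl R)" for u'
            using that tlR by (auto intro: old levold)
        qed (use I(8)[OF 1(1)] in simp_all)
      next
        case 2
        have l: "last U \<in> set U" using U(2) by simp
        have "next_tree M' t = last U" by (simp add: next_tree_def M')
        then show ?thesis
          using 2 l elold[OF tV] elnew[OF l] nodes[OF l] last levnew[OF l] levold[OF tV] t
          by (simp add: next_ok_def)
      qed
    qed
    show "\<forall>j<length (D0 @ (R1 @ [t]) @ R2 @ U). number M' ((D0 @ (R1 @ [t]) @ R2 @ U) ! j) = j"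
      unfolding V2
    proof (intro allI impI)
      fix j assume "j < length (V @ U)"
      then consider "j < length V" | k where "j = length V + k" "k < length U"
        by (metis length_append nat_add_left_cancel_less not_le_imp_less le_Suc_ex)
      then show "number M' ((V @ U) ! j) = j"
      proof cases
        case 1
        then show ?thesis using I(9)[OF 1] old[OF nth_mem[OF 1]] by (simp add: nth_append same_rec_def)
      next
        case 2
        have "(V @ U) ! j = U ! k" using 2 by simp
        moreover have "number M' (U ! k) = length V + k"
          using num[OF 2(2)] new[OF nth_mem[OF 2(2)]] unfolding V_def R_def by (simp add: same_rec_def)
        ultimately show ?thesis using 2 by simp
      qed
    qed
    show "(total M' (D0 @ (R1 @ [t]) @ R2 @ U)) +
      pending d M' lev' (R2 @ U) \<le> N" by (rule E)
  qed
qed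

abbreviation "main_regs \<equiv> {8, 9, 28, 7, 10, 11, 12, 13, 14, 15, 16, 17, 18, 19, 20, 21, 22, 23, 24, 25, 26, 27, 4} :: nat set"

text \<open>With \<open>x = length L * Suc H\<close>, a round that builds a tree costs at most
  \<open>94 * x + 23\<close> steps, which 130 credits per unit of released weight cover. A round
  that only skips a record is paid by the weight of that record, at least one unit per
  point.\<close>

definition main_state where
  "main_state n d h X b0 D0 r0 N s0 v s \<longleftrightarrow> consts_ok s \<and> frame main_regs s0 s \<and>
     (\<exists>R1 R2 lev. main_inv n d h X b0 D0 N (mem s) (reg s 8) (reg s 7) R1 R2 lev \<and> hd (R1 @ R2) = r0 \<and>
        reg s 12 = length (D0 @ R1 @ R2) \<and>
        v = 130 * (pending d (mem s) lev R2))"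

lemma wp_main_body:
  assumes inv: "main_state n d h X b0 D0 r0 N s0 v s" and more: "reg s 8 < reg s 7"
    and s0: "reg s0 1 = d" and X: "\<And>p k. X p k = crd s0 (p * d + k)"
    and w: "n * d < words w" "b0 + 9 * N + 30 < words w"
  shows "wp w main_body (\<lambda>r s'. \<exists>v'. main_state n d h X b0 D0 r0 N s0 v' s' \<and> v' + r + 1 \<le> v) s"
proof -
  define t b M where "t = reg s 8" and "b = reg s 7" and "M = mem s"
  have c: "consts_ok s" and fr: "frame main_regs s0 s" using inv unfolding main_state_def by blast+
  obtain R1 R lev where I0: "main_inv n d h X b0 D0 N M t b R1 R lev" and hd0: "hd (R1 @ R) = r0"
    and r12: "reg s 12 = length (D0 @ R1 @ R)"
    and v: "v = 130 * pending d M lev R"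
    using inv unfolding main_state_def t_def b_def M_def by blast
  have "recs M t R b" using I0 unfolding main_inv_def by blast
  then obtain R2 where R: "R = t # R2" and rt: "recs M t (t # R2) b"
    using more recs_Nil_iff[of M t R b] by (cases R) (auto simp: t_def b_def)
  note I = I0[unfolded R]
  define L where "L = elems M t"
  have M7: "M (t + 7) = length L" by (simp add: L_def elems_def)
  have node: "node_ok X M lev (set (D0 @ R1 @ t # R2)) t" "set L \<subseteq> {..<n}" "M t \<le> d"
    using I unfolding main_inv_def L_def by auto
  then have L: "L \<noteq> []" "length L \<le> 2 ^ lev t" "distinct L" "sorted_wrt (coord_le X (Suc (M t))) L"
    unfolding node_ok_def L_def by blast+
  have tb: "t + 8 + length L \<le> b" using recs_bounds[OF rt, of t] by (simp add: L_def)
  have "length L * 1 \<le> length L * weight (lev t) (d - M t)" by (intro mult_le_mono2 weight_pos)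
  then have lw: "length L \<le> length L * weight (lev t) (d - M t)" by simp
  have sp: "b + 9 * (length L * weight (lev t) (d - M t)) \<le> b0 + 9 * N"
  proof -
    have "length L * weight (lev t) (d - M t) \<le> pending d M lev (t # R2)"
      by (simp add: L_def)
    then show ?thesis using main_inv_space(1)[OF I] by linarith
  qed
  have bw: "b + 30 < words w" using sp w by linarith
  have dw: "d < words w"
  proof -
    obtain x where "x < n" using L(1) node(2) by (cases L) auto
    then have "1 * d \<le> n * d" by (intro mult_le_mono1) simp
    then have "d \<le> n * d" unfolding mult_1 .
    then show ?thesis using w(1) by (rule le_less_trans)
  qed
  have d1: "reg s 1 = d" using frame_reg[OF fr, of 1] s0 by simp
  define P where "P r s' \<longleftrightarrow> (\<exists>v'. main_state n d h X b0 D0 r0 N s0 v' s' \<and> v' + r + 1 \<le> v)" for r s'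
  define s1 where "s1 = s\<lparr>reg := (reg s)(9 := M t, 21 := length L, 28 := t + 8 + length L)\<rparr>"
  have five: "5 + r = 1 + (1 + (1 + (1 + (1 + r))))" for r :: nat by simp
  have head: "wp w (LOAD 9 8;; ADD 21 8 32;; LOAD 21 21;; ADD 28 8 33;; ADD 28 28 21;; p) Q s \<longleftrightarrow>
      wp w p (\<lambda>r. Q (5 + r)) s1" for p Q
    unfolding five using c tb bw by (simp add: wp_steps consts_ok_def M_def[symmetric] t_def[symmetric] M7 s1_def add.assoc
        fun_upd_twist cong: wp_cong)
  have c1: "consts_ok s1" using c by (simp add: s1_def consts_ok_def)
  have "wp w (If (RLess 9 1) (ADD 9 9 6;; tree_prog;; ADD 21 8 31;; STORE 21 10) SKIP;; ADD 8 28 4) (\<lambda>r. P (5 + r)) s1"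
  proof (cases "M t < d")
    case False
    define s2 where "s2 = s1\<lparr>reg := (reg s1)(4 := 0, 8 := t + 8 + length L)\<rparr>"
    have "main_state n d h X b0 D0 r0 N s0 (130 * pending d M lev R2) s2"
      unfolding main_state_def
    proof (intro conjI exI)
      show "consts_ok s2" using c1 by (simp add: s2_def consts_ok_def)
      show "frame main_regs s0 s2" using fr by (simp add: frame_def s2_def s1_def)
      show "main_inv n d h X b0 D0 N (mem s2) (reg s2 8) (reg s2 7) (R1 @ [t]) R2 lev"
        using main_inv_skip[OF I False] by (simp add: s2_def s1_def L_def M_def[symmetric] b_def)
      show "hd ((R1 @ [t]) @ R2) = r0" "reg s2 12 = length (D0 @ (R1 @ [t]) @ R2)"
        using hd0 r12 by (simp_all add: R s2_def s1_def)
    qed (simp add: s2_def s1_def M_def)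
    moreover have "130 * pending d M lev R2 + 8 + 1 \<le> v"
    proof -
      have "1 \<le> length L" using L(1) by (cases L) auto
      then show ?thesis using lw unfolding v R list.map sum_list.Cons L_def[symmetric] distrib_left by linarith
    qed
    ultimately have "P 8 s2" unfolding P_def by blast
    moreover have "8 < words w" "reg s1 1 = d" "reg s1 9 = M t" "reg s1 4 = 0" "reg s1 28 = t + 8 + length L"
      using bw d1 c by (simp_all add: s1_def consts_ok_def)
    ultimately show ?thesis
      using False tb bw by (simp add: wp_steps s2_def cong: wp_cong)
  next
    case True
    define K H where "K = Suc (M t)" and "H = lev t"
    define s2 where "s2 = s1\<lparr>reg := (reg s1)(9 := K)\<rparr>"
    obtain j where j: "d - M t = Suc j" "d - K = j" using True by (auto simp: K_def intro: that[of "d - Suc (M t)"])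
    have sH: "length L * Suc H \<le> length L * weight (lev t) (d - M t)"
      using weight_step[where l = H and j = j] unfolding j(1) H_def[symmetric] by (intro mult_le_mono2) simp
    have c2: "consts_ok s2" using c1 by (simp add: s2_def consts_ok_def)
    have tree: "wp w tree_prog (\<lambda>r s'. tree_post X K L H (length (D0 @ R1 @ R)) b s2 s' (r \<le> 94 * (length L * Suc H) + 12)) s2"
    proof (rule wp_tree[OF c2])
      show "reg s2 1 = d" "reg s2 9 = K" "reg s2 8 = t" "reg s2 7 = b" "reg s2 12 = length (D0 @ R1 @ R)"
        using d1 r12 by (simp_all add: s2_def s1_def t_def b_def)
      show "X p K = crd s2 (p * d + K)" for p
        using X frame_crd[OF fr] by (simp add: s2_def s1_def)
      show "elems (mem s2) t = L" by (simp add: s2_def s1_def L_def M_def)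
      show "L \<noteq> []" "length L \<le> 2 ^ H" "sorted_wrt (coord_le X K) L" "distinct L" using L by (simp_all add: H_def K_def)
      show "x * d + K < words w" if "x \<in> set L" for x
      proof -
        have "Suc x * d \<le> n * d" using that node(2) by (intro mult_le_mono1) auto
        then show ?thesis using w(1) True by (simp add: K_def)
      qed
      show "length (D0 @ R1 @ R) \<le> b" using main_inv_space(2)[OF I0] by simp
      show "t + 8 + length L \<le> b" by (rule tb)
      show "b + 9 * (length L * Suc H) + 20 < words w" using sH sp w(2) by linarith
    qed
    have "wp w (tree_prog;; ADD 21 8 31;; STORE 21 10;; ADD 8 28 4) (\<lambda>r. P (7 + r)) s2"
      unfolding wp_Seq[of w tree_prog]
    proof (rule wp_mono[OF tree], elim exE conjE)
      fix r :: nat and s3 U levU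
      assume fr3: "frame tree_regs s2 s3" and low: "\<forall>a<b. mem s3 a = mem s2 a"
        and U: "recs (mem s3) b U (reg s3 7)" "U \<noteq> []" and r3: "reg s3 10 = last U" "reg s3 12 = length (D0 @ R1 @ R) + length U"
        and nodes: "\<forall>u\<in>set U. node_ok X (mem s3) levU (set U) u \<and> mem s3 u = K \<and> set (elems (mem s3) u) \<subseteq> set L"
        and num: "\<forall>j<length U. number (mem s3) (U ! j) = length (D0 @ R1 @ R) + j"
        and last: "levU (last U) \<le> H" "set (elems (mem s3) (last U)) = set L"
        and wt: "\<forall>f. (\<Sum>u\<leftarrow>U. length (elems (mem s3) u) * f (levU u)) \<le> length L * sum f {0..H}"
        and r: "r \<le> 94 * (length L * Suc H) + 12"
      define M' lev' where "M' = (mem s3)(t + 5 := last U)" and "lev' = (\<lambda>u. if u \<in> set U then levU u else lev u)"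
      define s4 where "s4 = s3\<lparr>reg := (reg s3)(21 := t + 5, 8 := t + 8 + length L), mem := M'\<rparr>"
      have g: "reg s3 8 = t" "reg s3 28 = t + 8 + length L" "reg s3 31 = 5" "reg s3 4 = 0"
        using frame_reg[OF fr3, of 8] frame_reg[OF fr3, of 28] frame_reg[OF fr3, of 31] frame_reg[OF fr3, of 4] c
        by (simp_all add: s2_def s1_def t_def consts_ok_def)
      have m: "mem s3 a = M a" if "a < b" for a using low that by (simp add: s2_def s1_def M_def)
      note step = main_inv_step[OF I True H_def[symmetric] L_def[symmetric] m U _ _ last _ M'_def lev'_def]
      have S: "main_inv n d h X b0 D0 N M' (t + 8 + length L) (reg s3 7) (R1 @ [t]) (R2 @ U) lev'"
        "pending d M' lev' (R2 @ U) + length L * Suc H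
          \<le> pending d M lev (t # R2)"
        by (rule step; use nodes num wt in \<open>simp add: K_def R\<close>)+
      have "main_state n d h X b0 D0 r0 N s0 (130 * pending d M' lev' (R2 @ U)) s4"
        unfolding main_state_def
      proof (intro conjI exI)
        have "consts_ok s3" by (rule consts_ok_frame[OF c2 fr3]) simp
        then show "consts_ok s4" by (simp add: s4_def consts_ok_def)
        show "frame main_regs s0 s4" using fr fr3 by (simp add: frame_def s4_def s2_def s1_def)
        show "main_inv n d h X b0 D0 N (mem s4) (reg s4 8) (reg s4 7) (R1 @ [t]) (R2 @ U) lev'"
          using S(1) by (simp add: s4_def)
        show "hd ((R1 @ [t]) @ R2 @ U) = r0" using hd0 by (cases R1) (simp_all add: R)
        show "reg s4 12 = length (D0 @ (R1 @ [t]) @ R2 @ U)" using r3 by (simp add: s4_def R)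
      qed (simp add: s4_def)
      moreover have "130 * pending d M' lev' (R2 @ U) + (7 + (r + 3)) + 1 \<le> v"
      proof -
        have "1 * 1 \<le> length L * Suc H" using L(1) by (intro mult_le_mono) (cases L, auto)
        then show ?thesis using S(2) r unfolding v R distrib_left by linarith
      qed
      ultimately have "P (7 + (r + 3)) s4" unfolding P_def by blast
      then show "wp w (ADD 21 8 31;; STORE 21 10;; ADD 8 28 4) (\<lambda>t'. P (7 + (r + t'))) s3"
        using g tb bw r3(1) by (simp add: wp_steps s4_def M'_def cong: wp_cong)
    qed
    then have "wp w (tree_prog;; ADD 21 8 31;; STORE 21 10) (\<lambda>r. wp w (ADD 8 28 4) (\<lambda>r'. P (7 + r + r'))) s2"
      unfolding wp_Seq add.assoc .
    moreover have "reg s1 1 = d" "reg s1 9 = M t" "reg s1 6 = 1" using d1 c by (simp_all add: s1_def consts_ok_def)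
    moreover have "M t + 1 < words w" using True dw by simp
    moreover have "M t + 1 = K" by (simp add: K_def One_nat_def)
    ultimately show ?thesis
      unfolding wp_Seq[of w "If _ _ _"] wp_If wp_Seq[of w "ADD 9 9 6"] using True
      by (simp add: wp_Instr exec_Add s2_def[symmetric] add.assoc[symmetric])
  qed
  then show ?thesis unfolding head P_def .
qed

section \<open>Initialisation, directory and the whole construction\<close>

lemma wp_init:
  assumes s: "reg s = (\<lambda>_. 0)(0 := n, 1 := d)" and w: "3 * n + 2 * d + 20 < words w"
    and t0: "t0 = n + n + (d + d) + 2"
  shows "wp w init_prog (\<lambda>r s'. consts_ok s' \<and> crd s' = crd s \<and> reg s' 0 = n \<and> reg s' 1 = d \<and> reg s' 8 = t0 \<and>
     reg s' 7 = t0 + 8 + n \<and> reg s' 34 = t0 + 8 + n \<and> reg s' 9 = 0 \<and> reg s' 12 = 0 \<and>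
     elems (mem s') t0 = [0..<n] \<and> r \<le> 4 * n + 16) s"
proof -
  define s1 where "s1 = s\<lparr>reg := (reg s)(4 := 0, 6 := 1, 30 := 2, 31 := 5, 32 := 7, 33 := 8, 8 := t0, 7 := t0 + 8, 21 := 0),
     mem := (mem s)(t0 + 7 := n)\<rparr>"
  define I where "I v s' \<longleftrightarrow> (\<exists>i\<le>n. frame {7, 21} s1 s' \<and> reg s' 21 = i \<and> reg s' 7 = t0 + 8 + i \<and>
     mem s' (t0 + 7) = n \<and> (\<forall>j<i. mem s' (t0 + 8 + j) = j) \<and> v = 4 * (n - i))" for v s'
  have loop: "wp w (While (RLess 21 0) (emit 21;; ADD 21 21 6)) (\<lambda>r s'. I 0 s' \<and> r \<le> 4 * n + 1) s1"
  proof (rule wp_While[where I = I and v = "4 * n"])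
    show "I (4 * n) s1" by (auto simp: I_def s1_def frame_refl)
  next
    fix v s' assume "I v s'" and h: "holds (RLess 21 0) s'"
    then obtain i where i: "i \<le> n" "frame {7, 21} s1 s'" "reg s' 21 = i" "reg s' 7 = t0 + 8 + i"
      "mem s' (t0 + 7) = n" "\<And>j. j < i \<Longrightarrow> mem s' (t0 + 8 + j) = j" "v = 4 * (n - i)"
      unfolding I_def by blast
    have r: "reg s' 0 = n" "reg s' 6 = 1"
      using frame_reg[OF i(2), of 0] frame_reg[OF i(2), of 6] s by (simp_all add: s1_def)
    have "i < n" using h r i(3) by simp
    define s2 where "s2 = s'\<lparr>reg := (reg s')(7 := t0 + 8 + i + 1, 21 := i + 1), mem := (mem s')(t0 + 8 + i := i)\<rparr>"
    have "I (4 * (n - Suc i)) s2"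
      unfolding I_def
    proof (intro exI[of _ "Suc i"] conjI allI impI)
      show "frame {7, 21} s1 s2" using i(2) by (simp add: frame_def s2_def)
      show "mem s2 (t0 + 8 + j) = j" if "j < Suc i" for j using i(6)[of j] that by (auto simp: s2_def less_Suc_eq)
    qed (use i \<open>i < n\<close> in \<open>auto simp: s2_def\<close>)
    moreover have "4 * (n - Suc i) + 3 + 1 \<le> v" using \<open>i < n\<close> i(7) by simp
    ultimately have "\<exists>v'. I v' s2 \<and> v' + 3 + 1 \<le> v" by blast
    then show "wp w (emit 21;; ADD 21 21 6) (\<lambda>t s'. \<exists>v'. I v' s' \<and> v' + t + 1 \<le> v) s'"
      using i(3,4) r \<open>i < n\<close> w t0 by (simp add: wp_steps wp_emit s2_def cong: wp_cong)
  next
    fix r v' s' assume "I v' s'" "\<not> holds (RLess 21 0) s'" "r + v' \<le> 4 * n + 1"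
    moreover have "reg s' 0 = n" if "frame {7, 21} s1 s'" using frame_reg[OF that, of 0] s by (simp add: s1_def)
    ultimately show "I 0 s' \<and> r \<le> 4 * n + 1" by (auto simp: I_def)
  qed
  have cont: "wp w (While (RLess 21 0) (emit 21;; ADD 21 21 6);; ADD 34 7 4) (\<lambda>r s'. consts_ok s' \<and> crd s' = crd s \<and> reg s' 0 = n \<and> reg s' 1 = d \<and> reg s' 8 = t0 \<and>
     reg s' 7 = t0 + 8 + n \<and> reg s' 34 = t0 + 8 + n \<and> reg s' 9 = 0 \<and> reg s' 12 = 0 \<and>
     elems (mem s') t0 = [0..<n] \<and> 14 + r \<le> 4 * n + 16) s1"
    unfolding wp_Seq
  proof (rule wp_mono[OF loop], elim conjE)
    fix r :: nat and s' assume "I 0 s'" and r: "r \<le> 4 * n + 1"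
    then have i: "frame {7, 21} s1 s'" "reg s' 7 = t0 + 8 + n" "mem s' (t0 + 7) = n" "\<And>j. j < n \<Longrightarrow> mem s' (t0 + 8 + j) = j"
      unfolding I_def by auto
    have el: "elems (mem s') t0 = [0..<n]"
      by (rule nth_equalityI) (simp_all add: elems_def i(3,4))
    have c: "consts_ok s'" by (rule consts_ok_frame[OF _ i(1)]) (simp_all add: s1_def consts_ok_def)
    note f = frame_reg[OF i(1)]
    show "wp w (ADD 34 7 4) (\<lambda>t' s'. consts_ok s' \<and> crd s' = crd s \<and> reg s' 0 = n \<and> reg s' 1 = d \<and> reg s' 8 = t0 \<and>
     reg s' 7 = t0 + 8 + n \<and> reg s' 34 = t0 + 8 + n \<and> reg s' 9 = 0 \<and> reg s' 12 = 0 \<and>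
     elems (mem s') t0 = [0..<n] \<and> 14 + (r + t') \<le> 4 * n + 16) s'"
      using c i(2) el r w t0 f[of 0] f[of 1] f[of 8] f[of 9] f[of 12] frame_crd[OF i(1)] s
      by (simp add: wp_steps consts_ok_def s1_def cong: wp_cong)
  qed
  have head: "wp w (consts_prog;; ADD 8 0 0;; ADD 21 1 1;; ADD 8 8 21;; ADD 8 8 30;; ADD 7 8 32;;
     emit 0;; ADD 21 4 4;; p) Q s" if "wp w p (\<lambda>r. Q (14 + r)) s1" for p Q
  proof -
    have "reg s 0 = n" "reg s 1 = d" using s by simp_all
    then show ?thesis
      unfolding wp_Seq[of w consts_prog] using w that
      by (intro wp_consts) (simp_all add: wp_steps wp_emit s1_def t0 add.assoc cong: wp_cong)
  qed
  show ?thesis unfolding init_prog_def by (rule head) (rule cont)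
qed

lemma wp_dir:
  assumes c: "consts_ok s" and regs: "reg s 29 = r0" "reg s 34 = b0" "reg s 7 = b" "reg s 12 = length V"
    and r: "recs (mem s) b0 V b" "r0 \<in> set V" and w: "b + length V + 20 < words w"
  shows "wp w dir_prog (\<lambda>t s'. frame {2, 5, 7, 8, 21, 28} s s' \<and> reg s' 5 = next_tree (mem s) r0 \<and> reg s' 2 = b \<and>
     (\<forall>a<b. mem s' a = mem s a) \<and> mem s' b = length V \<and> (\<forall>j<length V. mem s' (b + 1 + j) = V ! j + 7) \<and>
     t \<le> 7 * length V + 9) s"
proof -
  let ?A = "{2, 5, 7, 8, 21, 28} :: nat set"
  define s1 where "s1 = s\<lparr>reg := (reg s)(21 := r0 + 5, 5 := mem s (r0 + 5), 8 := b0, 28 := b, 2 := b, 7 := b + 1),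
     mem := (mem s)(b := length V)\<rparr>"
  define I where "I v s' \<longleftrightarrow> (\<exists>i\<le>length V. frame {7, 8, 21} s1 s' \<and> recs (mem s) b0 (take i V) (reg s' 8) \<and>
     recs (mem s) (reg s' 8) (drop i V) b \<and> reg s' 7 = b + 1 + i \<and> (\<forall>a<b. mem s' a = mem s a) \<and>
     mem s' b = length V \<and> (\<forall>j<i. mem s' (b + 1 + j) = V ! j + 7) \<and> v = 7 * (length V - i))" for v s'
  have rb: "r0 + 8 \<le> b" using recs_bounds[OF r] by simp
  have b0b: "b0 \<le> b" using recs_le[OF r(1)] .
  have loop: "wp w (While (RLess 8 28) (ADD 21 8 32;; emit 21;; LOAD 21 21;; ADD 8 8 33;; ADD 8 8 21))
    (\<lambda>r s'. I 0 s' \<and> r \<le> 7 * length V + 1) s1"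
  proof (rule wp_While[where I = I and v = "7 * length V"])
    show "I (7 * length V) s1" using r(1) unfolding I_def
      by (intro exI[of _ 0]) (simp add: s1_def frame_refl)
  next
    fix v s' assume "I v s'" and h: "holds (RLess 8 28) s'"
    then obtain i where i: "i \<le> length V" "frame {7, 8, 21} s1 s'" "recs (mem s) b0 (take i V) (reg s' 8)"
      "recs (mem s) (reg s' 8) (drop i V) b" "reg s' 7 = b + 1 + i" "\<And>a. a < b \<Longrightarrow> mem s' a = mem s a"
      "mem s' b = length V" "\<And>j. j < i \<Longrightarrow> mem s' (b + 1 + j) = V ! j + 7" "v = 7 * (length V - i)"
      unfolding I_def by blast
    define a where "a = reg s' 8"
    have k: "reg s' 28 = b" "reg s' 6 = 1" "reg s' 32 = 7" "reg s' 33 = 8"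
      using frame_reg[OF i(2), of 28] frame_reg[OF i(2), of 6] frame_reg[OF i(2), of 32] frame_reg[OF i(2), of 33] c
      by (simp_all add: s1_def consts_ok_def)
    have iV: "i < length V" using h k i(1,4) by (cases "i < length V") auto
    have V: "drop i V = V ! i # drop (Suc i) V" using iV by (simp add: Cons_nth_drop_Suc)
    then have va: "V ! i = a" and ra: "recs (mem s) (a + 8 + length (elems (mem s) a)) (drop (Suc i) V) b"
      using i(4) by (auto simp: a_def)
    have le: "a + 8 + length (elems (mem s) a) \<le> b" by (rule recs_le[OF ra])
    have m7: "mem s' (a + 7) = length (elems (mem s) a)" using i(6)[of "a + 7"] le by (simp add: elems_def)
    define s2 where "s2 = s'\<lparr>reg := (reg s')(7 := b + 1 + i + 1, 21 := length (elems (mem s) a), 8 := a + 8 + length (elems (mem s) a)),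
       mem := (mem s')(b + 1 + i := a + 7)\<rparr>"
    have "I (7 * (length V - Suc i)) s2"
      unfolding I_def
    proof (intro exI[of _ "Suc i"] conjI allI impI)
      show "frame {7, 8, 21} s1 s2" using i(2) by (simp add: frame_def s2_def)
      show "recs (mem s) b0 (take (Suc i) V) (reg s2 8)"
        using i(3) iV va by (simp add: take_Suc_conv_app_nth recs_append s2_def a_def)
      show "recs (mem s) (reg s2 8) (drop (Suc i) V) b" using ra by (simp add: s2_def)
      show "mem s2 (b + 1 + j) = V ! j + 7" if "j < Suc i" for j
        using i(8)[of j] that va by (auto simp: s2_def less_Suc_eq)
      show "mem s2 a' = mem s a'" if "a' < b" for a' using i(6)[OF that] that by (simp add: s2_def)
    qed (use i iV in \<open>auto simp: s2_def\<close>)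
    moreover have "7 * (length V - Suc i) + 6 + 1 \<le> v" using iV i(9) by simp
    ultimately have "\<exists>v'. I v' s2 \<and> v' + 6 + 1 \<le> v" by blast
    then show "wp w (ADD 21 8 32;; emit 21;; LOAD 21 21;; ADD 8 8 33;; ADD 8 8 21)
        (\<lambda>t s'. \<exists>v'. I v' s' \<and> v' + t + 1 \<le> v) s'"
      using k i(5) iV w le m7 by (simp add: wp_steps wp_emit s2_def a_def[symmetric] fun_upd_twist add.assoc cong: wp_cong)
  next
    fix r v' s' assume "I v' s'" and h: "\<not> holds (RLess 8 28) s'" and "r + v' \<le> 7 * length V + 1"
    then obtain i where i: "i \<le> length V" "frame {7, 8, 21} s1 s'" "recs (mem s) b0 (take i V) (reg s' 8)"
      "recs (mem s) (reg s' 8) (drop i V) b" "reg s' 7 = b + 1 + i" "\<forall>a<b. mem s' a = mem s a"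
      "mem s' b = length V" "\<forall>j<i. mem s' (b + 1 + j) = V ! j + 7" "v' = 7 * (length V - i)"
      unfolding I_def by blast
    have "reg s' 28 = b" using frame_reg[OF i(2), of 28] by (simp add: s1_def)
    then have "reg s' 8 = b" using h recs_le[OF i(4)] by simp
    then have "drop i V = []" using recs_Nil_iff[OF i(4)] by simp
    then have "i = length V" using i(1) by simp
    then show "I 0 s' \<and> r \<le> 7 * length V + 1" using i \<open>r + v' \<le> 7 * length V + 1\<close> unfolding I_def by auto
  qed
  have head: "wp w (ADD 21 29 31;; LOAD 5 21;; ADD 8 34 4;; ADD 28 7 4;; ADD 2 7 4;; emit 12;; p) Q s"
    if "wp w p (\<lambda>r. Q (7 + r)) s1" for p Q
  proof -
    show ?thesis
      using c regs rb b0b w that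
      by (simp add: wp_steps wp_emit consts_ok_def s1_def cong: wp_cong)
  qed
  show ?thesis
    unfolding dir_prog_def
  proof (rule head, rule wp_mono[OF loop], elim conjE)
    fix t :: nat and s' assume "I 0 s'" "t \<le> 7 * length V + 1"
    moreover have "frame ?A s s'" "reg s' 5 = next_tree (mem s) r0" "reg s' 2 = b" if f: "frame {7, 8, 21} s1 s'"
      using f frame_reg[OF f, of 5] frame_reg[OF f, of 2] by (simp_all add: frame_def s1_def next_tree_def)
    ultimately show "frame ?A s s' \<and> reg s' 5 = next_tree (mem s) r0 \<and> reg s' 2 = b \<and>
      (\<forall>a<b. mem s' a = mem s a) \<and> mem s' b = length V \<and> (\<forall>j<length V. mem s' (b + 1 + j) = V ! j + 7) \<and>
      7 + t \<le> 7 * length V + 9"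
      unfolding I_def by auto
  qed
qed

text \<open>
  What the construction leaves behind: all records \<open>V\<close>, followed by the directory of their lists, and
  among them the range tree \<open>U\<close>, whose root for the first dimension is in register 5.
\<close>

definition built :: "nat \<Rightarrow> nat \<Rightarrow> (nat \<Rightarrow> nat \<Rightarrow> real) \<Rightarrow> nat \<Rightarrow> nat \<Rightarrow> config \<Rightarrow> bool" where
  "built n d X h N s \<longleftrightarrow> reg s 0 = n \<and> reg s 1 = d \<and> (\<exists>V b lev U.
     recs (mem s) (3 * n + 2 * d + 10) V b \<and> reg s 2 = b \<and> b \<le> 3 * n + 2 * d + 10 + 9 * N \<and> length V \<le> N \<and>
     (\<forall>u\<in>set V. distinct (elems (mem s) u) \<and> set (elems (mem s) u) \<subseteq> {..<n}) \<and>
     (\<forall>j<length V. number (mem s) (V ! j) = j) \<and> total (mem s) V \<le> N \<and>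
     mem s b = length V \<and> (\<forall>j<length V. mem s (b + 1 + j) = V ! j + 7) \<and>
     range_tree n d X (mem s) lev U \<and> U \<subseteq> set V \<and> reg s 5 \<in> U \<and> mem s (reg s 5) = 1 \<and>
     lev (reg s 5) \<le> h \<and> set (elems (mem s) (reg s 5)) = {..<n})"

text \<open>The summands of \<open>N\<close> bound the entries of the initial sort and of all that
  is built from its root with \<open>d\<close> dimensions to go. The factors 4, 94, 130 and 7 of the
  four phases stay below 250.\<close>

lemma wp_build:
  assumes s: "reg s = (\<lambda>_. 0)(0 := n, 1 := d)" and n: "1 \<le> n" "n \<le> 2 ^ h" and d: "1 \<le> d"
    and X: "\<And>p k. X p k = crd s (p * d + k)"
    and N: "N = n * Suc h + n * weight h d"
    and w: "n * d < words w" "3 * n + 2 * d + 10 * N + 50 < words w"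
  shows "wp w build_prog (\<lambda>t s'. built n d X h N s' \<and> crd s' = crd s \<and> t \<le> 250 * N + 60) s"
proof -
  define t0 b0 where "t0 = n + n + (d + d) + 2" and "b0 = 3 * n + 2 * d + 10"
  have b0: "b0 = t0 + 8 + n" by (simp add: t0_def b0_def)
  have nS: "n * Suc h \<le> N" "n * weight h d \<le> N" by (simp_all add: N)
  have nN: "n \<le> N" using nS(1) by (rule order.trans[rotated]) simp
  show ?thesis
    unfolding build_prog_def wp_Seq[of w init_prog]
  proof (rule wp_mono[OF wp_init[OF s _ t0_def]], use w(2) in linarith, elim conjE)
    fix t1 :: nat and s1
    assume c1: "consts_ok s1" and crd1: "crd s1 = crd s" and r1: "reg s1 0 = n" "reg s1 1 = d" "reg s1 8 = t0"
      "reg s1 7 = t0 + 8 + n" "reg s1 34 = t0 + 8 + n" "reg s1 9 = 0" "reg s1 12 = 0"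
      and el: "elems (mem s1) t0 = [0..<n]" and t1: "t1 \<le> 4 * n + 16"
    have tree: "wp w tree_prog (\<lambda>r s'. tree_post X 0 [0..<n] h 0 b0 s1 s' (r \<le> 94 * (length [0..<n] * Suc h) + 12)) s1"
    proof (rule wp_tree[OF c1 r1(2) r1(6) r1(3) _ r1(7) _ el])
      show "x * d + 0 < words w" if "x \<in> set [0..<n]" for x
      proof -
        have "x * d \<le> n * d" using that by (intro mult_le_mono1) simp
        then have "x * d + 0 \<le> n * d" unfolding add_0_right .
        then show ?thesis using w(1) by (rule le_less_trans)
      qed
      show "b0 + 9 * (length [0..<n] * Suc h) + 20 < words w"
        using nS(1) w(2) unfolding b0_def length_upt diff_zero by linarith
      have "sorted_wrt (coord_le X 0) xs" for xs by (induction xs) (auto simp: coord_le_def)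
      then show "sorted_wrt (coord_le X 0) [0..<n]" .
    qed (use n r1 b0 X crd1 in simp_all)
    show "wp w (tree_prog;; ADD 8 10 4;; ADD 29 10 4;; main_prog;; dir_prog)
      (\<lambda>t' s'. built n d X h N s' \<and> crd s' = crd s \<and> t1 + t' \<le> 250 * N + 60) s1"
      unfolding wp_Seq[of w tree_prog]
    proof (rule wp_mono[OF tree], elim exE conjE)
      fix t2 :: nat and s2 U lev
      assume fr2: "frame tree_regs s1 s2" and U: "recs (mem s2) b0 U (reg s2 7)" "U \<noteq> []"
        and r2: "reg s2 10 = last U" "reg s2 12 = 0 + length U"
        and nodes: "\<forall>u\<in>set U. node_ok X (mem s2) lev (set U) u \<and> mem s2 u = 0 \<and> set (elems (mem s2) u) \<subseteq> set [0..<n]"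
        and num: "\<forall>j<length U. number (mem s2) (U ! j) = 0 + j"
        and last: "lev (last U) \<le> h" "set (elems (mem s2) (last U)) = set [0..<n]"
        and wt: "\<forall>f. (\<Sum>u\<leftarrow>U. length (elems (mem s2) u) * f (lev u)) \<le> length [0..<n] * sum f {0..h}"
        and t2: "t2 \<le> 94 * (length [0..<n] * Suc h) + 12"
      \<comment> \<open>Only the root of the initial sort enters the queue. The other runs
        \<open>D0\<close> keep their numbers and belong to the family, so that numbers and positions
        in the directory agree.\<close>
      define r0 D0 where "r0 = last U" and "D0 = butlast U"
      have UD: "U = D0 @ [r0]" using U(2) by (simp add: r0_def D0_def)
      have r0U: "r0 \<in> set U" by (simp add: UD)
      have r0b: "b0 \<le> r0" "r0 + 8 \<le> reg s2 7" using recs_bounds[OF U(1) r0U] by auto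
      define M where "M = mem s2"
      have dist: "distinct (elems M r0)" using nodes r0U by (simp add: node_ok_def M_def)
      have len0: "length (elems M r0) = n" using last(2) distinct_card[OF dist] by (simp add: r0_def M_def)
      have sz: "total M U \<le> n * Suc h"
        using wt[rule_format, of "\<lambda>_. 1"] by (simp add: M_def)
      define s3 where "s3 = s2\<lparr>reg := (reg s2)(8 := r0, 29 := r0)\<rparr>"
      have recsU: "recs M b0 D0 r0" "recs M r0 [r0] (reg s2 7)"
        using U(1) unfolding UD recs_append M_def by auto
      have c3: "consts_ok s3"
      proof -
        have "consts_ok s2" by (rule consts_ok_frame[OF c1 fr2]) simp
        then show ?thesis by (simp add: s3_def consts_ok_def)
      qed
      have W: "total M U + n * weight (lev r0) d \<le> N"
      proof -
        have "n * weight (lev r0) d \<le> n * weight h d" using last(1) by (intro mult_le_mono2 weight_mono) (simp add: r0_def)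
        then show ?thesis using sz unfolding N by linarith
      qed
      have inv0: "main_inv n d h X b0 D0 N M r0 (reg s2 7) [] [r0] lev"
        unfolding main_inv_def
        using recsU nodes num W last len0 by (simp add: UD M_def r0_def[symmetric] atLeast0LessThan)
      define v0 where "v0 = 130 * (pending d M lev [r0])"
      have v0: "v0 \<le> 130 * N"
      proof -
        have "M r0 = 0" using r0U nodes by (simp add: M_def)
        then have "v0 = 130 * (n * weight (lev r0) d)" by (simp add: v0_def len0)
        then show ?thesis using W by linarith
      qed
      have state0: "main_state n d h X b0 D0 r0 N s3 v0 s3"
        unfolding main_state_def
        using inv0 r2 c3 by (intro conjI exI[of _ "[]"] exI[of _ "[r0]"] exI[of _ lev])
          (simp_all add: frame_refl s3_def M_def v0_def UD)
      have crd3: "crd s3 = crd s" using frame_crd[OF fr2] crd1 by (simp add: s3_def)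
      have r3: "reg s3 0 = n" "reg s3 1 = d" "reg s3 34 = b0" "reg s3 29 = r0"
        using frame_reg[OF fr2, of 0] frame_reg[OF fr2, of 1] frame_reg[OF fr2, of 34] r1 b0 by (simp_all add: s3_def)
      have main: "wp w main_prog (\<lambda>t s'. \<exists>v'. main_state n d h X b0 D0 r0 N s3 v' s' \<and> \<not> holds (RLess 8 7) s' \<and>
        t \<le> 130 * N + 1) s3"
        unfolding main_prog_def
      proof (rule wp_While[where I = "main_state n d h X b0 D0 r0 N s3", OF state0])
        fix v s' assume S: "main_state n d h X b0 D0 r0 N s3 v s'" and more: "holds (RLess 8 7) s'"
        show "wp w main_body (\<lambda>t s'. \<exists>v'. main_state n d h X b0 D0 r0 N s3 v' s' \<and> v' + t + 1 \<le> v) s'"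
        proof (rule wp_main_body[OF S])
          show "reg s' 8 < reg s' 7" using more by simp
          show "reg s3 1 = d" by (rule r3)
          show "X p k = crd s3 (p * d + k)" for p k unfolding crd3 by (rule X)
          show "b0 + 9 * N + 30 < words w" using w(2) by (simp add: b0_def)
        qed (use w in simp_all)
      qed (use v0 in force)
      have "wp w (main_prog;; dir_prog) (\<lambda>t' s'. built n d X h N s' \<and> crd s' = crd s \<and> t1 + (t2 + (2 + t')) \<le> 250 * N + 60) s3"
        unfolding wp_Seq[of w main_prog]
      proof (rule wp_mono[OF main], elim exE conjE)
        fix t4 :: nat and s4 v' assume S: "main_state n d h X b0 D0 r0 N s3 v' s4" and stop: "\<not> holds (RLess 8 7) s4"
          and t4: "t4 \<le> 130 * N + 1"
        define b M4 where "b = reg s4 7" and "M4 = mem s4"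
        have c4: "consts_ok s4" and fr4: "frame main_regs s3 s4" using S unfolding main_state_def by blast+
        obtain R1 R2 lev where I0: "main_inv n d h X b0 D0 N M4 (reg s4 8) b R1 R2 lev"
          and hd0: "hd (R1 @ R2) = r0" and r12: "reg s4 12 = length (D0 @ R1 @ R2)"
          using S unfolding main_state_def b_def M4_def by blast
        have rR: "recs M4 (reg s4 8) R2 b" using I0 unfolding main_inv_def by blast
        have "reg s4 8 = b" using recs_le[OF rR] stop by (simp add: b_def)
        then have "R2 = []" using recs_Nil_iff[OF rR] by simp
        note I = I0[unfolded this append_Nil2]
        \<comment> \<open>The range tree consists of all processed records but the first,
          \<open>r0\<close>, whose key is 0.\<close>
        define V G where "V = D0 @ R1" and "G = set (tl R1)"
        have rV: "recs M4 b0 V b" using main_inv_space(3)[OF I] by (simp add: V_def)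
        have R1: "R1 = r0 # tl R1" using I hd0 \<open>R2 = []\<close> unfolding main_inv_def by (cases R1) auto
        have r0V: "r0 \<in> set R1" "r0 \<in> set V" unfolding V_def by (subst R1; simp)+
        have GV: "G \<subseteq> set V" unfolding G_def V_def by (subst (2) R1) auto
        have nodeV: "node_ok X M4 lev (set V) u" "set (elems M4 u) \<subseteq> {..<n}" if "u \<in> set V" for u
          using I that unfolding main_inv_def V_def append_Nil2 by blast+
        have nodeG: "node_ok X M4 lev G u" "1 \<le> M4 u" if "u \<in> G" for u
          using I that unfolding main_inv_def G_def append_Nil2 by blast+
        have nextR: "next_ok d M4 lev G u" "M4 u \<le> d" if "u \<in> set R1" for u
          using I that unfolding main_inv_def G_def append_Nil2 by blast+
        have GR: "G \<subseteq> set R1" unfolding G_def by (subst (2) R1) auto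
        have numV: "\<forall>j<length V. number M4 (V ! j) = j" and sumV: "total M4 V \<le> N"
          using I unfolding main_inv_def V_def append_Nil2 by auto
        have low2: "M4 r0 = 0" "set (elems M4 r0) = {..<n}" "lev r0 \<le> h"
          using I0 hd0 unfolding main_inv_def by auto
        have bN: "b \<le> b0 + 9 * N" using main_inv_space(1)[OF I] by simp
        have VN: "length V \<le> N"
        proof -
          have "(\<Sum>u\<leftarrow>V. 1) \<le> total M4 V"
          proof (rule sum_list_mono)
            fix u assume "u \<in> set V"
            then have "elems M4 u \<noteq> []" using nodeV(1) unfolding node_ok_def by blast
            then show "1 \<le> length (elems M4 u)" by (cases "elems M4 u") auto
          qed
          then show ?thesis using sumV by (simp add: sum_list_triv)
        qed
        have r4: "reg s4 29 = r0" "reg s4 34 = b0" "reg s4 0 = n" "reg s4 1 = d"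
          using frame_reg[OF fr4, of 29] frame_reg[OF fr4, of 34] frame_reg[OF fr4, of 0] frame_reg[OF fr4, of 1] r3
          by simp_all
        have r12V: "reg s4 12 = length V" using r12 \<open>R2 = []\<close> by (simp add: V_def)
        have bw: "b + length V + 20 < words w" using bN VN w(2) unfolding b0_def by linarith
        show "wp w dir_prog (\<lambda>t' s'. built n d X h N s' \<and> crd s' = crd s \<and> t1 + (t2 + (2 + (t4 + t'))) \<le> 250 * N + 60) s4"
        proof (rule wp_mono[OF wp_dir[OF c4 r4(1,2) b_def[symmetric] r12V rV[unfolded M4_def] r0V(2) bw]], elim conjE)
          fix t5 :: nat and s5
          assume fr5: "frame {2, 5, 7, 8, 21, 28} s4 s5" and r5: "reg s5 5 = next_tree (mem s4) r0" "reg s5 2 = b"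
            and low: "\<forall>a<b. mem s5 a = mem s4 a" and dir: "mem s5 b = length V" "\<forall>j<length V. mem s5 (b + 1 + j) = V ! j + 7"
            and t5: "t5 \<le> 7 * length V + 9"
          define M5 where "M5 = mem s5"
          have lowM: "M5 a = M4 a" if "a < b" for a using low that by (simp add: M5_def M4_def)
          have same: "same_rec M4 M5 u" if "u \<in> set V" for u by (rule recs_same[OF rV lowM that])
          have el: "elems M5 u = elems M4 u" "M5 u = M4 u" "number M5 u = number M4 u" if "u \<in> set V" for u
            using same[OF that] by (simp_all add: same_rec_def)
          have nx: "next_tree M5 u = next_tree M4 u" if "u \<in> set V" for u
            using recs_bounds[OF rV that] lowM[of "u + 5"] by (simp add: next_tree_def)
          have tree: "range_tree n d X M5 lev G"
          proof
            fix v assume v: "v \<in> G"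
            then have vV: "v \<in> set V" and vR: "v \<in> set R1" using GV GR by auto
            show "node_ok X M5 lev G v"
              by (rule node_ok_cong[OF _ _ v nodeG(1)[OF v]]) (use same GV in auto)
            show "next_ok d M5 lev G v"
            proof (rule next_ok_cong[where M = M4 and M' = M5 and lev = lev and lev' = lev and U = G and U' = G])
              show "same_rec M4 M5 u" if "u \<in> G" for u using that GV by (intro same) auto
              show "same_rec M4 M5 v" "next_tree M5 v = next_tree M4 v" "next_ok d M4 lev G v"
                by (rule same[OF vV] nx[OF vV] nextR(1)[OF vR])+
            qed simp_all
            show "1 \<le> M5 v \<and> M5 v \<le> d" using nodeG(2)[OF v] nextR(2)[OF vR] el[OF vV] by simp
            show "set (elems M5 v) \<subseteq> {..<n}" using nodeV(2)[OF vV] el[OF vV] by simp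
          qed
          have root: "next_tree M4 r0 \<in> G" "M4 (next_tree M4 r0) = 1" "lev (next_tree M4 r0) \<le> h"
            "set (elems M4 (next_tree M4 r0)) = {..<n}"
            using nextR(1)[OF r0V(1)] low2 d unfolding next_ok_def
            by (auto simp: One_nat_def)
          have rootV: "next_tree M4 r0 \<in> set V" using root(1) GV by auto
          have r50: "reg s5 5 = next_tree M4 r0" using r5(1) by (simp add: M4_def)
          have "built n d X h N s5"
            unfolding built_def M5_def[symmetric] r50
          proof (intro conjI exI)
            show "reg s5 0 = n" "reg s5 1 = d" using frame_reg[OF fr5, of 0] frame_reg[OF fr5, of 1] r4 by simp_all
            show "recs M5 (3 * n + 2 * d + 10) V b" using recs_below[OF rV lowM] by (simp add: b0_def)
            show "reg s5 2 = b" by (rule r5)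
            show "b \<le> 3 * n + 2 * d + 10 + 9 * N" using bN by (simp add: b0_def)
            show "length V \<le> N" by (rule VN)
            show "\<forall>u\<in>set V. distinct (elems M5 u) \<and> set (elems M5 u) \<subseteq> {..<n}"
              using nodeV el by (auto simp: node_ok_def)
            show "\<forall>j<length V. number M5 (V ! j) = j" using numV el by simp
            have "map (\<lambda>u. length (elems M5 u)) V = map (\<lambda>u. length (elems M4 u)) V" using el by simp
            then show "total M5 V \<le> N" using sumV by metis
            show "M5 b = length V" "\<forall>j<length V. M5 (b + 1 + j) = V ! j + 7" using dir by (simp_all add: M5_def)
            show "range_tree n d X M5 lev G" "G \<subseteq> set V" by fact+
            show "next_tree M4 r0 \<in> G" "M5 (next_tree M4 r0) = 1" "lev (next_tree M4 r0) \<le> h"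
              "set (elems M5 (next_tree M4 r0)) = {..<n}" using root el[OF rootV] by simp_all
          qed
          moreover have "crd s5 = crd s" using frame_crd[OF fr5] frame_crd[OF fr4] crd3 by simp
          moreover have "t1 + (t2 + (2 + (t4 + t5))) \<le> 250 * N + 60"
            using t1 t2 t4 t5 nS(1) nN VN unfolding length_upt diff_zero by linarith
          ultimately show "built n d X h N s5 \<and> crd s5 = crd s \<and> t1 + (t2 + (2 + (t4 + t5))) \<le> 250 * N + 60" by blast
        qed
      qed
      moreover have "2 + t = 1 + (1 + t)" for t :: nat by simp
      moreover have "reg s2 4 = 0" "reg s2 10 < words w"
      proof -
        have "consts_ok s2" by (rule consts_ok_frame[OF c1 fr2]) simp
        then show "reg s2 4 = 0" by (simp add: consts_ok_def)
        have "reg s2 7 \<le> b0 + 9 * N" using main_inv_space(1)[OF inv0] by simp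
        then show "reg s2 10 < words w" using r0b w(2) r2 unfolding b0_def r0_def by linarith
      qed
      ultimately show "wp w (ADD 8 10 4;; ADD 29 10 4;; main_prog;; dir_prog)
        (\<lambda>t' s'. built n d X h N s' \<and> crd s' = crd s \<and> t1 + (t2 + t') \<le> 250 * N + 60) s2"
        using r2(1) unfolding wp_Seq[of w "ADD _ _ _"] wp_Instr by (simp add: exec_Add s3_def r0_def)
    qed
  qed
qed

section \<open>Answering a query\<close>

lemma wp_fetch:
  assumes c: "reg s 6 = 1" "reg s 1 = d" "reg s 34 = nd" "reg s 9 = sp + 1" "mem s sp = v" "mem s v = Suc k"
    and w: "sp + 1 < words w" "v + 8 < words w" "k < d" "nd + 2 * d < words w"
      "low (mem s) v * d + k < words w" "high (mem s) v * d + k < words w"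
  shows "wp w fetch_prog (\<lambda>t s'. t = 26 \<and> frame {9, 10, 11, 12, 13, 14, 15, 16, 17, 18, 19, 20, 21, 22, 23} s s' \<and>
     mem s' = mem s \<and> reg s' 9 = sp \<and> reg s' 11 = Suc k \<and>
     reg s' 12 = low (mem s) v * d + k \<and> reg s' 13 = high (mem s) v * d + k \<and>
     reg s' 14 = left (mem s) v \<and> reg s' 15 = right (mem s) v \<and> reg s' 16 = next_tree (mem s) v \<and>
     reg s' 17 = number (mem s) v \<and> reg s' 19 = mem s (2 * k) \<and> reg s' 20 = mem s (2 * k + 1) \<and>
     reg s' 22 = nd + 2 * k \<and> reg s' 23 = nd + (2 * k + 1)) s"
proof -
  have f: "mem s (v + 1) * d < words w" "mem s (v + 2) * d < words w"
    "mem s (v + 1) * d + k < words w" "mem s (v + 2) * d + k < words w" "Suc k < words w" "Suc k - 1 = k"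
    using w unfolding low_def high_def by linarith+
  show ?thesis
    using c w f unfolding fetch_prog_def
    by (simp add: wp_steps frame_def low_def high_def left_def right_def next_tree_def number_def add.assoc mult_2[symmetric] cong: wp_cong)
qed

text \<open>The branches are verified for any delay \<open>i\<close> of at most 3, so nested tests
  need not be unfolded for each kind of endpoint.\<close>

lemma wp_test_lower:
  assumes "reg s 4 = 0" "reg s 6 = 1" "reg s 19 = kind e" "crd s (reg s 22) = coordinate e"
    and "\<And>i. i \<le> 3 \<Longrightarrow> above e (crd s (reg s x)) \<Longrightarrow> wp w p (\<lambda>t. Q (i + t)) s"
    and "\<And>i. i \<le> 3 \<Longrightarrow> \<not> above e (crd s (reg s x)) \<Longrightarrow> wp w q (\<lambda>t. Q (i + t)) s"
  shows "wp w (test_lower x p q) Q s"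
  using assms(1-4) assms(5)[of 1] assms(6)[of 1] assms(5)[of 3] assms(6)[of 3]
  by (cases e) (auto simp: test_lower_def wp_If not_less not_le add.assoc[symmetric])

lemma wp_test_upper:
  assumes "reg s 4 = 0" "reg s 6 = 1" "reg s 20 = kind e" "crd s (reg s 23) = coordinate e"
    and "\<And>i. i \<le> 3 \<Longrightarrow> below e (crd s (reg s x)) \<Longrightarrow> wp w p (\<lambda>t. Q (i + t)) s"
    and "\<And>i. i \<le> 3 \<Longrightarrow> \<not> below e (crd s (reg s x)) \<Longrightarrow> wp w q (\<lambda>t. Q (i + t)) s"
  shows "wp w (test_upper x p q) Q s"
  using assms(1-4) assms(5)[of 1] assms(6)[of 1] assms(5)[of 3] assms(6)[of 3]
  by (cases e) (auto simp: test_upper_def wp_If not_less not_le add.assoc[symmetric])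

lemma wp_push: "reg s 6 = 1 \<Longrightarrow> reg s 9 + 1 < words w \<Longrightarrow> r \<noteq> 9 \<Longrightarrow> wp w (push r) Q s \<longleftrightarrow>
    Q 2 (s\<lparr>reg := (reg s)(9 := reg s 9 + 1), mem := (mem s)(reg s 9 := reg s r)\<rparr>)"
  by (simp add: push_def wp_steps cong: wp_cong)

abbreviation "query_regs \<equiv> {4, 7, 9, 10, 11, 12, 13, 14, 15, 16, 17, 18, 19, 20, 21, 22, 23} :: nat set"

text \<open>Each visit is worth 60 credits; it takes at most 45 steps with the loop test. The last
  inequality charges each reported node to the visit that reported it, so one count bounds both time
  and output.\<close>

definition query_state where
  "query_state n d q X M lev U rt0 s0 v s \<longleftrightarrow> frame query_regs s0 s \<and> reg s 4 = 0 \<and>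
     (\<forall>a\<ge>3 * n + 2 * d + 10. mem s a = M a) \<and> (\<forall>a<2 * d. mem s a = mem s0 a) \<and>
     (\<exists>stk out. query_inv n d q X M U stk out \<and>
       reg s 9 = 2 * d + n + 2 + length stk \<and> (\<forall>i<length stk. mem s (2 * d + n + 2 + i) = stk ! i) \<and>
       reg s 7 = 2 * d + 1 + length out \<and> mem s (2 * d) = length out \<and>
       (\<forall>i<length out. mem s (2 * d + 1 + i) = number M (out ! i)) \<and>
       v = 60 * (\<Sum>u\<leftarrow>stk. node_visits d q X M lev u) \<and>
       v + 60 * length out \<le> 60 * node_visits d q X M lev rt0)"

lemma wp_query_body:
  assumes inv: "query_state n d q X M lev U rt0 s0 v s" and more: "reg s 8 < reg s 9"
    and rt: "range_tree n d X M lev U" and U: "\<And>u. u \<in> U \<Longrightarrow> 3 * n + 2 * d + 10 \<le> u \<and> u + 8 < words w"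
    and s0: "reg s0 6 = 1" "reg s0 1 = d" "reg s0 34 = n * d" "reg s0 8 = 2 * d + n + 2" "reg s0 3 = 2 * d"
    and w: "n * d + 2 * d < words w" "3 * n + 2 * d + 10 < words w"
    and X: "\<And>p k. p < n \<Longrightarrow> k < d \<Longrightarrow> crd s0 (p * d + k) = X p k"
    and kinds: "\<And>k. k < d \<Longrightarrow> mem s0 (2 * k) = kind (fst (q ! k)) \<and> mem s0 (2 * k + 1) = kind (snd (q ! k)) \<and>
        crd s0 (n * d + 2 * k) = coordinate (fst (q ! k)) \<and> crd s0 (n * d + (2 * k + 1)) = coordinate (snd (q ! k))"
  shows "wp w query_body (\<lambda>t s'. \<exists>v'. query_state n d q X M lev U rt0 s0 v' s' \<and> v' + t + 1 \<le> v) s"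
proof -
  interpret range_tree n d X M lev U by (rule rt)
  let ?B = "3 * n + 2 * d + 10" and ?sb = "2 * d + n + 2"
  have fr: "frame query_regs s0 s" and r4: "reg s 4 = 0" and hiM: "\<And>a. ?B \<le> a \<Longrightarrow> mem s a = M a"
    and loM: "\<And>a. a < 2 * d \<Longrightarrow> mem s a = mem s0 a"
    using inv unfolding query_state_def by blast+
  obtain stk0 out where Q0: "query_inv n d q X M U stk0 out"
    and r9: "reg s 9 = ?sb + length stk0" and stk0: "\<And>i. i < length stk0 \<Longrightarrow> mem s (?sb + i) = stk0 ! i"
    and r7: "reg s 7 = 2 * d + 1 + length out" and olen: "mem s (2 * d) = length out"
    and outs: "\<And>i. i < length out \<Longrightarrow> mem s (2 * d + 1 + i) = number M (out ! i)"
    and v: "v = 60 * (\<Sum>u\<leftarrow>stk0. node_visits d q X M lev u)"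
    and tot: "v + 60 * length out \<le> 60 * node_visits d q X M lev rt0"
    using inv unfolding query_state_def by blast
  have "reg s 8 = ?sb" using frame_reg[OF fr, of 8] s0 by simp
  then have "stk0 \<noteq> []" using more r9 by auto
  then obtain stk x where st: "stk0 = stk @ [x]" by (metis rev_exhaust)
  note Q = Q0[unfolded st]
  define k where "k = M x - 1"
  have xU: "x \<in> U" using Q by (auto simp: query_inv_def)
  have xk: "M x = Suc k" "k < d" using key[OF xU] by (auto simp: k_def)
  have node_x: "low M x \<in> set (elems M x)" "high M x \<in> set (elems M x)" using node[OF xU] by (auto simp: node_ok_def)
  have xB: "?B \<le> x" "x + 8 < words w" using U[OF xU] by auto
  have lh: "low M x < n" "high M x < n" using elems_less[OF xU] node_x by auto
  \<comment> \<open>This keeps the output below the bottom \<open>2 * d + n + 2\<close> of the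
    stack, and the stack below the records.\<close>
  have ln: "length stk + 1 + length out \<le> n" using length_stack[OF Q] by simp
  have fields: "mem s x = Suc k" "low (mem s) x = low M x" "high (mem s) x = high M x" "left (mem s) x = left M x"
    "right (mem s) x = right M x" "next_tree (mem s) x = next_tree M x" "number (mem s) x = number M x"
    using xB hiM xk by (auto simp: low_def high_def left_def right_def next_tree_def number_def)
  have fit: "p * d + k < words w" if "p < n" for p
  proof -
    have "Suc p * d \<le> n * d" using that by (intro mult_le_mono1) simp
    then show ?thesis using w(1) xk(2) by simp
  qed
  have top: "mem s (?sb + length stk) = x" using stk0[of "length stk"] by (simp add: st)
  have bsb: "?sb + length stk + 1 < ?B" using ln by linarith
  have k2: "2 * k < 2 * d" "2 * k + 1 < 2 * d" using xk(2) by auto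
  have s1s: "reg s 6 = 1" "reg s 1 = d" "reg s 34 = n * d" "reg s 3 = 2 * d"
    using frame_reg[OF fr, of 6] frame_reg[OF fr, of 1] frame_reg[OF fr, of 34] frame_reg[OF fr, of 3] s0 by simp_all
  have r9': "reg s 9 = ?sb + length stk + 1" using r9 by (simp add: st)
  have fetch: "wp w fetch_prog (\<lambda>t s'. t = 26 \<and> frame {9, 10, 11, 12, 13, 14, 15, 16, 17, 18, 19, 20, 21, 22, 23} s s' \<and>
     mem s' = mem s \<and> reg s' 9 = ?sb + length stk \<and> reg s' 11 = Suc k \<and>
     reg s' 12 = low (mem s) x * d + k \<and> reg s' 13 = high (mem s) x * d + k \<and>
     reg s' 14 = left (mem s) x \<and> reg s' 15 = right (mem s) x \<and> reg s' 16 = next_tree (mem s) x \<and>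
     reg s' 17 = number (mem s) x \<and> reg s' 19 = mem s (2 * k) \<and> reg s' 20 = mem s (2 * k + 1) \<and>
     reg s' 22 = n * d + 2 * k \<and> reg s' 23 = n * d + (2 * k + 1)) s"
  proof (rule wp_fetch[OF s1s(1-3) r9' top fields(1)])
    show "?sb + length stk + 1 < words w" using bsb w(2) by linarith
  qed (use xB xk w fit lh in \<open>simp_all add: fields\<close>)
  show ?thesis
    unfolding query_body_def wp_Seq[of w fetch_prog]
  proof (rule wp_mono[OF fetch], elim conjE)
    fix t1 :: nat and s2
    assume t1: "t1 = 26" and fr2: "frame {9, 10, 11, 12, 13, 14, 15, 16, 17, 18, 19, 20, 21, 22, 23} s s2" and m2: "mem s2 = mem s"
      and g: "reg s2 9 = ?sb + length stk" "reg s2 11 = Suc k"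
        "reg s2 12 = low (mem s) x * d + k" "reg s2 13 = high (mem s) x * d + k"
        "reg s2 14 = left (mem s) x" "reg s2 15 = right (mem s) x" "reg s2 16 = next_tree (mem s) x"
        "reg s2 17 = number (mem s) x" "reg s2 19 = mem s (2 * k)" "reg s2 20 = mem s (2 * k + 1)"
        "reg s2 22 = n * d + 2 * k" "reg s2 23 = n * d + (2 * k + 1)"
    note f2 = frame_reg[OF fr2]
    have c2: "reg s2 4 = 0" "reg s2 6 = 1" "reg s2 1 = d" "reg s2 3 = 2 * d" "reg s2 7 = 2 * d + 1 + length out"
      using f2[of 4] f2[of 6] f2[of 1] f2[of 3] f2[of 7] r4 s1s r7 by simp_all
    have crd2: "crd s2 = crd s0" using frame_crd[OF fr2] frame_crd[OF fr] by simp
    let ?a = "fst (q ! k)" and ?b = "snd (q ! k)" and ?lo = "X (low M x) k" and ?hi = "X (high M x) k"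
    have cl: "crd s2 (reg s2 12) = ?lo" "crd s2 (reg s2 13) = ?hi"
      using X lh xk(2) by (simp_all add: crd2 g fields)
    have ce: "crd s2 (reg s2 22) = coordinate ?a" "crd s2 (reg s2 23) = coordinate ?b"
      "reg s2 19 = kind ?a" "reg s2 20 = kind ?b"
      using kinds[OF xk(2)] loM[OF k2(1)] loM[OF k2(2)] by (simp_all add: crd2 g)
    define P where "P t s' \<longleftrightarrow> (\<exists>v'. query_state n d q X M lev U rt0 s0 v' s' \<and> v' + (t1 + t) + 1 \<le> v)" for t s'
    have fin: "P t s3"
      if Q': "query_inv n d q X M U stk' out'" and t: "t \<le> 18"
        and vis: "Suc (\<Sum>u\<leftarrow>stk'. node_visits d q X M lev u) \<le> (\<Sum>u\<leftarrow>stk0. node_visits d q X M lev u)"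
        and fr3: "frame query_regs s2 s3" "reg s3 4 = 0"
        and r9: "reg s3 9 = ?sb + length stk'" and stk': "\<And>i. i < length stk' \<Longrightarrow> mem s3 (?sb + i) = stk' ! i"
        and r7: "reg s3 7 = 2 * d + 1 + length out'" and olen': "mem s3 (2 * d) = length out'"
        and outs': "\<And>i. i < length out' \<Longrightarrow> mem s3 (2 * d + 1 + i) = number M (out' ! i)"
        and m3: "\<And>a. ?B \<le> a \<or> a < 2 * d \<Longrightarrow> mem s3 a = mem s a" and lo: "length out' \<le> Suc (length out)"
      for stk' out' t s3
    proof -
      let ?v = "60 * (\<Sum>u\<leftarrow>stk'. node_visits d q X M lev u)"
      have v': "?v + 60 \<le> v" using vis v by simp
      have "frame query_regs s0 s3" using fr fr2 fr3(1) by (auto simp: frame_def)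
      moreover have "?v + 60 * length out' \<le> 60 * node_visits d q X M lev rt0" using v' tot lo by linarith
      moreover have "\<forall>a\<ge>?B. mem s3 a = M a" "\<forall>a<2 * d. mem s3 a = mem s0 a" using m3 hiM loM by auto
      ultimately have "query_state n d q X M lev U rt0 s0 ?v s3"
        unfolding query_state_def using Q' fr3(2) r9 stk' r7 olen' outs' by blast
      moreover have "?v + (t1 + t) + 1 \<le> v" using v' t t1 by linarith
      ultimately show ?thesis unfolding P_def by blast
    qed
    \<comment> \<open>The bound 12 stands for up to four tests of at most three steps each.\<close>
    have skip: "wp w SKIP (\<lambda>t. P (i + t)) s2" if out: "\<not> above ?a ?hi \<or> \<not> below ?b ?lo" and i: "i \<le> 12" for i
    proof -
      have "P (i + 1) (s2\<lparr>reg := (reg s2)(4 := 0)\<rparr>)"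
      proof (rule fin[OF inv_outside[OF Q k_def out]])
        show "Suc (\<Sum>u\<leftarrow>stk. node_visits d q X M lev u) \<le> (\<Sum>u\<leftarrow>stk0. node_visits d q X M lev u)"
          using visits_pos by (simp add: st node_visits_def Let_def One_nat_def Suc_le_eq)
        show "mem (s2\<lparr>reg := (reg s2)(4 := 0)\<rparr>) (?sb + j) = stk ! j" if "j < length stk" for j
          using stk0[of j] that by (simp add: st m2 nth_append)
      qed (use i g c2 olen outs in \<open>auto simp: frame_def m2\<close>)
      then show ?thesis using w by (simp add: wp_steps)
    qed
    have inside: "wp w inside_prog (\<lambda>t. P (i + t)) s2" if a: "above ?a ?lo" and b: "below ?b ?hi" and i: "i \<le> 12" for i
    proof (cases "M x < d")
      case True
      define y s3 where "y = next_tree M x"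
        and "s3 = s2\<lparr>reg := (reg s2)(9 := ?sb + length stk + 1), mem := (mem s2)(?sb + length stk := y)\<rparr>"
      have "P (i + 3) s3"
      proof (rule fin[OF inv_next[OF Q k_def a b True, folded y_def]])
        show "Suc (\<Sum>u\<leftarrow>stk @ [y]. node_visits d q X M lev u) \<le> (\<Sum>u\<leftarrow>stk0. node_visits d q X M lev u)"
          using visits_next[OF Q k_def a b True] by (simp add: st y_def)
        show "mem s3 (?sb + j) = (stk @ [y]) ! j" if "j < length (stk @ [y])" for j
          using stk0[of j] that by (auto simp: st m2 nth_append s3_def less_Suc_eq)
        show "mem s3 (2 * d + 1 + j) = number M (out ! j)" if "j < length out" for j
          using outs[OF that] that ln by (simp add: s3_def m2)
        show "mem s3 a = mem s a" if "?B \<le> a \<or> a < 2 * d" for a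
          using that bsb by (auto simp: s3_def m2)
      qed (use i g c2 olen in \<open>auto simp: frame_def m2 s3_def\<close>)
      then show ?thesis
        using True c2 g xk bsb w unfolding inside_prog_def
        by (simp add: wp_If wp_push fields s3_def y_def)
    next
      case False
      define s3 where "s3 = s2\<lparr>reg := (reg s2)(7 := 2 * d + 1 + length out + 1, 21 := length out + 1),
        mem := (mem s2)(2 * d + 1 + length out := number M x, 2 * d := length out + 1)\<rparr>"
      have "P (i + 6) s3"
      proof (rule fin[OF inv_output[OF Q k_def a b False]])
        show "Suc (\<Sum>u\<leftarrow>stk. node_visits d q X M lev u) \<le> (\<Sum>u\<leftarrow>stk0. node_visits d q X M lev u)"
          using visits_pos by (simp add: st node_visits_def Let_def One_nat_def Suc_le_eq)
        show "mem s3 (?sb + j) = stk ! j" if "j < length stk" for j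
          using stk0[of j] that ln by (simp add: st m2 nth_append s3_def)
        show "mem s3 (2 * d + 1 + j) = number M ((out @ [x]) ! j)" if "j < length (out @ [x])" for j
          using outs[of j] that by (auto simp: s3_def m2 nth_append less_Suc_eq)
        show "mem s3 a = mem s a" if "?B \<le> a \<or> a < 2 * d" for a
          using that ln by (auto simp: s3_def m2)
      qed (use i g c2 in \<open>auto simp: frame_def m2 s3_def\<close>)
      moreover have "2 * d + 1 + length out + 1 < words w" using ln w(2) by linarith
      ultimately show ?thesis
        using False c2 g xk w olen unfolding inside_prog_def
        by (simp add: wp_steps fields s3_def m2 cong: wp_cong)
    qed
    have split: "wp w split_prog (\<lambda>t. P (i + t)) s2"
      if ab: "above ?a ?hi" "below ?b ?lo" "\<not> (above ?a ?lo \<and> below ?b ?hi)" and i: "i \<le> 12" for i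
    proof -
      define cs where "cs = (if left M x = right M x then [left M x] else [left M x, right M x])"
      have Qs: "query_inv n d q X M U (stk @ cs) out" unfolding cs_def by (rule inv_split[OF Q k_def ab])
      have vis: "Suc (\<Sum>u\<leftarrow>stk @ cs. node_visits d q X M lev u) \<le> (\<Sum>u\<leftarrow>stk0. node_visits d q X M lev u)"
        using visits_children[OF Q k_def ab] unfolding cs_def st by simp
      \<comment> \<open>Counting in the state after the split guarantees the room for the second
        push beforehand.\<close>
      have lcs: "length stk + length cs + length out \<le> n" using length_stack[OF Qs] by simp
      show ?thesis
      proof (cases "left M x = right M x")
        case True
        define s3 where "s3 = s2\<lparr>reg := (reg s2)(9 := ?sb + length stk + 1, 4 := 0), mem := (mem s2)(?sb + length stk := left M x)\<rparr>"
        have "P (i + 4) s3"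
        proof (rule fin[OF Qs _ vis])
          show "mem s3 (?sb + j) = (stk @ cs) ! j" if "j < length (stk @ cs)" for j
            using stk0[of j] that True by (auto simp: st m2 nth_append s3_def less_Suc_eq cs_def)
          show "mem s3 (2 * d + 1 + j) = number M (out ! j)" if "j < length out" for j
            using outs[OF that] that ln by (simp add: s3_def m2)
          show "mem s3 a = mem s a" if "?B \<le> a \<or> a < 2 * d" for a
            using that bsb by (auto simp: s3_def m2)
        qed (use i g c2 olen True in \<open>auto simp: frame_def m2 s3_def cs_def\<close>)
        then show ?thesis
          using True c2 g bsb w unfolding split_prog_def
          by (simp add: wp_steps wp_push fields s3_def cong: wp_cong)
      next
        case False
        define s3 where "s3 = s2\<lparr>reg := (reg s2)(9 := ?sb + length stk + 1 + 1),
          mem := (mem s2)(?sb + length stk := left M x, ?sb + length stk + 1 := right M x)\<rparr>"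
        have bsb': "?sb + length stk + 1 + 1 < ?B" using lcs False by (simp add: cs_def)
        have "P (i + 5) s3"
        proof (rule fin[OF Qs _ vis])
          show "mem s3 (?sb + j) = (stk @ cs) ! j" if "j < length (stk @ cs)" for j
          proof -
            from that False consider "j < length stk" | "j = length stk" | "j = length stk + 1"
              by (fastforce simp: cs_def One_nat_def)
            then show ?thesis using stk0[of j] False by cases (auto simp: st m2 nth_append s3_def cs_def One_nat_def)
          qed
          show "mem s3 (2 * d + 1 + j) = number M (out ! j)" if "j < length out" for j
            using outs[OF that] that ln by (simp add: s3_def m2)
          show "mem s3 a = mem s a" if "?B \<le> a \<or> a < 2 * d" for a
            using that bsb' by (auto simp: s3_def m2)
        qed (use i g c2 olen False in \<open>auto simp: frame_def m2 s3_def cs_def\<close>)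
        then show ?thesis
          using False c2 g bsb' w unfolding split_prog_def
          by (simp add: wp_steps wp_push fields s3_def cong: wp_cong)
      qed
    qed
    have "wp w (test_lower 13 (test_upper 12 (test_lower 12 (test_upper 13 inside_prog split_prog) split_prog) SKIP) SKIP) P s2"
      apply (rule wp_test_lower[OF c2(1,2) ce(3,1)])
       apply (rule wp_test_upper[OF c2(1,2) ce(4,2)])
        apply (rule wp_test_lower[OF c2(1,2) ce(3,1)])
         apply (rule wp_test_upper[OF c2(1,2) ce(4,2)])
      unfolding add.assoc[symmetric] cl
          apply (rule inside; simp)
         apply (rule split; simp)
        apply (rule split; simp)
       apply (rule skip; simp)
      apply (rule skip; simp)
      done
    then show "wp w (test_lower 13 (test_upper 12 (test_lower 12 (test_upper 13 inside_prog split_prog) split_prog) SKIP) SKIP)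
      (\<lambda>t' s'. \<exists>v'. query_state n d q X M lev U rt0 s0 v' s' \<and> v' + (t1 + t') + 1 \<le> v) s2"
      unfolding P_def .
  qed
qed

lemma wp_query:
  assumes rt: "range_tree n d X M lev U" and U: "\<And>u. u \<in> U \<Longrightarrow> 3 * n + 2 * d + 10 \<le> u \<and> u + 8 < words w"
    and rt0: "rt0 \<in> U" "M rt0 = 1" "set (elems M rt0) = {..<n}"
    and regs: "reg s 0 = n" "reg s 1 = d" "reg s 5 = rt0"
    and M: "\<And>a. 3 * n + 2 * d + 10 \<le> a \<Longrightarrow> mem s a = M a"
    and w: "n * d + 2 * d < words w" "3 * n + 2 * d + 10 < words w"
    and X: "\<And>p k. p < n \<Longrightarrow> k < d \<Longrightarrow> crd s (p * d + k) = X p k"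
    and kinds: "\<And>k. k < d \<Longrightarrow> mem s (2 * k) = kind (fst (q ! k)) \<and> mem s (2 * k + 1) = kind (snd (q ! k)) \<and>
        crd s (n * d + 2 * k) = coordinate (fst (q ! k)) \<and> crd s (n * d + (2 * k + 1)) = coordinate (snd (q ! k))"
  shows "wp w query_prog (\<lambda>t s'. \<exists>out. query_inv n d q X M U [] out \<and>
      crd s' = crd s \<and> (\<forall>r\<in>{0, 1, 2, 5}. reg s' r = reg s r) \<and> reg s' 3 = 2 * d \<and>
      (\<forall>a\<ge>3 * n + 2 * d + 10. mem s' a = M a) \<and>
      mem s' (2 * d) = length out \<and> (\<forall>i<length out. mem s' (2 * d + 1 + i) = number M (out ! i)) \<and>
      length out \<le> node_visits d q X M lev rt0 \<and> t \<le> 60 * node_visits d q X M lev rt0 + 20) s"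
proof -
  interpret range_tree n d X M lev U by (rule rt)
  let ?B = "3 * n + 2 * d + 10" and ?sb = "2 * d + n + 2"
  define s1 where "s1 = s\<lparr>reg := (reg s)(4 := 0, 6 := 1, 30 := 2, 31 := 5, 32 := 7, 33 := 8, 3 := d + d, 7 := d + d + 1,
     8 := d + d + n + 2, 9 := d + d + n + 2 + 1, 34 := n * d),
     mem := (mem s)(d + d := 0, d + d + n + 2 := rt0)\<rparr>"
  define v where "v = 60 * node_visits d q X M lev rt0"
  have d0: "0 < d" using key[OF rt0(1)] by simp
  have inv0: "query_inv n d q X M U [rt0] []"
    using rt0 node[OF rt0(1)] by (auto simp: query_inv_def node_ok_def One_nat_def)
  have n0: "1 \<le> n" using length_stack[OF inv0] by (simp add: One_nat_def)
  have state: "query_state n d q X M lev U rt0 s1 v s1"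
    unfolding query_state_def
  proof (intro conjI exI)
    show "frame query_regs s1 s1" by (rule frame_refl)
    show "query_inv n d q X M U [rt0] []" by (rule inv0)
    show "\<forall>a\<ge>?B. mem s1 a = M a" using M n0 by (auto simp: s1_def)
  qed (simp_all add: s1_def v_def)
  have loop: "wp w (While (RLess 8 9) query_body)
    (\<lambda>t s'. \<exists>v'. query_state n d q X M lev U rt0 s1 v' s' \<and> \<not> holds (RLess 8 9) s' \<and> t \<le> v + 1) s1"
  proof (rule wp_While[where I = "query_state n d q X M lev U rt0 s1", OF state])
    fix v s' assume S: "query_state n d q X M lev U rt0 s1 v s'" and more: "holds (RLess 8 9) s'"
    show "wp w query_body (\<lambda>t s'. \<exists>v'. query_state n d q X M lev U rt0 s1 v' s' \<and> v' + t + 1 \<le> v) s'"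
    proof (rule wp_query_body[OF S _ rt U])
      show "reg s' 8 < reg s' 9" using more by simp
      show "crd s1 (p * d + k) = X p k" if "p < n" "k < d" for p k using X[OF that] by (simp add: s1_def)
      show "mem s1 (2 * k) = kind (fst (q ! k)) \<and> mem s1 (2 * k + 1) = kind (snd (q ! k)) \<and>
        crd s1 (n * d + 2 * k) = coordinate (fst (q ! k)) \<and> crd s1 (n * d + (2 * k + 1)) = coordinate (snd (q ! k))"
        if "k < d" for k
      proof -
        have "2 * k + 1 < d + d" using that by simp
        then show ?thesis using kinds[OF that] by (simp add: s1_def)
      qed
    qed (use regs w in \<open>simp_all add: s1_def\<close>)
  qed force
  have head: "wp w (consts_prog;; ADD 3 1 1;; STORE 3 4;; ADD 7 3 6;; ADD 8 3 0;; ADD 8 8 30;;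
     ADD 9 8 4;; push 5;; MUL 34 0 1;; p) Q s" if "wp w p (\<lambda>t. Q (15 + t)) s1" for p Q
    unfolding wp_Seq[of w consts_prog] using w regs that
    by (intro wp_consts) (simp_all add: wp_steps wp_push s1_def add.assoc cong: wp_cong)
  show ?thesis
    unfolding query_prog_def
  proof (rule head, rule wp_mono[OF loop], elim exE conjE)
    fix t :: nat and s' v' assume S: "query_state n d q X M lev U rt0 s1 v' s'" and stop: "\<not> holds (RLess 8 9) s'"
      and t: "t \<le> v + 1"
    have fr: "frame query_regs s1 s'" and hiM: "\<forall>a\<ge>?B. mem s' a = M a"
      using S unfolding query_state_def by blast+
    obtain stk out where Q: "query_inv n d q X M U stk out" and r9: "reg s' 9 = ?sb + length stk"
      and olen: "mem s' (2 * d) = length out" and outs: "\<forall>i<length out. mem s' (2 * d + 1 + i) = number M (out ! i)"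
      and tot: "v' + 60 * length out \<le> 60 * node_visits d q X M lev rt0"
      using S unfolding query_state_def by blast
    have "reg s' 8 = ?sb" using frame_reg[OF fr, of 8] by (simp add: s1_def)
    then have "stk = []" using stop r9 by simp
    moreover have "\<forall>r\<in>{0, 1, 2, 5}. reg s' r = reg s r" "reg s' 3 = 2 * d" "crd s' = crd s"
      using frame_reg[OF fr, of 0] frame_reg[OF fr, of 1] frame_reg[OF fr, of 2] frame_reg[OF fr, of 5]
        frame_reg[OF fr, of 3] frame_crd[OF fr] by (simp_all add: s1_def)
    moreover have "length out \<le> node_visits d q X M lev rt0" using tot by linarith
    moreover have "15 + t \<le> 60 * node_visits d q X M lev rt0 + 20" using t by (simp add: v_def)
    ultimately show "\<exists>out. query_inv n d q X M U [] out \<and>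
      crd s' = crd s \<and> (\<forall>r\<in>{0, 1, 2, 5}. reg s' r = reg s r) \<and> reg s' 3 = 2 * d \<and>
      (\<forall>a\<ge>?B. mem s' a = M a) \<and>
      mem s' (2 * d) = length out \<and> (\<forall>i<length out. mem s' (2 * d + 1 + i) = number M (out ! i)) \<and>
      length out \<le> node_visits d q X M lev rt0 \<and> 15 + t \<le> 60 * node_visits d q X M lev rt0 + 20"
      using Q olen outs hiM by blast
  qed
qed

section \<open>Stored lists and sets of points\<close>

lemma distinct_concat_map:
  "distinct (concat (map f xs)) \<Longrightarrow> \<forall>x\<in>set xs. f x \<noteq> [] \<Longrightarrow>
   distinct xs \<and> (\<forall>x\<in>set xs. \<forall>y\<in>set xs. x \<noteq> y \<longrightarrow> set (f x) \<inter> set (f y) = {})"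
proof (induction xs)
  case (Cons x xs)
  then have IH: "distinct xs" "\<forall>x\<in>set xs. \<forall>y\<in>set xs. x \<noteq> y \<longrightarrow> set (f x) \<inter> set (f y) = {}" by auto
  have dis: "set (f x) \<inter> set (f y) = {}" if "y \<in> set xs" for y using Cons.prems(1) that by auto
  have "x \<notin> set xs" using dis[of x] Cons.prems(2) by auto
  moreover have "set (f y) \<inter> set (f x) = {}" if "y \<in> set xs" for y using dis[OF that] by blast
  ultimately show ?case using IH dis by simp
qed simp

lemma stored_list_elems: "stored_list M (v + 7) = elems M v"
proof -
  have "[v + 8..<v + 8 + M (v + 7)] = map (\<lambda>k. k + (v + 8)) [0..<M (v + 7)]"
    by (simp add: map_add_upt add.commute)
  then show ?thesis
    by (simp add: stored_list_def elems_def comp_def add.assoc add.commute[of _ "v + 8"] add.left_commute)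
qed

lemma le_two_power_log:
  assumes "1 \<le> n"
  shows "n \<le> 2 ^ nat \<lceil>log 2 (real n)\<rceil>"
proof -
  have "0 \<le> log 2 (real n)" using assms by (simp add: One_nat_def)
  then have "log 2 (real n) \<le> real (nat \<lceil>log 2 (real n)\<rceil>)" by linarith
  then have "2 powr log 2 (real n) \<le> 2 powr real (nat \<lceil>log 2 (real n)\<rceil>)" by (intro powr_mono) simp_all
  moreover have "2 powr log 2 (real n) = real n" using assms by (simp add: One_nat_def)
  ultimately have "real n \<le> 2 powr real (nat \<lceil>log 2 (real n)\<rceil>)" by simp
  then have "real n \<le> real (2 ^ nat \<lceil>log 2 (real n)\<rceil>)" by (simp add: powr_realpow)
  then show ?thesis by linarith
qed

text \<open>This is all that a query relies on and all that it preserves. The word cells below the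
  records and the coordinates of former endpoints may contain anything.\<close>

definition after_build where
  "after_build n d X M b rt0 s \<longleftrightarrow> reg s 0 = n \<and> reg s 1 = d \<and> reg s 2 = b \<and> reg s 5 = rt0 \<and>
     (\<forall>a\<ge>3 * n + 2 * d + 10. mem s a = M a) \<and> (\<forall>p<n. \<forall>k<d. crd s (p * d + k) = X p k)"

lemma point_address_less: "p < n \<Longrightarrow> k < d \<Longrightarrow> p * d + k < n * (d :: nat)"
proof -
  assume "p < n" "k < d"
  then have "Suc p * d \<le> n * d" by (intro mult_le_mono1) simp
  then show ?thesis using \<open>k < d\<close> by simp
qed

abbreviation query_post where
  "query_post n d q X M lev U rt0 t s' \<equiv> \<exists>out. query_inv n d q X M U [] out \<and> reg s' 3 = 2 * d \<and>
      mem s' (2 * d) = length out \<and> (\<forall>i<length out. mem s' (2 * d + 1 + i) = number M (out ! i)) \<and>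
      length out \<le> node_visits d q X M lev rt0 \<and> t \<le> 60 * node_visits d q X M lev rt0 + 20"

lemma wp_loaded_query:
  assumes rt: "range_tree n d X M lev U" and U: "\<And>u. u \<in> U \<Longrightarrow> 3 * n + 2 * d + 10 \<le> u \<and> u + 8 < words w"
    and rt0: "rt0 \<in> U" "M rt0 = 1" "set (elems M rt0) = {..<n}"
    and s: "after_build n d X M b rt0 s"
    and w: "n * d + 2 * d < words w" "3 * n + 2 * d + 10 < words w"
  shows "wp w query_prog (\<lambda>t s'. after_build n d X M b rt0 s' \<and> (query_post n d q X M lev U rt0 t s')) (load_query n d q s)"
proof (rule wp_mono[OF wp_query[OF rt U rt0]])
  let ?s = "load_query n d q s"
  show "reg ?s 0 = n" "reg ?s 1 = d" "reg ?s 5 = rt0" using s by (simp_all add: after_build_def load_query_def)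
  show "mem ?s a = M a" if "3 * n + 2 * d + 10 \<le> a" for a using s that by (simp add: after_build_def load_query_def)
  show crd: "crd ?s (p * d + k) = X p k" if "p < n" "k < d" for p k
    using s that point_address_less[OF that] by (simp add: after_build_def load_query_def)
  show "mem ?s (2 * k) = kind (fst (q ! k)) \<and> mem ?s (2 * k + 1) = kind (snd (q ! k)) \<and>
        crd ?s (n * d + 2 * k) = coordinate (fst (q ! k)) \<and> crd ?s (n * d + (2 * k + 1)) = coordinate (snd (q ! k))"
    if "k < d" for k
  proof -
    have "2 * k < 2 * d" "2 * k + 1 < 2 * d" "(2 * k + 1) div 2 = k" using that by simp_all
    then show ?thesis by (simp add: load_query_def query_endpoint_def)
  qed
  fix t s'
  assume "\<exists>out. query_inv n d q X M U [] out \<and>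
      crd s' = crd ?s \<and> (\<forall>r\<in>{0, 1, 2, 5}. reg s' r = reg ?s r) \<and> reg s' 3 = 2 * d \<and>
      (\<forall>a\<ge>3 * n + 2 * d + 10. mem s' a = M a) \<and>
      mem s' (2 * d) = length out \<and> (\<forall>i<length out. mem s' (2 * d + 1 + i) = number M (out ! i)) \<and>
      length out \<le> node_visits d q X M lev rt0 \<and> t \<le> 60 * node_visits d q X M lev rt0 + 20"
  then obtain out where o: "query_inv n d q X M U [] out"
      "crd s' = crd ?s" "\<forall>r\<in>{0, 1, 2, 5}. reg s' r = reg ?s r" "reg s' 3 = 2 * d"
      "\<forall>a\<ge>3 * n + 2 * d + 10. mem s' a = M a"
      "mem s' (2 * d) = length out" "\<forall>i<length out. mem s' (2 * d + 1 + i) = number M (out ! i)"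
      "length out \<le> node_visits d q X M lev rt0" "t \<le> 60 * node_visits d q X M lev rt0 + 20" by blast
  have "reg ?s r = reg s r" for r by (simp add: load_query_def)
  then have "after_build n d X M b rt0 s'"
    using s o(2,3,5) crd by (simp add: after_build_def)
  then show "after_build n d X M b rt0 s' \<and> (query_post n d q X M lev U rt0 t s')"
    using o by blast
qed (use w in auto)

theorem theorem3:
  shows "\<exists>(build :: prog) (query :: prog) (k :: nat) (c :: nat).
    \<forall>(n :: nat) (d :: nat) (w :: nat) (P :: real list set) (ps :: real list list).
      n \<ge> 1 \<longrightarrow> d \<ge> 1 \<longrightarrow> P \<subseteq> points d \<longrightarrow> finite P \<longrightarrow> card P = n \<longrightarrow>
      set ps = P \<longrightarrow> distinct ps \<longrightarrow>
      k * (n * d * B n d) \<le> 2 ^ w \<longrightarrow>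
      (\<exists>(I :: nat set) (F :: nat \<Rightarrow> real list set) (s0 :: config) (t0 :: nat).
         (\<forall>i\<in>I. F i \<subseteq> P) \<and>
         finite I \<and> (\<Sum>i\<in>I. card (F i)) \<le> c * (n * d * B n d) \<and>
         exec w build (build_input n d ps) t0 s0 \<and> t0 \<le> c * (n * d * B n d) \<and>
         (\<forall>s. after_queries w query n d s0 s \<longrightarrow>
            stores_family w ps s I F \<and>
            (\<forall>R q. axis_parallel_box d R \<longrightarrow> encodes_box d q R \<longrightarrow>
               (\<exists>t s' IR. exec w query (load_query n d q s) t s' \<and> t \<le> c * (2 ^ d * B n d) \<and>
                  returns_indices w s' IR \<and> IR \<subseteq> I \<and> card IR \<le> c * (2 ^ d * B n d) \<and>
                  P \<inter> R = (\<Union>i\<in>IR. F i) \<and> disjoint_family_on F IR))))"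
\<comment> \<open>With \<open>Z = n * d * B n d\<close> and \<open>N \<le> 3 * Z\<close>, the
  addresses stay below \<open>3 * n + 2 * d + 10 * N + 50\<close>, at most \<open>85 * Z\<close>,
  and the construction takes at most \<open>810 * Z\<close> steps. A query takes at most
  \<open>140 * (2 ^ d * B n d)\<close>.\<close>
proof (rule exI[of _ build_prog], rule exI[of _ query_prog], rule exI[of _ 100], rule exI[of _ 1000], intro allI impI)
  fix n d w :: nat and P :: "real list set" and ps :: "real list list"
  assume n: "n \<ge> 1" and d: "d \<ge> 1" and P: "P \<subseteq> points d" "finite P" "card P = n"
    and ps: "set ps = P" "distinct ps" and w: "100 * (n * d * B n d) \<le> 2 ^ w"
  define h where "h = nat \<lceil>log 2 (real n)\<rceil>"
  define N where "N = n * Suc h + n * weight h d"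
  define Z where "Z = n * d * B n d"
  have len: "length ps = n" using ps P(3) by (metis distinct_card)
  have B: "B n d = (h + d) choose d" by (simp add: B_def h_def add.commute)
  obtain d' where d': "d = Suc d'" using d by (cases d) auto
  have B1: "1 \<le> B n d" unfolding B by (simp add: Suc_le_eq One_nat_def)
  have "Suc h \<le> (h + d) choose d" unfolding d' by (rule Suc_le_choose)
  then have hB: "Suc h \<le> B n d" unfolding B .
  \<comment> \<open>Since \<open>d\<close> is positive, \<open>Suc h \<le> B n d\<close>, which
    absorbs the initial sort; the factor \<open>Suc d\<close> in \<open>weight h d\<close> is at
    most \<open>2 * d\<close>.\<close>
  have Z: "n \<le> Z" "d \<le> Z" "n * d \<le> Z" "1 \<le> Z" "N \<le> 3 * Z" "2 * d \<le> 2 * Z"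
  proof -
    have "n * d * 1 \<le> Z" unfolding Z_def using B1 by (intro mult_le_mono2)
    then show nd: "n * d \<le> Z" by simp
    have "n * 1 \<le> n * d" "1 * d \<le> n * d" using n d by (intro mult_le_mono; simp)+
    then show "n \<le> Z" "d \<le> Z" "1 \<le> Z" "2 * d \<le> 2 * Z" using nd n by linarith+
    have "n * Suc h \<le> n * (d * B n d)"
    proof (rule mult_le_mono2)
      have "1 * B n d \<le> d * B n d" using d by (intro mult_le_mono1)
      then show "Suc h \<le> d * B n d" using hB by linarith
    qed
    moreover have "n * weight h d \<le> n * (2 * (d * B n d))"
    proof (rule mult_le_mono2)
      have "Suc d * B n d \<le> (2 * d) * B n d" using d by (intro mult_le_mono1) simp
      then show "weight h d \<le> 2 * (d * B n d)" by (simp add: weight_def B)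
    qed
    moreover have "n * (2 * (d * B n d)) = 2 * Z" "n * (d * B n d) = Z" by (simp_all add: Z_def)
    ultimately show "N \<le> 3 * Z" unfolding N_def by linarith
  qed
  have W: "100 * Z \<le> words w" using w by (simp add: Z_def words_def)
  define X where "X = (\<lambda>p k. crd (build_input n d ps) (p * d + k))"
  have X: "X p k = ps ! p ! k" if "p < n" "k < d" for p k
    using point_address_less[OF that] that by (simp add: X_def build_input_def)
  have "wp w build_prog (\<lambda>t s'. built n d X h N s' \<and> crd s' = crd (build_input n d ps) \<and> t \<le> 250 * N + 60) (build_input n d ps)"
  proof (rule wp_build)
    show "reg (build_input n d ps) = (\<lambda>_. 0)(0 := n, 1 := d)" by (simp add: build_input_def)
    show "n \<le> 2 ^ h" unfolding h_def by (rule le_two_power_log[OF n])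
    show "N = n * Suc h + n * weight h d" by (rule N_def)
    show "n * d < words w" "3 * n + 2 * d + 10 * N + 50 < words w" using Z W by linarith+
  qed (use n d in \<open>simp_all add: X_def\<close>)
  then obtain t0 s0 where ex: "exec w build_prog (build_input n d ps) t0 s0" and bs: "built n d X h N s0"
    and crd0: "crd s0 = crd (build_input n d ps)" and t0: "t0 \<le> 250 * N + 60"
    unfolding wp_def by blast
  define M rt0 where "M = mem s0" and "rt0 = reg s0 5"
  let ?B = "3 * n + 2 * d + 10"
  have built: "built n d X h N s0 \<longleftrightarrow> reg s0 0 = n \<and> reg s0 1 = d \<and> (\<exists>V b lev U.
     recs M ?B V b \<and> reg s0 2 = b \<and> b \<le> ?B + 9 * N \<and> length V \<le> N \<and>
     (\<forall>u\<in>set V. distinct (elems M u) \<and> set (elems M u) \<subseteq> {..<n}) \<and>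
     (\<forall>j<length V. number M (V ! j) = j) \<and> total M V \<le> N \<and>
     M b = length V \<and> (\<forall>j<length V. M (b + 1 + j) = V ! j + 7) \<and>
     range_tree n d X M lev U \<and> U \<subseteq> set V \<and> rt0 \<in> U \<and> M rt0 = 1 \<and>
     lev rt0 \<le> h \<and> set (elems M rt0) = {..<n})"
    unfolding built_def M_def rt0_def ..
  have regs0: "reg s0 0 = n" "reg s0 1 = d" using bs unfolding built_def by - (elim conjE, assumption)+
  obtain V b lev U where V0: "recs M ?B V b" and r2: "reg s0 2 = b" and V1: "b \<le> ?B + 9 * N" "length V \<le> N"
     "\<forall>u\<in>set V. distinct (elems M u) \<and> set (elems M u) \<subseteq> {..<n}"
     "\<forall>j<length V. number M (V ! j) = j" "total M V \<le> N"
     "M b = length V" "\<forall>j<length V. M (b + 1 + j) = V ! j + 7" and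
     rt: "range_tree n d X M lev U" and UV: "U \<subseteq> set V" and rt0: "rt0 \<in> U" "M rt0 = 1"
     "lev rt0 \<le> h" "set (elems M rt0) = {..<n}"
    using bs unfolding built by (elim conjE exE) (rule that)
  have V: "recs M ?B V b" "b \<le> ?B + 9 * N" "length V \<le> N"
     "\<And>u. u \<in> set V \<Longrightarrow> distinct (elems M u) \<and> set (elems M u) \<subseteq> {..<n}"
     "\<And>j. j < length V \<Longrightarrow> number M (V ! j) = j" "total M V \<le> N"
     "M b = length V" "\<And>j. j < length V \<Longrightarrow> M (b + 1 + j) = V ! j + 7"
    using V0 V1 by simp_all
  interpret range_tree n d X M lev U by (rule rt)
  have bw: "b + length V + 1 < words w" using V(2,3) Z W by linarith
  have Ub: "?B \<le> u \<and> u + 8 < words w" if "u \<in> U" for u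
    using recs_bounds[OF V(1)] UV that bw by fastforce
  have ww: "n * d + 2 * d < words w" "?B < words w" using Z W by linarith+
  have after0: "after_build n d X M b rt0 s0"
    unfolding after_build_def using regs0 r2 crd0 by (simp add: M_def rt0_def X_def)
  define F where "F = (\<lambda>i. (!) ps ` set (elems M (V ! i)))"
  define I where "I = {..<length V}"
  have inj: "inj_on ((!) ps) {..<n}" using inj_on_nth[OF ps(2), of "{..<n}"] len by simp
  have P_eq: "P = (!) ps ` {..<n}" using ps(1) len by (auto simp: set_conv_nth)
  have FP: "F i \<subseteq> P" if "i \<in> I" for i
    using V(4)[of "V ! i"] that unfolding F_def P_eq I_def by auto
  have "(\<Sum>i\<in>I. card (F i)) \<le> (\<Sum>i\<in>I. length (elems M (V ! i)))"
    unfolding F_def by (intro sum_mono order.trans[OF card_image_le card_length]) simp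
  also have "\<dots> = total M V"
    unfolding I_def sum_list_sum_nth by (simp add: atLeast0LessThan)
  finally have FN: "(\<Sum>i\<in>I. card (F i)) \<le> N" using V(6) by linarith
  have query: "wp w query_prog (\<lambda>t s'. after_build n d X M b rt0 s' \<and> (query_post n d q X M lev U rt0 t s')) (load_query n d q s)"
    if "after_build n d X M b rt0 s" for q s
    by (rule wp_loaded_query[OF rt Ub rt0(1,2,4) that ww])
  \<comment> \<open>\<open>after_queries\<close> speaks of some execution, \<open>query\<close>
    provides one with the desired result; determinism identifies the two.\<close>
  have after: "after_build n d X M b rt0 s" if "after_queries w query_prog n d s0 s" for s
    using that
  proof induction
    case (step s q t s')
    from query[OF step.IH, of q] exec_deterministic[OF step.hyps(3)] show ?case unfolding wp_def by blast
  qed (rule after0)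
  show "\<exists>(I :: nat set) (F :: nat \<Rightarrow> real list set) (s0 :: config) (t0 :: nat).
         (\<forall>i\<in>I. F i \<subseteq> P) \<and>
         finite I \<and> (\<Sum>i\<in>I. card (F i)) \<le> 1000 * (n * d * B n d) \<and>
         exec w build_prog (build_input n d ps) t0 s0 \<and> t0 \<le> 1000 * (n * d * B n d) \<and>
         (\<forall>s. after_queries w query_prog n d s0 s \<longrightarrow>
            stores_family w ps s I F \<and>
            (\<forall>R q. axis_parallel_box d R \<longrightarrow> encodes_box d q R \<longrightarrow>
               (\<exists>t s' IR. exec w query_prog (load_query n d q s) t s' \<and> t \<le> 1000 * (2 ^ d * B n d) \<and>
                  returns_indices w s' IR \<and> IR \<subseteq> I \<and> card IR \<le> 1000 * (2 ^ d * B n d) \<and>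
                  P \<inter> R = (\<Union>i\<in>IR. F i) \<and> disjoint_family_on F IR)))"
  proof (rule exI[of _ I], rule exI[of _ F], rule exI[of _ s0], rule exI[of _ t0], intro conjI allI impI)
    show "\<forall>i\<in>I. F i \<subseteq> P" using FP by blast
    show "finite I" by (simp add: I_def)
    show "(\<Sum>i\<in>I. card (F i)) \<le> 1000 * (n * d * B n d)" using FN Z unfolding Z_def[symmetric] by linarith
    show "exec w build_prog (build_input n d ps) t0 s0" by (rule ex)
    show "t0 \<le> 1000 * (n * d * B n d)" using t0 Z unfolding Z_def[symmetric] by linarith
  next
    fix s assume "after_queries w query_prog n d s0 s"
    then have s: "after_build n d X M b rt0 s" by (rule after)
    then have hiM: "\<And>a. ?B \<le> a \<Longrightarrow> mem s a = M a" and r2: "reg s 2 = b" unfolding after_build_def by blast+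
    have bB: "?B \<le> b" using recs_le[OF V(1)] .
    have dir: "stored_list (mem s) b = map (\<lambda>u. u + 7) V"
      using V(7,8) bB hiM by (intro nth_equalityI) (simp_all add: stored_list_def)
    show "stores_family w ps s I F"
      unfolding stores_family_def r2 dir Let_def length_map
    proof (intro conjI ballI)
      show "list_fits w (mem s) b" using bw V(7) hiM[OF bB] by (simp add: list_fits_def words_def)
      show "I = {..<length V}" by (rule I_def)
      fix i assume "i \<in> I"
      then have i: "i < length V" "V ! i \<in> set V" by (auto simp: I_def)
      define u where "u = V ! i"
      have ub: "?B \<le> u" "u + 8 + length (elems M u) \<le> b" using recs_bounds[OF V(1) i(2)] by (auto simp: u_def)
      have el: "elems (mem s) u = elems M u" using hiM ub(1) by (simp add: elems_def)
      have m7: "mem s (u + 7) = length (elems M u)" using hiM[of "u + 7"] ub(1) by (simp add: elems_def)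
      have mi: "map (\<lambda>u. u + 7) V ! i = u + 7" using i(1) by (simp add: u_def)
      show "list_fits w (mem s) (map (\<lambda>u. u + 7) V ! i)"
        using ub(2) bw m7 unfolding mi by (simp add: list_fits_def words_def)
      show "distinct (stored_list (mem s) (map (\<lambda>u. u + 7) V ! i))"
        "set (stored_list (mem s) (map (\<lambda>u. u + 7) V ! i)) \<subseteq> {..<length ps}"
        "F i = (!) ps ` set (stored_list (mem s) (map (\<lambda>u. u + 7) V ! i))"
        using V(4)[OF i(2)] unfolding mi stored_list_elems el len F_def by (auto simp: u_def)
    qed
    fix R q assume "axis_parallel_box d R" and R: "encodes_box d q R"
    from query[OF s, of q] obtain t s' out where e: "exec w query_prog (load_query n d q s) t s'"
      and Q: "query_inv n d q X M U [] out" and r3: "reg s' 3 = 2 * d"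
      and out: "mem s' (2 * d) = length out" "\<forall>i<length out. mem s' (2 * d + 1 + i) = number M (out ! i)"
      and lo: "length out \<le> node_visits d q X M lev rt0" and t: "t \<le> 60 * node_visits d q X M lev rt0 + 20"
      unfolding wp_def by blast
    have nv: "node_visits d q X M lev rt0 \<le> 2 * (2 ^ d * B n d)"
    proof -
      have "node_visits d q X M lev rt0 \<le> node_bound (lev rt0) (d + 1 - M rt0)"
        by (rule node_visits_le) (use rt0(2) d in simp_all)
      also have "\<dots> \<le> node_bound h d" using node_bound_mono[OF rt0(3)] rt0(2) by simp
      also have "\<dots> \<le> 2 * (2 ^ d * B n d)" by (simp add: node_bound_def B)
      finally show ?thesis .
    qed
    have p1: "1 \<le> 2 ^ d * B n d" using B1 by (simp add: Suc_le_eq One_nat_def)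
    have outU: "set out \<subseteq> U" and dc: "distinct (concat (map (elems M) out))"
      and cover: "{p. p < n \<and> (\<forall>k<d. in_dim q X k p)} \<subseteq> (\<Union>u\<in>set out. set (elems M u))"
      and sound: "\<And>u p. u \<in> set out \<Longrightarrow> p \<in> set (elems M u) \<Longrightarrow> \<forall>k<d. in_dim q X k p"
      using Q by (auto simp: query_inv_def)
    have "\<forall>u\<in>set out. elems M u \<noteq> []" using outU node by (auto simp: node_ok_def)
    from distinct_concat_map[OF dc this] have dout: "distinct out"
      and dis: "\<And>u v. u \<in> set out \<Longrightarrow> v \<in> set out \<Longrightarrow> u \<noteq> v \<Longrightarrow> set (elems M u) \<inter> set (elems M v) = {}"
      by blast+
    have num: "number M u < length V \<and> V ! number M u = u" if "u \<in> set V" for u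
      using that V(5) by (metis in_set_conv_nth)
    have outV: "set out \<subseteq> set V" using outU UV by blast
    define IR where "IR = number M ` set out"
    have st: "stored_list (mem s') (2 * d) = map (number M) out"
      using out by (intro nth_equalityI) (simp_all add: stored_list_def)
    have FI: "F (number M u) = (!) ps ` set (elems M u)" if "u \<in> set out" for u
      using num[of u] that outV by (auto simp: F_def)
    have "inj_on (number M) (set out)"
      by (rule inj_on_inverseI[where g = "(!) V"]) (use num outV in blast)
    have ret: "returns_indices w s' IR"
      unfolding returns_indices_def r3 st
    proof (intro conjI)
      show "list_fits w (mem s') (2 * d)" using length_stack[OF Q] ww(2) by (simp add: list_fits_def out words_def)
      show "distinct (map (number M) out)" using dout \<open>inj_on (number M) (set out)\<close> by (simp add: distinct_map)
    qed (simp add: IR_def)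
    have cardIR: "card IR \<le> length out" unfolding IR_def by (metis card_image_le card_length finite_set order.trans)
    have PR: "P \<inter> R = (\<Union>i\<in>IR. F i)"
    proof -
      have "(ps ! p \<in> R) \<longleftrightarrow> (\<forall>k<d. in_dim q X k p)" if "p < n" for p
      proof -
        have "ps ! p \<in> points d" using P(1) ps(1) that len nth_mem by blast
        then show ?thesis using R X[OF that] by (auto simp: encodes_box_def in_dim_def)
      qed
      then have "P \<inter> R = (!) ps ` {p. p < n \<and> (\<forall>k<d. in_dim q X k p)}" unfolding P_eq by auto
      also have "{p. p < n \<and> (\<forall>k<d. in_dim q X k p)} = (\<Union>u\<in>set out. set (elems M u))"
        using cover sound outV V(4) by blast
      also have "(!) ps ` \<dots> = (\<Union>i\<in>IR. F i)" using FI by (auto simp: IR_def)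
      finally show ?thesis .
    qed
    have disj: "disjoint_family_on F IR"
      unfolding disjoint_family_on_def
    proof (intro ballI impI)
      fix i j assume "i \<in> IR" "j \<in> IR" "i \<noteq> j"
      then obtain u v where uv: "u \<in> set out" "v \<in> set out" "i = number M u" "j = number M v" "u \<noteq> v"
        by (auto simp: IR_def)
      have "set (elems M u) \<subseteq> {..<n}" "set (elems M v) \<subseteq> {..<n}" using uv outV V(4) by blast+
      from inj_on_image_Int[OF inj this] show "F i \<inter> F j = {}" using dis[OF uv(1,2,5)] uv FI by simp
    qed
    show "\<exists>t s' IR. exec w query_prog (load_query n d q s) t s' \<and> t \<le> 1000 * (2 ^ d * B n d) \<and>
        returns_indices w s' IR \<and> IR \<subseteq> I \<and> card IR \<le> 1000 * (2 ^ d * B n d) \<and>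
        P \<inter> R = (\<Union>i\<in>IR. F i) \<and> disjoint_family_on F IR"
    proof (intro exI conjI)
      show "t \<le> 1000 * (2 ^ d * B n d)" using t nv p1 by linarith
      show "card IR \<le> 1000 * (2 ^ d * B n d)" using cardIR lo nv by linarith
      show "IR \<subseteq> I" using num outV by (auto simp: IR_def I_def)
    qed (fact e ret PR disj)+
  qed
qed

end
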